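(* Let $d\ge 2$ and $q\ge 2$ be integers and let $\beta\ge 0$. Let $\mu_\beta^{\varnothing}$ be the free state of the $q$-state Potts model on the Cayley tree $\mathbb{T}^d$ at inverse temperature $\beta$, let $\mathrm{ex}\,\mathscr{G}_\beta$ be the set of extremal Gibbs measures, and let $\lambda_{\mu_\beta^{\varnothing}}$ be the extremal decomposition measure of $\mu_\beta^{\varnothing}$. Then the following dichotomy holds: (i) either $\mu_\beta^{\varnothing}$ is extremal, i.e. $\mu_\beta^{\varnothing}\in \mathrm{ex}\,\mathscr{G}_\beta$; (ii) or $\lambda_{\mu_\beta^{\varnothing}}$ has no atoms, i.e. $\lambda_{\mu_\beta^{\varnothing}}(\{\nu\})=0$ for each $\nu\in\mathrm{ex}\,\mathscr{G}_\beta$. In particular, in this case the support of $\lambda_{\mu_\beta^{\varnothing}}$ contains uncountably many extremal measures.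
   Context: $\mathbb{T}^d$ is the Cayley tree with branching factor $d$, i.e. the infinite tree in which every vertex has degree $d+1$; $V(\mathbb{T}^d)$ is its vertex set, $u\sim v$ means that $uv$ is an edge, and $\Lambda\Subset V(\mathbb{T}^d)$ means that $\Lambda$ is a finite subset. Put $\Omega=\{1,\dots,q\}^{V(\mathbb{T}^d)}$ with the product $\sigma$-algebra. For $\Lambda\Subset V(\mathbb{T}^d)$ and $\eta\in\{1,\dots,q\}^{\Lambda^c}$ (or $\eta\in\Omega$, using only its restriction to $\Lambda^c$), the $q$-state Potts model on $\Lambda$ with boundary condition $\eta$ is the probability measure on $\{1,\dots,q\}^\Lambda$ $$\mu^{\eta}_{\Lambda,\beta}(\sigma)=\frac{1}{Z^{\eta}_{\Lambda,\beta}}\exp\Big[\beta\sum_{u,v\in\Lambda:\,u\sim v}\delta_{\sigma_u,\sigma_v}+\beta\sum_{u\in\Lambda,\,v\in\Lambda^c:\,u\sim v}\delta_{\sigma_u,\eta_v}\Big],$$ where $\delta$ is the Kronecker delta, each edge is counted once, and $Z^{\eta}_{\Lambda,\beta}$ is the normalizing constant. The measure $\mu_{\Lambda,\beta}^{\varnothing}$ with free boundary conditions is obtained by removing the second sum. The free state $\mu_\beta^{\varnothing}$ is the unique probability measure on $\Omega$ such that for each $\Lambda\Subset V(\mathbb{T}^d)$ inducing a connected subgraph and each $s\in\{1,\dots,q\}^\Lambda$, $\mu_\beta^{\varnothing}(\sigma_u=s_u\ \forall u\in\Lambda)=\mu^{\varnothing}_{\Lambda,\beta}(\sigma_u=s_u\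 \forall u\in\Lambda)$. A probability measure $\mu$ on $\Omega$ is a Gibbs measure if $\mu(A)=\int \mu_{\Lambda,\beta}^{\eta}(A)\,\mu(d\eta)$ for every $\Lambda\Subset V(\mathbb{T}^d)$ and every local event $A$ in $\Lambda$ (an event depending only on the spins in $\Lambda$). $\mathscr{G}_\beta$ is the set of all Gibbs measures; the free state belongs to it. $\mu\in\mathscr{G}_\beta$ is extremal if it cannot be written as $\mu=\lambda\mu_1+(1-\lambda)\mu_2$ with $\lambda\in(0,1)$ and $\mu_1\ne\mu_2\in\mathscr{G}_\beta$; $\mathrm{ex}\,\mathscr{G}_\beta$ is the set of extremal measures. For each $\mu\in\mathscr{G}_\beta$, $\lambda_\mu$ (the extremal decomposition measure) denotes the unique probability measure on $\mathrm{ex}\,\mathscr{G}_\beta$ (with the $\sigma$-algebra generated by the maps $\nu\mapsto\nu(B)$, $B$ an event) such that $\mu(\cdot)=\int_{\mathrm{ex}\,\mathscr{G}_\beta}\nu(\cdot)\,\lambda_\mu(d\nu)$; its existence and uniqueness is a standard fact. *)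

theory Defs
  imports "HOL-Probability.Probability"
begin

section \<open>Trees\<close>

text \<open>A graph on the vertex set \<open>UNIV :: 'v set\<close> is given by its set of edges,
  an edge being a two-element set of vertices.\<close>

definition simple_graph :: "'v set set \<Rightarrow> bool" where
  "simple_graph E \<longleftrightarrow> (\<forall>e\<in>E. card e = 2)"

definition connected_in :: "'v set set \<Rightarrow> 'v set \<Rightarrow> bool" where
  "connected_in E \<Lambda> \<longleftrightarrow>
     (\<forall>u\<in>\<Lambda>. \<forall>v\<in>\<Lambda>. (\<lambda>x y. x \<in> \<Lambda> \<and> y \<in> \<Lambda> \<and> {x, y} \<in> E)\<^sup>*\<^sup>* u v)"

definition is_cycle :: "'v set set \<Rightarrow> 'v list \<Rightarrow> bool" where
  "is_cycle E xs \<longleftrightarrow> length xs \<ge> 3 \<and> distinct xs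
     \<and> successively (\<lambda>x y. {x, y} \<in> E) xs \<and> {last xs, hd xs} \<in> E"

definition cayley_tree :: "nat \<Rightarrow> 'v set set \<Rightarrow> bool" where
  "cayley_tree d E \<longleftrightarrow> simple_graph E \<and> infinite (UNIV :: 'v set)
     \<and> connected_in E UNIV \<and> \<not> (\<exists>xs. is_cycle E xs)
     \<and> (\<forall>v. card {u. {u, v} \<in> E} = d + 1)"


section \<open>The Potts model\<close>

definition config_space :: "nat \<Rightarrow> ('v \<Rightarrow> nat) measure" where
  "config_space q = Pi\<^sub>M UNIV (\<lambda>_. count_space {1..q})"

abbreviation configs :: "nat \<Rightarrow> 'v set \<Rightarrow> ('v \<Rightarrow> nat) set" where
  "configs q \<Lambda> \<equiv> \<Lambda> \<rightarrow>\<^sub>E {1..q}"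

text \<open>Sums over edges inside \<open>\<Lambda>\<close> (as sets, so each is counted once) and over edges leaving
  \<open>\<Lambda>\<close> (as pairs with first component in \<open>\<Lambda>\<close>); \<open>of_bool\<close> is the Kronecker delta.\<close>

definition inner_energy :: "'v set set \<Rightarrow> 'v set \<Rightarrow> ('v \<Rightarrow> nat) \<Rightarrow> real" where
  "inner_energy E \<Lambda> \<sigma> =
     (\<Sum>e \<in> {e \<in> E. e \<subseteq> \<Lambda>}. of_bool (\<forall>u\<in>e. \<forall>v\<in>e. \<sigma> u = \<sigma> v))"

definition boundary_energy :: "'v set set \<Rightarrow> 'v set \<Rightarrow> ('v \<Rightarrow> nat) \<Rightarrow> ('v \<Rightarrow> nat) \<Rightarrow> real" where
  "boundary_energy E \<Lambda> \<eta> \<sigma> =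
     (\<Sum>(u, v) \<in> {(u, v). u \<in> \<Lambda> \<and> v \<notin> \<Lambda> \<and> {u, v} \<in> E}. of_bool (\<sigma> u = \<eta> v))"

text \<open>The probability measure on \<open>{1,\<dots>,q}\<^sup>\<Lambda>\<close> (for finite \<open>\<Lambda>\<close>) whose density is
  proportional to \<open>w\<close>.\<close>

definition normalized :: "nat \<Rightarrow> 'v set \<Rightarrow> (('v \<Rightarrow> nat) \<Rightarrow> real) \<Rightarrow> ('v \<Rightarrow> nat) measure" where
  "normalized q \<Lambda> w =
     point_measure (configs q \<Lambda>) (\<lambda>\<sigma>. ennreal (w \<sigma> / (\<Sum>\<tau> \<in> configs q \<Lambda>. w \<tau>)))"

definition potts :: "'v set set \<Rightarrow> nat \<Rightarrow> real \<Rightarrow> 'v set \<Rightarrow> ('v \<Rightarrow> nat) \<Rightarrow> ('v \<Rightarrow> nat) measure" where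
  "potts E q \<beta> \<Lambda> \<eta> =
     normalized q \<Lambda> (\<lambda>\<sigma>. exp (\<beta> * inner_energy E \<Lambda> \<sigma> + \<beta> * boundary_energy E \<Lambda> \<eta> \<sigma>))"

definition potts_free :: "'v set set \<Rightarrow> nat \<Rightarrow> real \<Rightarrow> 'v set \<Rightarrow> ('v \<Rightarrow> nat) measure" where
  "potts_free E q \<beta> \<Lambda> = normalized q \<Lambda> (\<lambda>\<sigma>. exp (\<beta> * inner_energy E \<Lambda> \<sigma>))"

definition config_prob :: "nat \<Rightarrow> ('v \<Rightarrow> nat) measure \<Rightarrow> bool" where
  "config_prob q \<mu> \<longleftrightarrow> prob_space \<mu> \<and> sets \<mu> = sets (config_space q)"

definition free_state :: "'v set set \<Rightarrow> nat \<Rightarrow> real \<Rightarrow> ('v \<Rightarrow> nat) measure \<Rightarrow> bool" where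
  "free_state E q \<beta> \<mu> \<longleftrightarrow> config_prob q \<mu>
     \<and> (\<forall>\<Lambda>. finite \<Lambda> \<longrightarrow> connected_in E \<Lambda> \<longrightarrow> (\<forall>s \<in> configs q \<Lambda>.
          emeasure \<mu> {\<omega> \<in> space (config_space q). \<forall>u\<in>\<Lambda>. \<omega> u = s u}
          = emeasure (potts_free E q \<beta> \<Lambda>) {\<sigma> \<in> configs q \<Lambda>. \<forall>u\<in>\<Lambda>. \<sigma> u = s u}))"

text \<open>The event that the configuration in \<open>\<Lambda>\<close> belongs to \<open>S \<subseteq> {1,\<dots>,q}\<^sup>\<Lambda>\<close>; every local
  event in \<open>\<Lambda>\<close> is of this form, and \<open>potts E q \<beta> \<Lambda> \<eta>\<close> assigns it the mass of \<open>S\<close>.\<close>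

definition cyl :: "nat \<Rightarrow> 'v set \<Rightarrow> ('v \<Rightarrow> nat) set \<Rightarrow> ('v \<Rightarrow> nat) set" where
  "cyl q \<Lambda> S = {\<omega> \<in> space (config_space q). restrict \<omega> \<Lambda> \<in> S}"

definition local_events :: "nat \<Rightarrow> ('v \<Rightarrow> nat) set set" where
  "local_events q = {cyl q \<Lambda> S | \<Lambda> S. finite \<Lambda> \<and> S \<subseteq> configs q \<Lambda>}"

definition gibbs :: "'v set set \<Rightarrow> nat \<Rightarrow> real \<Rightarrow> ('v \<Rightarrow> nat) measure set" where
  "gibbs E q \<beta> = {\<mu>. config_prob q \<mu>
     \<and> (\<forall>\<Lambda>. finite \<Lambda> \<longrightarrow> (\<forall>S \<subseteq> configs q \<Lambda>.
          emeasure \<mu> (cyl q \<Lambda> S) = (\<integral>\<^sup>+\<eta>. emeasure (potts E q \<beta> \<Lambda> \<eta>) S \<partial>\<mu>)))}"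

definition ex_gibbs :: "'v set set \<Rightarrow> nat \<Rightarrow> real \<Rightarrow> ('v \<Rightarrow> nat) measure set" where
  "ex_gibbs E q \<beta> = {\<mu> \<in> gibbs E q \<beta>.
     \<not> (\<exists>t::real. \<exists>\<mu>1 \<in> gibbs E q \<beta>. \<exists>\<mu>2 \<in> gibbs E q \<beta>. 0 < t \<and> t < 1 \<and> \<mu>1 \<noteq> \<mu>2
          \<and> (\<forall>B \<in> sets (config_space q).
               measure \<mu> B = t * measure \<mu>1 B + (1 - t) * measure \<mu>2 B))}"


section \<open>The extremal decomposition\<close>

text \<open>\<^const>\<open>prob_algebra\<close> carries the \<open>\<sigma>\<close>-algebra generated by the evaluation maps
  \<open>\<nu> \<mapsto> \<nu>(B)\<close>.\<close>

definition extremal_decomposition ::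
  "'v set set \<Rightarrow> nat \<Rightarrow> real \<Rightarrow> ('v \<Rightarrow> nat) measure \<Rightarrow> ('v \<Rightarrow> nat) measure measure \<Rightarrow> bool" where
  "extremal_decomposition E q \<beta> \<mu> L \<longleftrightarrow> prob_space L
     \<and> sets L = sets (restrict_space (prob_algebra (config_space q)) (ex_gibbs E q \<beta>))
     \<and> (\<forall>B \<in> sets (config_space q). emeasure \<mu> B = (\<integral>\<^sup>+\<nu>. emeasure \<nu> B \<partial>L))"

text \<open>The topology on a set \<open>X\<close> of probability measures of convergence on all local events.
  As there are finitely many spin values, this is the topology of weak convergence with respect
  to the product topology on configurations.\<close>

definition local_topology :: "nat \<Rightarrow> ('v \<Rightarrow> nat) measure set \<Rightarrow> ('v \<Rightarrow> nat) measure topology" where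
  "local_topology q X = pullback_topology X (\<lambda>\<nu>. \<lambda>A\<in>local_events q. measure \<nu> A)
     (product_topology (\<lambda>_. euclideanreal) (local_events q))"

text \<open>Requiring \<open>U \<notin> null_sets M\<close> rather than \<open>emeasure M U > 0\<close> is the same for measurable
  open sets, and does not discard non-measurable ones, to which \<open>emeasure\<close> assigns 0.\<close>

definition support_in :: "'a topology \<Rightarrow> 'a measure \<Rightarrow> 'a set" where
  "support_in T M = {x \<in> topspace T. \<forall>U. openin T U \<and> x \<in> U \<longrightarrow> U \<notin> null_sets M}"

end

theory Submission
  imports Defs
begin

text \<open>
  Call a probability measure balanced if it satisfies the detailed balance relations between
  cylinder events; this is equivalent to being Gibbs, and turns a density between two Gibbs measures
  into a function that is invariant under local modifications. Extremal measures are trivial on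
  invariant events, so two extremal measures with densities with respect to the free state are equal
  or their densities have disjoint supports.

  The free state is a Markov chain indexed by the tree whose transition kernel contracts towards the
  uniform distribution. Hence it is mixing along automorphisms that move a vertex further and
  further away. If an extremal \<open>\<nu>\<close> is absolutely continuous with respect to the free state, mixing
  prevents \<open>\<nu>\<close> from being singular to its far translates, so \<open>\<nu>\<close> is invariant under them; mixing
  once more shows that \<open>\<nu>\<close> is the free state. An atom of the decomposition measure is such a \<open>\<nu>\<close>.
\<close>

text \<open>Mixing along automorphisms yields a form of ergodicity, not triviality on tail events,
  so it leaves open whether the free state is extremal. What it excludes is a single component of
  positive weight that differs from the whole; hence a dichotomy. Detailed balance is the working
  form of the Gibbs property because it compares two cylinder probabilities and involves no integral
  over boundary conditions. It therefore passes by direct computation to mixtures, to conditioning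
  on invariant events and to images under automorphisms. The free state inherits it from its
  extremal components; the explicit finite-volume formula serves decorrelation and invariance. The
  tree enters in two ways: an outside vertex is joined to a connected set by at most one edge, which
  makes the partition function factorize, and all vertices look alike, which supplies the
  translations. Absence of atoms alone does not make the support uncountable: its complement is a
  union of possibly uncountably many null open sets, and a countable base is what shows this union
  to be null.\<close>

lemma rtranclp_imp_distinct_path:
  assumes "P\<^sup>*\<^sup>* x y"
  shows "\<exists>xs. xs \<noteq> [] \<and> hd xs = x \<and> last xs = y \<and> distinct xs \<and> successively P xs"
  using assms
proof (induction rule: rtranclp_induct)
  case base
  show ?case by (rule exI[of _ "[x]"]) simp
next
  case (step y z)
  then obtain xs where xs: "xs \<noteq> []" "hd xs = x" "last xs = y" "distinct xs" "successively P xs"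
    by blast
  show ?case
  proof (cases "z \<in> set xs")
    case True
    \<comment> \<open>The walk returns to a vertex already visited: erase the loop by cutting the
      path at that vertex.\<close>
    then obtain as bs where "xs = as @ z # bs" by (meson split_list)
    then show ?thesis using xs
      by (intro exI[of _ "as @ [z]"]) (auto simp: successively_append_iff hd_append split: if_splits)
  next
    case False
    then show ?thesis using xs step.hyps
      by (intro exI[of _ "xs @ [z]"]) (auto simp: successively_append_iff)
  qed
qed

lemma successively_set_closed:
  assumes "successively P xs" "\<And>x y. P x y \<Longrightarrow> y \<in> A" "hd xs \<in> A"
  shows "set xs \<subseteq> A"
  using assms
proof (induction xs)
  case (Cons a xs)
  then show ?case by (cases xs) auto
qed simp

subsection \<open>Connected sets and distances in a regular tree\<close>

locale regular_tree =
  fixes E :: "'v set set" and d :: nat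
  assumes tree: "cayley_tree d E" and d_pos: "d \<ge> 2"
begin

abbreviation adj :: "'v \<Rightarrow> 'v \<Rightarrow> bool" where
  "adj u v \<equiv> {u, v} \<in> E"

abbreviation step_in :: "'v set \<Rightarrow> 'v \<Rightarrow> 'v \<Rightarrow> bool" where
  "step_in \<Lambda> \<equiv> (\<lambda>x y. x \<in> \<Lambda> \<and> y \<in> \<Lambda> \<and> {x, y} \<in> E)"

lemma simple: "simple_graph E" and connected_UNIV: "connected_in E UNIV"
  and acyclic: "\<not> is_cycle E xs" and degree: "card {u. adj u v} = d + 1"
  using tree by (auto simp: cayley_tree_def)

lemma adj_sym: "adj u v \<longleftrightarrow> adj v u"
  by (simp add: insert_commute)

lemma not_adj_refl [simp]: "{u} \<notin> E"
  using simple by (force simp: simple_graph_def)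

lemma edge_cases:
  assumes "e \<in> E" obtains u v where "e = {u, v}" "u \<noteq> v"
  using assms simple by (auto simp: simple_graph_def card_2_iff)

lemma finite_nbrs: "finite {u. adj u v}"
  using degree[of v] by (intro card_ge_0_finite) simp

lemma step_in_sym: "(step_in \<Lambda>)\<^sup>*\<^sup>* x y \<Longrightarrow> (step_in \<Lambda>)\<^sup>*\<^sup>* y x"
  by (rule sympD[OF symp_rtranclp]) (auto simp: symp_def adj_sym)

lemma connected_inI:
  assumes "y \<in> \<Lambda>" "\<And>v. v \<in> \<Lambda> \<Longrightarrow> (step_in \<Lambda>)\<^sup>*\<^sup>* y v"
  shows "connected_in E \<Lambda>"
  unfolding connected_in_def using assms(2) by (blast intro: rtranclp_trans step_in_sym)

lemma connected_inD: "connected_in E \<Lambda> \<Longrightarrow> u \<in> \<Lambda> \<Longrightarrow> v \<in> \<Lambda> \<Longrightarrow> (step_in \<Lambda>)\<^sup>*\<^sup>* u v"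
  by (auto simp: connected_in_def)

lemma step_in_mono: "(step_in A)\<^sup>*\<^sup>* x y \<Longrightarrow> A \<subseteq> B \<Longrightarrow> (step_in B)\<^sup>*\<^sup>* x y"
  by (erule rtranclp_mono[THEN predicate2D, rotated]) auto

lemma connected_in_singleton: "connected_in E {v}"
  by (auto simp: connected_in_def)

lemma connected_in_Un:
  assumes "connected_in E A" "connected_in E B" "y \<in> A" "y \<in> B"
  shows "connected_in E (A \<union> B)"
proof (rule connected_inI[of y])
  show "(step_in (A \<union> B))\<^sup>*\<^sup>* y v" if "v \<in> A \<union> B" for v
  proof (cases "v \<in> A")
    case True
    show ?thesis
      by (rule step_in_mono[OF connected_inD[OF assms(1,3) True]]) simp
  next
    case False
    then have "v \<in> B" using that by simp
    show ?thesis
      by (rule step_in_mono[OF connected_inD[OF assms(2,4) \<open>v \<in> B\<close>]]) simp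
  qed
qed (use assms in auto)

lemma connected_in_insert:
  assumes "connected_in E A" "u \<in> A" "adj u v"
  shows "connected_in E (insert v A)"
proof -
  have "connected_in E {u, v}"
    by (rule connected_inI[of u]) (use assms in auto)
  from connected_in_Un[OF assms(1) this, of u] show ?thesis
    using assms by (simp add: insert_absorb)
qed

text \<open>Two neighbours of \<open>v\<close> in \<open>\<Lambda>\<close> would close a path inside \<open>\<Lambda>\<close> to a cycle through \<open>v\<close>.\<close>

lemma unique_attachment:
  assumes conn: "connected_in E \<Lambda>" and v: "v \<notin> \<Lambda>"
    and u: "u \<in> \<Lambda>" "adj u v" and u': "u' \<in> \<Lambda>" "adj u' v"
  shows "u = u'"
proof (rule ccontr)
  assume "u \<noteq> u'"
  from rtranclp_imp_distinct_path[OF connected_inD[OF conn u(1) u'(1)]]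
  obtain xs where xs: "xs \<noteq> []" "hd xs = u" "last xs = u'" "distinct xs" "successively (step_in \<Lambda>) xs"
    by blast
  have "set xs \<subseteq> \<Lambda>"
    using successively_set_closed[OF xs(5)] xs(2) u(1) by blast
  moreover have "successively adj xs"
    using xs(5) by (rule successively_mono) auto
  moreover have "length xs \<ge> 2"
    using xs \<open>u \<noteq> u'\<close> by (cases xs; cases "tl xs") auto
  ultimately have "is_cycle E (v # xs)"
    using xs u u' v by (auto simp: is_cycle_def successively_Cons adj_sym)
  then show False using acyclic by blast
qed

lemma edge_leaving:
  assumes "connected_in E \<Lambda>" "K \<subseteq> \<Lambda>" "y \<in> K" "K \<noteq> \<Lambda>"
  obtains u v where "u \<in> K" "v \<in> \<Lambda>" "v \<notin> K" "adj u v"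
proof -
  obtain z where z: "z \<in> \<Lambda>" "z \<notin> K" using assms by auto
  have "(step_in \<Lambda>)\<^sup>*\<^sup>* y z" using assms z by (auto dest: connected_inD)
  \<comment> \<open>If no edge left \<open>K\<close>, everything reachable from \<open>y\<close>
    inside \<open>\<Lambda>\<close> would stay in \<open>K\<close>.\<close>
  then have "z \<in> K" if "\<not> (\<exists>u v. u \<in> K \<and> v \<in> \<Lambda> \<and> v \<notin> K \<and> adj u v)"
    by (induction rule: rtranclp_induct) (use that assms in auto)
  then show ?thesis using z that by blast
qed

text \<open>Growth of a finite connected set leaf by leaf: each new vertex is attached by an edge to
  the current connected set, and by \<open>unique_attachment\<close> by no other. A maximal
  connected subset satisfying \<open>P\<close> must be all of \<open>\<Lambda>\<close>, since
  otherwise \<open>edge_leaving\<close> enlarges it.\<close>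

lemma connected_induct [consumes 3, case_names single insert]:
  assumes fin: "finite \<Lambda>" and conn: "connected_in E \<Lambda>" and y: "y \<in> \<Lambda>"
    and single: "P {y}"
    and insert: "\<And>K u v. K \<subseteq> \<Lambda> \<Longrightarrow> y \<in> K \<Longrightarrow> connected_in E K \<Longrightarrow> u \<in> K \<Longrightarrow> v \<in> \<Lambda> \<Longrightarrow> v \<notin> K
      \<Longrightarrow> adj u v \<Longrightarrow> P K \<Longrightarrow> P (insert v K)"
  shows "P \<Lambda>"
proof -
  define \<K> where "\<K> = {K. K \<subseteq> \<Lambda> \<and> y \<in> K \<and> connected_in E K \<and> P K}"
  have "finite \<K>" using fin unfolding \<K>_def by (auto intro: finite_subset[of _ "Pow \<Lambda>"])
  moreover have "{y} \<in> \<K>" using single y connected_in_singleton unfolding \<K>_def by simp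
  then have "\<K> \<noteq> {}" by blast
  ultimately obtain K where K: "K \<in> \<K>" "\<And>K'. K' \<in> \<K> \<Longrightarrow> K \<subseteq> K' \<Longrightarrow> K = K'"
    using finite_has_maximal[of \<K>] by blast
  have "K = \<Lambda>"
  proof (rule ccontr)
    assume "K \<noteq> \<Lambda>"
    then obtain u v where uv: "u \<in> K" "v \<in> \<Lambda>" "v \<notin> K" "adj u v"
      using edge_leaving[OF conn, of K y] K(1) unfolding \<K>_def by blast
    then have "Set.insert v K \<in> \<K>"
      using K(1) insert[of K u v] connected_in_insert[of K u v] unfolding \<K>_def by auto
    from K(2)[OF this] uv show False by auto
  qed
  then show ?thesis using K(1) unfolding \<K>_def by auto
qed

section \<open>Graph distance and finite balls\<close>

definition gdist :: "'v \<Rightarrow> 'v \<Rightarrow> nat" where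
  "gdist u v = (LEAST n. (adj ^^ n) u v)"

lemma gdist_walk: "(adj ^^ gdist u v) u v"
proof -
  have "adj\<^sup>*\<^sup>* u v" using connected_inD[OF connected_UNIV, of u v] by simp
  then obtain n where "(adj ^^ n) u v" by (auto simp: rtranclp_power)
  then show ?thesis unfolding gdist_def by (rule LeastI)
qed

lemma gdist_le: "(adj ^^ n) u v \<Longrightarrow> gdist u v \<le> n"
  unfolding gdist_def by (rule Least_le)

lemma gdist_refl [simp]: "gdist u u = 0"
  using gdist_le[of 0 u u] by simp

lemma gdist_eq_0 [simp]: "gdist u v = 0 \<longleftrightarrow> u = v"
  using gdist_walk[of u v] by auto

lemma gdist_triangle: "gdist u w \<le> gdist u v + gdist v w"
  using gdist_walk[of u v] gdist_walk[of v w]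
  by (intro gdist_le) (auto simp: relpowp_add)

lemma gdist_sym: "gdist u v = gdist v u"
proof -
  have "(adj ^^ n) v u" if "(adj ^^ n) u v" for n u v
    using that
  proof (induction n arbitrary: v)
    case (Suc n)
    then obtain w where w: "(adj ^^ n) u w" "adj w v" by auto
    from w(2) have "adj v w" by (simp add: adj_sym)
    then show ?case using Suc.IH[OF w(1)] by (rule relpowp_Suc_I2)
  qed simp
  then show ?thesis using gdist_walk gdist_le by (intro antisym) blast+
qed

lemma gdist_adj: "adj u v \<Longrightarrow> gdist u v = 1"
proof -
  assume "adj u v"
  then have "gdist u v \<le> 1" "gdist u v \<noteq> 0" using gdist_le[of 1 u v] by (auto simp: eq_OO)
  then show ?thesis by linarith
qed

lemma gdist_pred:
  assumes "gdist r v = Suc n" obtains w where "adj w v" "gdist r w = n"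
proof -
  from gdist_walk[of r v] assms obtain w where w: "(adj ^^ n) r w" "adj w v" by auto
  have "gdist r w \<le> n" using w gdist_le by auto
  moreover have "Suc n \<le> gdist r w + 1" using gdist_triangle[of r v w] w assms by (simp add: gdist_adj)
  ultimately show ?thesis using that[of w] w by simp
qed

definition gball :: "'v \<Rightarrow> nat \<Rightarrow> 'v set" where
  "gball r n = {v. gdist r v \<le> n}"

lemma gball_0 [simp]: "gball r 0 = {r}"
  by (auto simp: gball_def)

lemma center_in_gball [simp]: "r \<in> gball r n"
  by (auto simp: gball_def)

lemma gball_mono: "m \<le> n \<Longrightarrow> gball r m \<subseteq> gball r n"
  by (auto simp: gball_def)

lemma gball_Suc: "gball r (Suc n) \<subseteq> gball r n \<union> (\<Union>w\<in>gball r n. {v. adj v w})"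
proof
  fix v assume v: "v \<in> gball r (Suc n)"
  show "v \<in> gball r n \<union> (\<Union>w\<in>gball r n. {v. adj v w})"
  proof (cases "gdist r v = Suc n")
    case True
    then obtain w where "adj w v" "gdist r w = n" by (rule gdist_pred)
    then show ?thesis by (auto simp: gball_def adj_sym)
  qed (use v in \<open>auto simp: gball_def\<close>)
qed

lemma finite_gball: "finite (gball r n)"
proof (induction n)
  case (Suc n)
  then show ?case by (intro finite_subset[OF gball_Suc]) (auto intro: finite_nbrs)
qed simp

lemma connected_gball: "connected_in E (gball r n)"
proof (rule connected_inI[of r])
  show "(step_in (gball r n))\<^sup>*\<^sup>* r v" if "v \<in> gball r n" for v
    using that
  proof (induction "gdist r v" arbitrary: v)
    case (Suc m)
    from Suc(2)[symmetric] obtain w where w: "adj w v" "gdist r w = m" by (rule gdist_pred)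
    then have "w \<in> gball r n" using Suc by (auto simp: gball_def)
    then have "(step_in (gball r n))\<^sup>*\<^sup>* r w" using Suc w by auto
    then show ?case using w Suc \<open>w \<in> gball r n\<close> by (auto intro: rtranclp.rtrancl_into_rtrancl)
  qed simp
qed simp

lemma finite_subset_gball:
  assumes "finite A" obtains n where "A \<subseteq> gball r n"
proof
  show "A \<subseteq> gball r (Max (gdist r ` A))"
    using assms by (auto simp: gball_def)
qed

lemma countable_vertices: "countable (UNIV :: 'v set)"
proof -
  have "(UNIV :: 'v set) = (\<Union>n. gball undefined n)" by (auto simp: gball_def)
  also have "countable \<dots>" by (auto intro: countable_finite finite_gball)
  finally show ?thesis .
qed

subsection \<open>Vertex transitivity\<close>

definition par :: "'v \<Rightarrow> 'v \<Rightarrow> 'v" where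
  "par r v = (SOME w. adj w v \<and> Suc (gdist r w) = gdist r v)"

definition children :: "'v \<Rightarrow> 'v \<Rightarrow> 'v set" where
  "children r v = {u. u \<noteq> r \<and> par r u = v}"

lemma par: assumes "v \<noteq> r" shows "adj (par r v) v" "Suc (gdist r (par r v)) = gdist r v"
proof -
  obtain n where "gdist r v = Suc n" using assms by (cases "gdist r v") auto
  then have "\<exists>w. adj w v \<and> Suc (gdist r w) = gdist r v"
    by (metis gdist_pred)
  from someI_ex[OF this] show "adj (par r v) v" "Suc (gdist r (par r v)) = gdist r v"
    by (auto simp: par_def)
qed

text \<open>Let \<open>u\<close> be the end that is not farther from \<open>r\<close>. The ball of
  radius \<open>gdist r v - 1\<close> with \<open>u\<close> added is connected and misses
  \<open>v\<close>, and both \<open>u\<close> and \<open>par r v\<close> join it to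
  \<open>v\<close>; \<open>unique_attachment\<close> identifies them. This excludes edges between
  equal distances and makes the chosen parent the only possible one.\<close>

lemma adj_cases:
  assumes "adj u v"
  shows "(v \<noteq> r \<and> u = par r v) \<or> (u \<noteq> r \<and> v = par r u)"
proof -
  have *: "v \<noteq> r \<and> u = par r v" if "adj u v" "gdist r u \<le> gdist r v" for u v
  proof -
    have "u \<noteq> v" using that by auto
    have v: "v \<noteq> r" using that by auto
    then obtain n where n: "gdist r v = Suc n" by (cases "gdist r v") auto
    have p: "par r v \<in> gball r n" "v \<notin> gball r n" "adj (par r v) v"
      using par[OF v] n by (auto simp: gball_def)
    let ?K = "insert u (gball r n)"
    have "connected_in E ?K"
    proof (cases "u \<in> gball r n")
      case True
      then show ?thesis using connected_gball by (simp add: insert_absorb)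
    next
      case False
      then have "gdist r u = Suc n" using that n by (auto simp: gball_def)
      then obtain w where "adj w u" "gdist r w = n" by (rule gdist_pred)
      then show ?thesis by (intro connected_in_insert[OF connected_gball]) (auto simp: gball_def)
    qed
    from unique_attachment[OF this, of v u "par r v"] show ?thesis
      using p v \<open>u \<noteq> v\<close> \<open>adj u v\<close> by auto
  qed
  show ?thesis
    using *[of u v] *[of v u] assms by (cases "gdist r u \<le> gdist r v") (auto simp: adj_sym)
qed

lemma children_gdist: "u \<in> children r v \<Longrightarrow> gdist r u = Suc (gdist r v)"
  using par[of u r] by (auto simp: children_def)

lemma nbrs_eq: "{u. adj u v} = children r v \<union> (if v = r then {} else {par r v})"
proof (intro equalityI subsetI)
  fix u assume "u \<in> {u. adj u v}"
  then have "adj u v" by blast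
  from adj_cases[OF this, of r] show "u \<in> children r v \<union> (if v = r then {} else {par r v})"
    by (auto simp: children_def)
next
  fix u assume "u \<in> children r v \<union> (if v = r then {} else {par r v})"
  then consider "u \<noteq> r" "par r u = v" | "v \<noteq> r" "u = par r v"
    by (auto simp: children_def split: if_splits)
  then have "adj u v" using par(1) by cases (auto simp: adj_sym)
  then show "u \<in> {u. adj u v}" by blast
qed

lemma finite_children: "finite (children r v)"
  using finite_nbrs[of v] by (simp add: nbrs_eq[of v r])

lemma card_children: "card (children r v) = (if v = r then d + 1 else d)"
proof (cases "v = r")
  case True
  then show ?thesis using degree[of v] unfolding nbrs_eq[of v r] by simp
next
  case False
  have "par r v \<notin> children r v"
    using children_gdist[of "par r v" r v] par(2)[OF False] by auto
  then show ?thesis using degree[of v] False finite_children[of r v] unfolding nbrs_eq[of v r] by simp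
qed

definition child_map :: "'v \<Rightarrow> 'v \<Rightarrow> 'v \<Rightarrow> 'v \<Rightarrow> 'v \<Rightarrow> 'v" where
  "child_map r x u w = (SOME h. bij_betw h (children r u) (children x w))"

text \<open>The root has \<open>d + 1\<close> children and every other vertex has \<open>d\<close>,
  so the hypothesis says that the two sets of children have equal size.\<close>

lemma child_map:
  assumes "u = r \<longleftrightarrow> w = x"
  shows "bij_betw (child_map r x u w) (children r u) (children x w)"
  unfolding child_map_def
  by (rule someI_ex[of "\<lambda>h. bij_betw h _ _"], rule finite_same_card_bij) (use assms in \<open>auto simp: finite_children card_children\<close>)

text \<open>The automorphism is built downwards from the root: the children of a vertex go
  bijectively to the children of its image. The level is carried as an explicit recursion argument,
  and only the value at level \<open>gdist r v\<close> is meaningful; \<open>aut\<close> selects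
  it.\<close>

primrec aut_level :: "'v \<Rightarrow> 'v \<Rightarrow> nat \<Rightarrow> 'v \<Rightarrow> 'v" where
  "aut_level r x 0 v = x"
| "aut_level r x (Suc n) v = child_map r x (par r v) (aut_level r x n (par r v)) v"

definition aut :: "'v \<Rightarrow> 'v \<Rightarrow> 'v \<Rightarrow> 'v" where
  "aut r x v = aut_level r x (gdist r v) v"

lemma aut_root [simp]: "aut r x r = x"
  by (simp add: aut_def)

lemma aut_rec: "v \<noteq> r \<Longrightarrow> aut r x v = child_map r x (par r v) (aut r x (par r v)) v"
  using par(2)[of v r] by (cases "gdist r v") (auto simp: aut_def)

text \<open>The two facts need a joint induction on the depth: \<open>child_map\<close> is a
  bijection only if the parent is a root exactly when its image is one, and this is read off from
  the preserved distance of the parent.\<close>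

lemma gdist_aut: "gdist x (aut r x v) = gdist r v"
  and aut_in_children: "v \<noteq> r \<Longrightarrow> aut r x v \<in> children x (aut r x (par r v))"
proof -
  have "gdist x (aut r x v) = gdist r v \<and>
    (v \<noteq> r \<longrightarrow> aut r x v \<in> children x (aut r x (par r v)))"
  proof (induction "gdist r v" arbitrary: v)
    case (Suc n)
    then have v: "v \<noteq> r" by auto
    have n: "gdist r (par r v) = n" using par(2)[OF v] Suc by simp
    have "par r v = r \<longleftrightarrow> aut r x (par r v) = x"
      using Suc(1)[of "par r v"] n by (metis gdist_eq_0)
    from child_map[OF this] v have "aut r x v \<in> children x (aut r x (par r v))"
      by (auto simp: aut_rec children_def dest: bij_betwE)
    then show ?case using children_gdist Suc n by auto
  qed auto
  then show "gdist x (aut r x v) = gdist r v"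
    and "v \<noteq> r \<Longrightarrow> aut r x v \<in> children x (aut r x (par r v))" by auto
qed

lemma par_aut: "v \<noteq> r \<Longrightarrow> aut r x v \<noteq> x \<and> par x (aut r x v) = aut r x (par r v)"
  using aut_in_children[of v r x] by (auto simp: children_def)

lemma aut_child_map:
  "bij_betw (child_map r x u (aut r x u)) (children r u) (children x (aut r x u))"
  by (rule child_map) (metis aut_root par_aut)

lemma inj_aut: "inj (aut r x)"
proof (rule injI)
  show "u = v" if "aut r x u = aut r x v" for u v
    using that
  proof (induction "gdist r u" arbitrary: u v)
    case 0
    then show ?case by (metis aut_root gdist_eq_0 gdist_aut)
  next
    case (Suc n)
    have gv: "gdist r v = Suc n" using Suc gdist_aut by metis
    have uv: "u \<noteq> r" "v \<noteq> r" using Suc gv by auto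
    have "aut r x (par r u) = aut r x (par r v)"
      using par_aut[OF uv(1)] par_aut[OF uv(2)] Suc by metis
    then have p: "par r u = par r v" using Suc par(2)[OF uv(1)] by simp
    then have "child_map r x (par r u) (aut r x (par r u)) u = child_map r x (par r u) (aut r x (par r u)) v"
      using Suc(3) uv by (simp add: aut_rec)
    moreover have "u \<in> children r (par r u)" "v \<in> children r (par r u)"
      using uv p by (auto simp: children_def)
    ultimately show ?case using aut_child_map by (metis bij_betw_def inj_onD)
  qed
qed

lemma surj_aut: "surj (aut r x)"
proof -
  have "\<exists>v. w = aut r x v" for w
  proof (induction "gdist x w" arbitrary: w)
    case 0
    then show ?case by (metis aut_root gdist_eq_0)
  next
    case (Suc n)
    then have w: "w \<noteq> x" by auto
    then obtain u where u: "par x w = aut r x u" using Suc par(2)[OF w] by (metis Suc_inject)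
    have "w \<in> children x (aut r x u)" using w u by (auto simp: children_def)
    then obtain v where v: "v \<in> children r u" "w = child_map r x u (aut r x u) v"
      using aut_child_map by (metis bij_betw_def imageE)
    then show ?case by (intro exI[of _ v]) (auto simp: children_def aut_rec)
  qed
  then show ?thesis by auto
qed

lemma bij_aut: "bij (aut r x)"
  using inj_aut surj_aut by (rule bijI)

lemma adj_aut: "adj (aut r x u) (aut r x v) \<longleftrightarrow> adj u v"
proof
  show "adj (aut r x u) (aut r x v)" if "adj u v"
  proof -
    have *: "adj (aut r x (par r v)) (aut r x v)" if "v \<noteq> r" for v
      using par(1)[of "aut r x v" x] par_aut[OF that, of x] by simp
    show ?thesis using adj_cases[OF that, of r] * by (auto simp: adj_sym)
  qed
  show "adj u v" if "adj (aut r x u) (aut r x v)"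
  proof -
    have *: "adj u v" if "aut r x v \<noteq> x" "aut r x u = par x (aut r x v)" for u v
    proof -
      have "v \<noteq> r" using that by auto
      then have "u = par r v" using par_aut[of v r x] that inj_aut[of r x] by (auto dest: injD)
      then show ?thesis using par(1) \<open>v \<noteq> r\<close> by auto
    qed
    show ?thesis using adj_cases[OF that, of x] *[of v u] *[of u v] by (auto simp: adj_sym)
  qed
qed

lemma aut_gball: "aut r x ` gball r n = gball x n"
proof -
  have "w \<in> aut r x ` gball r n" if "w \<in> gball x n" for w
  proof -
    obtain v where "w = aut r x v" using surj_aut by (metis surjD)
    then show ?thesis using that gdist_aut by (auto simp: gball_def)
  qed
  then show ?thesis using gdist_aut by (auto simp: gball_def)
qed

section \<open>A geodesic ray from the root\<close>

text \<open>Used twice: its vertices are the targets of the translations, and its middle segment is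
  the bridge between two distant balls. Every step goes to a child, so the path is geodesic.\<close>

primrec ray :: "'v \<Rightarrow> nat \<Rightarrow> 'v" where
  "ray r 0 = r"
| "ray r (Suc n) = (SOME v. v \<in> children r (ray r n))"

lemma ray_children: "ray r (Suc n) \<in> children r (ray r n)"
proof -
  have "children r (ray r n) \<noteq> {}"
    using card_children[of r "ray r n"] d_pos by (metis add_eq_0_iff_both_eq_0 card.empty not_numeral_le_zero zero_neq_one)
  then show ?thesis by (simp add: some_in_eq)
qed

lemma adj_ray: "adj (ray r n) (ray r (Suc n))"
  using ray_children[of r n] par(1)[of "ray r (Suc n)" r] unfolding children_def by auto

lemma gdist_ray_root: "gdist r (ray r n) = n"
  by (induction n) (simp_all del: ray.simps(2) add: children_gdist[OF ray_children])

lemma gdist_ray: "m \<le> n \<Longrightarrow> gdist (ray r n) (ray r m) = n - m"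
proof (rule antisym)
  show "gdist (ray r n) (ray r m) \<le> n - m" if "m \<le> n"
    using that
  proof (induction n rule: dec_induct)
    case (step n)
    have "gdist (ray r (Suc n)) (ray r n) = 1"
      using adj_ray[of r n] by (intro gdist_adj) (simp add: adj_sym del: ray.simps)
    then show ?case using gdist_triangle[of "ray r (Suc n)" "ray r m" "ray r n"] step
      by (simp del: ray.simps)
  qed simp
  show "m \<le> n \<Longrightarrow> n - m \<le> gdist (ray r n) (ray r m)"
    using gdist_triangle[of r "ray r n" "ray r m"] by (simp add: gdist_ray_root gdist_sym)
qed

end

subsection \<open>Cylinder events\<close>

declare One_nat_def [simp del]

lemma space_config_space: "space (config_space q) = (\<Pi>\<^sub>E v\<in>UNIV. {1..q})"
  by (simp add: config_space_def space_PiM)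

lemma in_space_config_iff: "\<omega> \<in> space (config_space q) \<longleftrightarrow> (\<forall>v. \<omega> v \<in> {1..q})"
  by (auto simp: space_config_space)

lemma restrict_in_configs: "\<omega> \<in> space (config_space q) \<Longrightarrow> restrict \<omega> \<Lambda> \<in> configs q \<Lambda>"
  by (auto simp: in_space_config_iff)

lemma finite_configs: "finite \<Lambda> \<Longrightarrow> finite (configs q \<Lambda>)"
  by (intro finite_PiE) auto

lemma measurable_to_config_space:
  assumes "\<And>v. (\<lambda>x. f x v) \<in> measurable N (count_space {1..q})"
  shows "f \<in> measurable N (config_space q)"
  using measurable_PiM_single'[of UNIV "\<lambda>v x. f x v" N "\<lambda>_. count_space {1..q}"] assms
    measurable_space[OF assms]
  by (fastforce simp: config_space_def space_PiM PiE_iff)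

lemma measurable_spin [measurable]: "(\<lambda>\<omega>. \<omega> v) \<in> measurable (config_space q) (count_space {1..q})"
  unfolding config_space_def by (rule measurable_component_singleton) simp

lemma spin_event: "{\<omega> \<in> space (config_space q). \<omega> v = a} \<in> sets (config_space q)"
proof (cases "a \<in> {1..q}")
  case True
  have "(\<lambda>\<omega>. \<omega> v) -` {a} \<inter> space (config_space q) \<in> sets (config_space q)"
    by (rule measurable_sets[OF measurable_spin]) (use True in auto)
  then show ?thesis by (simp add: vimage_def Int_def conj_commute)
next
  case False
  then have "{\<omega> \<in> space (config_space q). \<omega> v = a} = {}" by (auto simp: in_space_config_iff)
  then show ?thesis by (metis sets.empty_sets)
qed

lemma cyl_singleton:
  assumes "s \<in> configs q \<Lambda>"
  shows "cyl q \<Lambda> {s} = {\<omega> \<in> space (config_space q). \<forall>v\<in>\<Lambda>. \<omega> v = s v}"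
  using assms unfolding cyl_def by (auto simp: fun_eq_iff PiE_iff extensional_def restrict_def)

lemma cyl_eq_UN: "cyl q \<Lambda> S = (\<Union>s\<in>S \<inter> configs q \<Lambda>. cyl q \<Lambda> {s})"
  using restrict_in_configs[of _ q \<Lambda>] by (auto simp: cyl_def)

lemma sets_cyl: assumes "finite \<Lambda>" shows "cyl q \<Lambda> S \<in> sets (config_space q)"
proof -
  have "cyl q \<Lambda> {s} \<in> sets (config_space q)" if "s \<in> configs q \<Lambda>" for s
    unfolding cyl_singleton[OF that]
    by (rule sets.sets_Collect_finite_All[OF _ assms]) (rule spin_event)
  then show ?thesis
    unfolding cyl_eq_UN[of q \<Lambda> S] using finite_configs[OF assms] by (intro sets.finite_UN) auto
qed

lemma cyl_subset_space: "cyl q \<Lambda> S \<subseteq> space (config_space q)"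
  by (auto simp: cyl_def)

lemma cyl_configs: "cyl q \<Lambda> (configs q \<Lambda>) = space (config_space q)"
  using restrict_in_configs[of _ q \<Lambda>] by (auto simp: cyl_def)

lemma cyl_Int: "cyl q \<Lambda> S \<inter> cyl q \<Lambda> S' = cyl q \<Lambda> (S \<inter> S')"
  by (auto simp: cyl_def)

lemma cyl_widen:
  assumes "\<Lambda> \<subseteq> \<Lambda>'"
  shows "cyl q \<Lambda> S = cyl q \<Lambda>' {s \<in> configs q \<Lambda>'. restrict s \<Lambda> \<in> S}"
proof -
  have "restrict (restrict \<omega> \<Lambda>') \<Lambda> = restrict \<omega> \<Lambda>" for \<omega> :: "'a \<Rightarrow> nat"
    using assms by (auto simp: restrict_def fun_eq_iff)
  then show ?thesis using restrict_in_configs[of _ q \<Lambda>'] unfolding cyl_def by auto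
qed

lemma emeasure_cyl_sum:
  assumes "sets M = sets (config_space q)" "finite \<Lambda>" "S \<subseteq> configs q \<Lambda>"
  shows "emeasure M (cyl q \<Lambda> S) = (\<Sum>s\<in>S. emeasure M (cyl q \<Lambda> {s}))"
proof -
  have "cyl q \<Lambda> S = (\<Union>s\<in>S. cyl q \<Lambda> {s})" using assms cyl_eq_UN[of q \<Lambda> S] by (simp add: Int_absorb2)
  moreover have "disjoint_family_on (\<lambda>s. cyl q \<Lambda> {s}) S" by (auto simp: disjoint_family_on_def cyl_def)
  moreover have "finite S" using assms finite_configs finite_subset by blast
  ultimately show ?thesis
    using sum_emeasure[of "\<lambda>s. cyl q \<Lambda> {s}" S M] assms sets_cyl[of \<Lambda> q] by (simp add: image_subset_iff)
qed

lemma sigma_local_events: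
  "sets (config_space q :: ('v \<Rightarrow> nat) measure) = sigma_sets (space (config_space q)) (local_events q)"
proof (rule equalityI)
  let ?\<Omega> = "space (config_space q :: ('v \<Rightarrow> nat) measure)"
  let ?R = "{{f \<in> ?\<Omega>. f v \<in> A} | v A. v \<in> (UNIV :: 'v set) \<and> A \<in> sets (count_space {1..q})}"
  have "sets (config_space q :: ('v \<Rightarrow> nat) measure) = sigma_sets ?\<Omega> ?R"
    unfolding space_config_space unfolding config_space_def sets_PiM_single by simp
  moreover have "?R \<subseteq> local_events q"
  proof
    fix X assume "X \<in> ?R"
    then obtain v A where X: "X = {f \<in> ?\<Omega>. f v \<in> A}" "A \<subseteq> {1..q}" by auto
    have "X = cyl q {v} {s \<in> configs q {v}. s v \<in> A}"
      using X restrict_in_configs[of _ q "{v}"] by (auto simp: cyl_def)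
    then show "X \<in> local_events q" unfolding local_events_def by blast
  qed
  ultimately show "sets (config_space q :: ('v \<Rightarrow> nat) measure) \<subseteq> sigma_sets ?\<Omega> (local_events q)"
    by (simp add: sigma_sets_subseteq)
  show "sigma_sets ?\<Omega> (local_events q) \<subseteq> sets (config_space q)"
    by (rule sets.sigma_sets_subset) (auto simp: local_events_def sets_cyl)
qed

lemma Int_stable_local_events: "Int_stable (local_events q)"
proof (rule Int_stableI)
  fix A B :: "('v \<Rightarrow> nat) set" assume "A \<in> local_events q" "B \<in> local_events q"
  then obtain \<Lambda> S \<Lambda>' S' where *: "A = cyl q \<Lambda> S" "B = cyl q \<Lambda>' S'" "finite \<Lambda>" "finite \<Lambda>'"
    unfolding local_events_def by blast
  let ?U = "\<Lambda> \<union> \<Lambda>'"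
  have "A \<inter> B = cyl q ?U ({s \<in> configs q ?U. restrict s \<Lambda> \<in> S} \<inter> {s \<in> configs q ?U. restrict s \<Lambda>' \<in> S'})"
    using * cyl_widen[of \<Lambda> ?U q S] cyl_widen[of \<Lambda>' ?U q S'] by (simp add: cyl_Int)
  then show "A \<inter> B \<in> local_events q" using * unfolding local_events_def by blast
qed

lemma local_events_subset: "local_events q \<subseteq> Pow (space (config_space q))"
  by (auto simp: local_events_def cyl_def)

lemma local_event_in_sets: "A \<in> local_events q \<Longrightarrow> A \<in> sets (config_space q)"
  by (auto simp: local_events_def sets_cyl)

lemma space_in_local_events: "space (config_space q) \<in> local_events q"
  unfolding local_events_def using cyl_configs[of q "{}"] by blast

text \<open>Every finite window lies in a member of \<open>\<F>\<close>, where a local event is a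
  finite disjoint union of cylinders over single configurations; these suffice by the pi-system
  argument. The freedom in \<open>\<F>\<close> matters because cylinder probabilities can often be
  computed only on special windows, such as balls or supersets of a given set.\<close>

lemma config_measure_eqI:
  fixes M N :: "('v \<Rightarrow> nat) measure"
  assumes sets: "sets M = sets (config_space q)" "sets N = sets (config_space q)"
    and fin: "finite_measure M"
    and cofinal: "\<And>\<Lambda>. finite \<Lambda> \<Longrightarrow> \<exists>\<Lambda>'\<in>\<F>. finite \<Lambda>' \<and> \<Lambda> \<subseteq> \<Lambda>'"
    and eq: "\<And>\<Lambda> s. \<Lambda> \<in> \<F> \<Longrightarrow> finite \<Lambda> \<Longrightarrow> s \<in> configs q \<Lambda>
      \<Longrightarrow> emeasure M (cyl q \<Lambda> {s}) = emeasure N (cyl q \<Lambda> {s})"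
  shows "M = N"
proof (rule measure_eqI_generator_eq[OF Int_stable_local_events local_events_subset])
  interpret finite_measure M by fact
  show "emeasure M X = emeasure N X" if X: "X \<in> local_events q" for X
  proof -
    obtain \<Lambda> S where X: "X = cyl q \<Lambda> S" "finite \<Lambda>" using X by (auto simp: local_events_def)
    then obtain \<Lambda>' where L: "\<Lambda>' \<in> \<F>" "finite \<Lambda>'" "\<Lambda> \<subseteq> \<Lambda>'" using cofinal by blast
    then show ?thesis unfolding X(1) cyl_widen[OF L(3)]
      by (subst (1 2) emeasure_cyl_sum) (auto intro!: sum.cong eq simp: sets)
  qed
  show "range (\<lambda>_. space (config_space q)) \<subseteq> local_events q"
    using space_in_local_events by auto
qed (use sets sigma_local_events finite_measure.emeasure_finite[OF fin] in auto)

lemma config_probD: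
  assumes "config_prob q \<nu>"
  shows "prob_space \<nu>" "sets \<nu> = sets (config_space q)" "space \<nu> = space (config_space q)"
  using assms sets_eq_imp_space_eq unfolding config_prob_def by blast+

subsection \<open>A detailed balance form of the Gibbs property\<close>

text \<open>Spins may differ only at vertices all of whose neighbours lie in
  \<open>\<Lambda>\<close>. Then no edge that leaves \<open>\<Lambda>\<close> notices the
  replacement of \<open>s\<close> by \<open>s'\<close>, whatever the configuration outside.\<close>

definition exchangeable :: "'v set set \<Rightarrow> nat \<Rightarrow> 'v set \<Rightarrow> ('v \<Rightarrow> nat) \<Rightarrow> ('v \<Rightarrow> nat) \<Rightarrow> bool" where
  "exchangeable E q \<Lambda> s s' \<longleftrightarrow> finite \<Lambda> \<and> s \<in> configs q \<Lambda> \<and> s' \<in> configs q \<Lambda>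
     \<and> (\<forall>u\<in>\<Lambda>. s u \<noteq> s' u \<longrightarrow> (\<forall>v. {u, v} \<in> E \<longrightarrow> v \<in> \<Lambda>))"

text \<open>The ratio of two Boltzmann weights, cross-multiplied so that no division in
  \<open>ennreal\<close> occurs. Only inner energies appear because the boundary energies of an
  exchangeable pair agree.\<close>

definition balanced :: "'v set set \<Rightarrow> nat \<Rightarrow> real \<Rightarrow> ('v \<Rightarrow> nat) measure \<Rightarrow> bool" where
  "balanced E q \<beta> \<nu> \<longleftrightarrow> (\<forall>\<Lambda> s s'. exchangeable E q \<Lambda> s s' \<longrightarrow>
     ennreal (exp (\<beta> * inner_energy E \<Lambda> s')) * emeasure \<nu> (cyl q \<Lambda> {s})
     = ennreal (exp (\<beta> * inner_energy E \<Lambda> s)) * emeasure \<nu> (cyl q \<Lambda> {s'}))"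

lemma exchangeable_sym: "exchangeable E q \<Lambda> s s' \<Longrightarrow> exchangeable E q \<Lambda> s' s"
  unfolding exchangeable_def by metis

lemma balancedD:
  "balanced E q \<beta> \<nu> \<Longrightarrow> exchangeable E q \<Lambda> s s' \<Longrightarrow>
    ennreal (exp (\<beta> * inner_energy E \<Lambda> s')) * emeasure \<nu> (cyl q \<Lambda> {s})
    = ennreal (exp (\<beta> * inner_energy E \<Lambda> s)) * emeasure \<nu> (cyl q \<Lambda> {s'})"
  unfolding balanced_def by blast

lemma emeasure_potts:
  assumes "finite \<Lambda>" "S \<subseteq> configs q \<Lambda>"
  shows "emeasure (potts E q \<beta> \<Lambda> \<eta>) S =
    (\<Sum>s\<in>S. ennreal (exp (\<beta> * inner_energy E \<Lambda> s + \<beta> * boundary_energy E \<Lambda> \<eta> s) /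
      (\<Sum>\<tau>\<in>configs q \<Lambda>. exp (\<beta> * inner_energy E \<Lambda> \<tau> + \<beta> * boundary_energy E \<Lambda> \<eta> \<tau>))))"
  unfolding potts_def normalized_def using assms finite_configs
  by (subst emeasure_point_measure_finite) auto

lemma measurable_boundary_energy [measurable]:
  "(\<lambda>\<eta>. boundary_energy E \<Lambda> \<eta> \<sigma>) \<in> borel_measurable (config_space q)"
proof -
  have "(\<lambda>\<eta>. of_bool (\<sigma> u = \<eta> v) :: real) \<in> borel_measurable (config_space q)" for u v
  proof -
    have "{\<omega> \<in> space (config_space q). \<sigma> u = \<omega> v} \<in> sets (config_space q)"
      using spin_event[of q v "\<sigma> u"] by (simp add: eq_commute)
    from borel_measurable_indicator[OF this]
    show ?thesis by (rule measurable_cong[THEN iffD1, rotated]) (auto simp: indicator_def)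
  qed
  then show ?thesis unfolding boundary_energy_def
    by (auto intro!: borel_measurable_sum)
qed

lemma measurable_emeasure_potts [measurable]:
  assumes "finite \<Lambda>" "S \<subseteq> configs q \<Lambda>"
  shows "(\<lambda>\<eta>. emeasure (potts E q \<beta> \<Lambda> \<eta>) S) \<in> borel_measurable (config_space q)"
  unfolding emeasure_potts[OF assms] by measurable

lemma gibbs_config_prob: "\<nu> \<in> gibbs E q \<beta> \<Longrightarrow> config_prob q \<nu>"
  by (simp add: gibbs_def)

lemma ex_gibbs_config_prob: "\<nu> \<in> ex_gibbs E q \<beta> \<Longrightarrow> config_prob q \<nu>"
  unfolding ex_gibbs_def by (blast intro: gibbs_config_prob)

text \<open>For each boundary condition the two Potts weights share the boundary energy and the
  partition function. The relation thus holds for every kernel and survives integration over the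
  boundary condition.\<close>

lemma gibbs_balanced:
  assumes "\<nu> \<in> gibbs E q \<beta>"
  shows "balanced E q \<beta> \<nu>"
  unfolding balanced_def
proof (intro allI impI)
  fix \<Lambda> s s' assume ex: "exchangeable E q \<Lambda> s s'"
  then have fin: "finite \<Lambda>" and s: "s \<in> configs q \<Lambda>" "s' \<in> configs q \<Lambda>"
    unfolding exchangeable_def by auto
  let ?H = "inner_energy E \<Lambda>" and ?w = "\<lambda>\<eta> s. exp (\<beta> * inner_energy E \<Lambda> s + \<beta> * boundary_energy E \<Lambda> \<eta> s)"
  have sets: "sets \<nu> = sets (config_space q)" using config_probD(2)[OF gibbs_config_prob[OF assms]] .
  have gibbs: "emeasure \<nu> (cyl q \<Lambda> {s}) = (\<integral>\<^sup>+\<eta>. emeasure (potts E q \<beta> \<Lambda> \<eta>) {s} \<partial>\<nu>)"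
    if "s \<in> configs q \<Lambda>" for s using assms fin that unfolding gibbs_def by simp
  have meas: "(\<lambda>\<eta>. emeasure (potts E q \<beta> \<Lambda> \<eta>) {s}) \<in> borel_measurable \<nu>" if "s \<in> configs q \<Lambda>" for s
    using measurable_emeasure_potts[of \<Lambda> "{s}" q E \<beta>] fin that unfolding measurable_cong_sets[OF sets refl] by simp
  have pt: "ennreal (exp (\<beta> * ?H s')) * emeasure (potts E q \<beta> \<Lambda> \<eta>) {s}
      = ennreal (exp (\<beta> * ?H s)) * emeasure (potts E q \<beta> \<Lambda> \<eta>) {s'}" for \<eta>
  proof -
    have "boundary_energy E \<Lambda> \<eta> s = boundary_energy E \<Lambda> \<eta> s'"
    proof -
      have "s u = s' u" if "u \<in> \<Lambda>" "v \<notin> \<Lambda>" "{u, v} \<in> E" for u v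
        using ex that unfolding exchangeable_def by blast
      then show ?thesis unfolding boundary_energy_def by (intro sum.cong) auto
    qed
    then have "exp (\<beta> * ?H s') * ?w \<eta> s = exp (\<beta> * ?H s) * ?w \<eta> s'"
      by (simp flip: exp_add add: algebra_simps)
    then have eq: "exp (\<beta> * ?H s') * (?w \<eta> s / Z) = exp (\<beta> * ?H s) * (?w \<eta> s' / Z)" for Z
      by (metis times_divide_eq_right)
    have Z: "(\<Sum>\<tau>\<in>configs q \<Lambda>. ?w \<eta> \<tau>) \<ge> 0" by (intro sum_nonneg) auto
    show ?thesis
      using s fin Z eq[of "\<Sum>\<tau>\<in>configs q \<Lambda>. ?w \<eta> \<tau>"] by (simp add: emeasure_potts flip: ennreal_mult)
  qed
  show "ennreal (exp (\<beta> * ?H s')) * emeasure \<nu> (cyl q \<Lambda> {s})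
      = ennreal (exp (\<beta> * ?H s)) * emeasure \<nu> (cyl q \<Lambda> {s'})"
    unfolding gibbs[OF s(1)] gibbs[OF s(2)]
    using meas[OF s(1)] meas[OF s(2)] pt by (simp flip: nn_integral_cmult)
qed

section \<open>Overwriting the spins in a finite window\<close>

definition impose :: "'v set \<Rightarrow> ('v \<Rightarrow> nat) \<Rightarrow> ('v \<Rightarrow> nat) \<Rightarrow> ('v \<Rightarrow> nat)" where
  "impose \<Lambda> s \<omega> = override_on \<omega> s \<Lambda>"

lemma measurable_impose [measurable]:
  assumes "s \<in> configs q \<Lambda>"
  shows "impose \<Lambda> s \<in> measurable (config_space q) (config_space q)"
proof (rule measurable_to_config_space)
  show "(\<lambda>\<omega>. impose \<Lambda> s \<omega> v) \<in> measurable (config_space q) (count_space {1..q})" for v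
  proof (cases "v \<in> \<Lambda>")
    case True
    then have "s v \<in> {1..q}" using assms by auto
    then show ?thesis using True by (auto simp: impose_def intro!: measurable_const)
  qed (auto simp: impose_def intro!: measurable_spin)
qed

lemma impose_impose: "s \<in> configs q \<Lambda> \<Longrightarrow> \<omega> \<in> cyl q \<Lambda> {s} \<Longrightarrow> impose \<Lambda> s (impose \<Lambda> s' \<omega>) = \<omega>"
  by (auto simp: cyl_singleton impose_def override_on_def)

lemma impose_in_cyl:
  assumes "s \<in> configs q \<Lambda>" "\<omega> \<in> space (config_space q)"
  shows "impose \<Lambda> s \<omega> \<in> cyl q \<Lambda> {s}"
  using assms unfolding cyl_singleton[OF assms(1)] by (auto simp: impose_def in_space_config_iff override_on_def)

lemma inner_energy_cong: "(\<And>v. v \<in> \<Lambda> \<Longrightarrow> s v = s' v) \<Longrightarrow> inner_energy E \<Lambda> s = inner_energy E \<Lambda> s'"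
  unfolding inner_energy_def by (intro sum.cong) (auto simp: subset_iff)

lemma finite_edges_in: "finite \<Lambda> \<Longrightarrow> finite {e \<in> E. e \<subseteq> \<Lambda>}"
  by (rule finite_subset[of _ "Pow \<Lambda>"]) auto

text \<open>Edges that are not inside \<open>\<Lambda>\<close> do not see the difference between \<open>s\<close> and \<open>s'\<close>.\<close>

lemma inner_energy_diff_widen:
  assumes E: "simple_graph E" and ex: "exchangeable E q \<Lambda> s s'" and fin: "finite \<Lambda>'" and sub: "\<Lambda> \<subseteq> \<Lambda>'"
    and t: "\<And>v. v \<in> \<Lambda> \<Longrightarrow> t v = s v" "\<And>v. v \<in> \<Lambda> \<Longrightarrow> t' v = s' v" "\<And>v. v \<notin> \<Lambda> \<Longrightarrow> t v = t' v"
  shows "inner_energy E \<Lambda>' t - inner_energy E \<Lambda>' t' = inner_energy E \<Lambda> s - inner_energy E \<Lambda> s'"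
proof -
  let ?f = "\<lambda>t e. of_bool (\<forall>u\<in>e. \<forall>v\<in>e. t u = (t v :: nat)) :: real"
  have "(\<Sum>e\<in>{e \<in> E. e \<subseteq> \<Lambda>'}. ?f t e - ?f t' e) = (\<Sum>e\<in>{e \<in> E. e \<subseteq> \<Lambda>}. ?f t e - ?f t' e)"
  proof (rule sum.mono_neutral_right)
    show "\<forall>e\<in>{e \<in> E. e \<subseteq> \<Lambda>'} - {e \<in> E. e \<subseteq> \<Lambda>}. ?f t e - ?f t' e = 0"
    proof
      fix e assume e: "e \<in> {e \<in> E. e \<subseteq> \<Lambda>'} - {e \<in> E. e \<subseteq> \<Lambda>}"
      then have "card e = 2" using E by (simp add: simple_graph_def)
      then obtain a b where ab: "e = {a, b}" unfolding card_2_iff by blast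
      have *: "t x = t' x" if "{x, y} \<in> E" "\<not> {x, y} \<subseteq> \<Lambda>" for x y
      proof (cases "x \<in> \<Lambda>")
        case True
        then have "y \<notin> \<Lambda>" using that by simp
        then have "s x = s' x" using ex True that(1) unfolding exchangeable_def by blast
        then show ?thesis using t True by simp
      qed (use t in simp)
      have "t a = t' a" "t b = t' b" using *[of a b] *[of b a] e ab by (auto simp: insert_commute)
      then show "?f t e - ?f t' e = 0" using ab by simp
    qed
  qed (use sub finite_edges_in[OF fin] in auto)
  moreover have "(\<Sum>e\<in>{e \<in> E. e \<subseteq> \<Lambda>}. ?f t e - ?f t' e) = inner_energy E \<Lambda> t - inner_energy E \<Lambda> t'"
    by (simp add: inner_energy_def sum_subtractf)
  moreover have "inner_energy E \<Lambda> t = inner_energy E \<Lambda> s" "inner_energy E \<Lambda> t' = inner_energy E \<Lambda> s'"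
    using t by (auto intro: inner_energy_cong)
  ultimately show ?thesis by (simp add: inner_energy_def sum_subtractf)
qed

text \<open>Only the difference of the exponents matters, so a balance relation can be moved between
  windows in which the energy differences coincide.\<close>

lemma exp_scale_eq:
  assumes "c1 - c2 = b1 - b2"
    and "ennreal (exp c1) * x = ennreal (exp c2) * y"
  shows "ennreal (exp b1) * x = ennreal (exp b2) * y"
proof -
  have b: "b1 = (b1 - c1) + c1" "b2 = (b1 - c1) + c2" using assms(1) by simp_all
  have "ennreal (exp b1) * x = ennreal (exp (b1 - c1)) * (ennreal (exp c1) * x)"
    by (subst b(1), subst exp_add) (simp add: ennreal_mult mult_ac)
  also have "\<dots> = ennreal (exp b2) * y"
    by (subst assms(2), subst b(2), subst exp_add) (simp add: ennreal_mult mult_ac)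
  finally show ?thesis .
qed

lemma emeasure_density_scaled:
  assumes "A \<in> sets M" "X \<in> sets M"
  shows "emeasure (density M (\<lambda>x. c * indicator A x)) X = c * emeasure M (A \<inter> X)"
proof -
  have "emeasure (density M (\<lambda>x. c * indicator A x)) X = (\<integral>\<^sup>+x. c * indicator (A \<inter> X) x \<partial>M)"
    using assms by (subst emeasure_density) (auto intro!: nn_integral_cong simp: indicator_def)
  also have "\<dots> = c * emeasure M (A \<inter> X)"
    using assms by (intro nn_integral_cmult_indicator) auto
  finally show ?thesis .
qed

text \<open>Up to the two Boltzmann factors, overwriting by \<open>s\<close> carries the part of
  \<open>\<nu>\<close> on the cylinder of \<open>s'\<close> to its part on the cylinder of
  \<open>s\<close>. This equality of finite measures is checked on cylinders over windows containing
  \<open>\<Lambda>\<close>, where the pair extended by common outside spins is again exchangeable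
  with the same energy difference.\<close>

lemma balanced_nn_integral:
  assumes E: "simple_graph E" and \<nu>: "config_prob q \<nu>" "balanced E q \<beta> \<nu>" and ex: "exchangeable E q \<Lambda> s s'"
    and F: "F \<in> borel_measurable (config_space q)"
  shows "ennreal (exp (\<beta> * inner_energy E \<Lambda> s')) * (\<integral>\<^sup>+\<omega>. F \<omega> * indicator (cyl q \<Lambda> {s}) \<omega> \<partial>\<nu>)
    = ennreal (exp (\<beta> * inner_energy E \<Lambda> s)) *
        (\<integral>\<^sup>+\<omega>. F (impose \<Lambda> s \<omega>) * indicator (cyl q \<Lambda> {s'}) \<omega> \<partial>\<nu>)"
proof -
  have fin: "finite \<Lambda>" and s: "s \<in> configs q \<Lambda>" "s' \<in> configs q \<Lambda>"
    using ex unfolding exchangeable_def by auto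
  interpret \<nu>: prob_space \<nu> using config_probD[OF \<nu>(1)] by simp
  have sets: "sets \<nu> = sets (config_space q)" and space: "space \<nu> = space (config_space q)"
    using config_probD[OF \<nu>(1)] by auto
  have cyl: "cyl q L S \<in> sets \<nu>" if "finite L" for L S using sets_cyl[OF that] sets by simp
  have imp: "impose \<Lambda> s \<in> measurable \<nu> (config_space q)"
    using measurable_impose[OF s(1)] measurable_cong_sets[OF sets refl] by blast
  let ?a = "ennreal (exp (\<beta> * inner_energy E \<Lambda> s'))" and ?b = "ennreal (exp (\<beta> * inner_energy E \<Lambda> s))"
  let ?M = "density \<nu> (\<lambda>\<omega>. ?a * indicator (cyl q \<Lambda> {s}) \<omega>)"
  let ?K = "density \<nu> (\<lambda>\<omega>. ?b * indicator (cyl q \<Lambda> {s'}) \<omega>)"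
  let ?N = "distr ?K (config_space q) (impose \<Lambda> s)"
  have M: "emeasure ?M X = ?a * emeasure \<nu> (cyl q \<Lambda> {s} \<inter> X)" if "X \<in> sets (config_space q)" for X
    using that sets by (intro emeasure_density_scaled cyl fin) simp
  have N0: "emeasure ?K X = ?b * emeasure \<nu> (cyl q \<Lambda> {s'} \<inter> X)" if "X \<in> sets (config_space q)" for X
    using that sets by (intro emeasure_density_scaled cyl fin) simp
  have N: "emeasure ?N X = ?b * emeasure \<nu> (cyl q \<Lambda> {s'} \<inter> impose \<Lambda> s -` X)" if "X \<in> sets (config_space q)" for X
  proof -
    have "emeasure ?N X = emeasure ?K (impose \<Lambda> s -` X \<inter> space \<nu>)"
      using that imp by (subst emeasure_distr) auto
    also have "\<dots> = ?b * emeasure \<nu> (cyl q \<Lambda> {s'} \<inter> (impose \<Lambda> s -` X \<inter> space \<nu>))"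
      using measurable_sets[OF imp that] by (subst N0) (auto simp: sets)
    also have "cyl q \<Lambda> {s'} \<inter> (impose \<Lambda> s -` X \<inter> space \<nu>) = cyl q \<Lambda> {s'} \<inter> impose \<Lambda> s -` X"
      using cyl_subset_space space by auto
    finally show ?thesis .
  qed
  have "?M = ?N"
  proof (rule config_measure_eqI[where q = q and \<F> = "{\<Lambda>'. \<Lambda> \<subseteq> \<Lambda>'}"])
    show "finite_measure ?M"
      by (rule finite_measureI) (use M[of "space (config_space q)"] space in \<open>simp add: ennreal_mult_eq_top_iff\<close>)
    show "\<exists>\<Lambda>''\<in>{\<Lambda>'. \<Lambda> \<subseteq> \<Lambda>'}. finite \<Lambda>'' \<and> L \<subseteq> \<Lambda>''" if "finite L" for L
      using that fin by (intro bexI[of _ "\<Lambda> \<union> L"]) auto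
    fix \<Lambda>' t assume L: "\<Lambda>' \<in> {\<Lambda>'. \<Lambda> \<subseteq> \<Lambda>'}" "finite \<Lambda>'" and t: "t \<in> configs q \<Lambda>'"
    show "emeasure ?M (cyl q \<Lambda>' {t}) = emeasure ?N (cyl q \<Lambda>' {t})"
    proof (cases "\<forall>v\<in>\<Lambda>. t v = s v")
      case True
      \<comment> \<open>\<open>t'\<close> carries \<open>s'\<close> on \<open>\<Lambda>\<close> and
        the spins of \<open>t\<close> elsewhere: overwriting by \<open>s\<close> turns it back into
        \<open>t\<close>.\<close>
      define t' where "t' = override_on t s' \<Lambda>"
      have t': "t' \<in> configs q \<Lambda>'"
        using t s L by (auto simp: t'_def override_on_def PiE_iff extensional_def)
      have 1: "cyl q \<Lambda> {s} \<inter> cyl q \<Lambda>' {t} = cyl q \<Lambda>' {t}"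
        using True L unfolding cyl_singleton[OF t] cyl_singleton[OF s(1)] by auto
      have 2: "cyl q \<Lambda> {s'} \<inter> impose \<Lambda> s -` cyl q \<Lambda>' {t} = cyl q \<Lambda>' {t'}"
      proof (intro equalityI subsetI)
        fix \<omega> assume "\<omega> \<in> cyl q \<Lambda> {s'} \<inter> impose \<Lambda> s -` cyl q \<Lambda>' {t}"
        then show "\<omega> \<in> cyl q \<Lambda>' {t'}"
          using L unfolding cyl_singleton[OF t] cyl_singleton[OF t'] cyl_singleton[OF s(2)]
          by (auto simp: t'_def impose_def override_on_def)
      next
        fix \<omega> assume w: "\<omega> \<in> cyl q \<Lambda>' {t'}"
        then have "impose \<Lambda> s \<omega> \<in> space (config_space q)"
          using impose_in_cyl[OF s(1)] cyl_subset_space by blast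
        with w show "\<omega> \<in> cyl q \<Lambda> {s'} \<inter> impose \<Lambda> s -` cyl q \<Lambda>' {t}"
          using True L unfolding cyl_singleton[OF t] cyl_singleton[OF t'] cyl_singleton[OF s(2)]
          by (auto simp: t'_def impose_def override_on_def)
      qed
      have ex': "exchangeable E q \<Lambda>' t t'"
        using ex t t' L True unfolding exchangeable_def by (auto simp: t'_def override_on_def)
      have diff: "inner_energy E \<Lambda>' t' - inner_energy E \<Lambda>' t = inner_energy E \<Lambda> s' - inner_energy E \<Lambda> s"
        using exchangeable_sym[OF ex] L True
        by (intro inner_energy_diff_widen[OF E, of q]) (auto simp: t'_def override_on_def)
      show ?thesis
        using exp_scale_eq[OF _ balancedD[OF \<nu>(2) ex']] diff
        by (simp add: M N sets_cyl[OF L(2)] 1 2 flip: right_diff_distrib)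
    next
      \<comment> \<open>The pattern \<open>t\<close> contradicts \<open>s\<close> on
        \<open>\<Lambda>\<close>, so both measures give its cylinder mass 0.\<close>
      case False
      then obtain v where v: "v \<in> \<Lambda>" "t v \<noteq> s v" "v \<in> \<Lambda>'" using L by auto
      have "cyl q \<Lambda> {s} \<inter> cyl q \<Lambda>' {t} = {}"
        using v L unfolding cyl_singleton[OF t] cyl_singleton[OF s(1)] by auto
      moreover have "cyl q \<Lambda> {s'} \<inter> impose \<Lambda> s -` cyl q \<Lambda>' {t} = {}"
        using v L unfolding cyl_singleton[OF t] by (auto simp: impose_def override_on_def)
      ultimately show ?thesis by (simp add: M N sets_cyl[OF L(2)])
    qed
  qed (simp_all add: sets)
  then have eq: "(\<integral>\<^sup>+\<omega>. F \<omega> \<partial>?M) = (\<integral>\<^sup>+\<omega>. F \<omega> \<partial>?N)" by simp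
  have F': "F \<in> borel_measurable \<nu>" using F measurable_cong_sets[OF sets refl] by blast
  have FI: "(\<lambda>\<omega>. F (impose \<Lambda> s \<omega>)) \<in> borel_measurable \<nu>"
    using measurable_compose[OF imp F] .
  have "(\<integral>\<^sup>+\<omega>. F \<omega> \<partial>?M) = (\<integral>\<^sup>+\<omega>. ?a * (F \<omega> * indicator (cyl q \<Lambda> {s}) \<omega>) \<partial>\<nu>)"
    using F' cyl[OF fin] by (subst nn_integral_density) (auto simp: mult_ac)
  also have "\<dots> = ?a * (\<integral>\<^sup>+\<omega>. F \<omega> * indicator (cyl q \<Lambda> {s}) \<omega> \<partial>\<nu>)"
    using F' cyl[OF fin] by (intro nn_integral_cmult) auto
  finally have 1: "(\<integral>\<^sup>+\<omega>. F \<omega> \<partial>?M) = \<dots>" .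
  have "(\<integral>\<^sup>+\<omega>. F \<omega> \<partial>?N) = (\<integral>\<^sup>+\<omega>. F (impose \<Lambda> s \<omega>) \<partial>?K)"
    using F imp by (intro nn_integral_distr) auto
  also have "\<dots> = (\<integral>\<^sup>+\<omega>. ?b * (F (impose \<Lambda> s \<omega>) * indicator (cyl q \<Lambda> {s'}) \<omega>) \<partial>\<nu>)"
    using FI cyl[OF fin] by (subst nn_integral_density) (auto simp: mult_ac)
  also have "\<dots> = ?b * (\<integral>\<^sup>+\<omega>. F (impose \<Lambda> s \<omega>) * indicator (cyl q \<Lambda> {s'}) \<omega> \<partial>\<nu>)"
    using FI cyl[OF fin] by (intro nn_integral_cmult) auto
  finally show ?thesis using eq 1 by simp
qed

lemma balanced_emeasure:
  assumes E: "simple_graph E" and \<nu>: "config_prob q \<nu>" "balanced E q \<beta> \<nu>" and ex: "exchangeable E q \<Lambda> s s'"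
    and B: "B \<in> sets (config_space q)"
  shows "ennreal (exp (\<beta> * inner_energy E \<Lambda> s')) * emeasure \<nu> (cyl q \<Lambda> {s} \<inter> B)
    = ennreal (exp (\<beta> * inner_energy E \<Lambda> s)) * emeasure \<nu> (cyl q \<Lambda> {s'} \<inter> impose \<Lambda> s -` B)"
proof -
  have fin: "finite \<Lambda>" and s: "s \<in> configs q \<Lambda>"
    using ex unfolding exchangeable_def by auto
  have sets: "sets \<nu> = sets (config_space q)" and space: "space \<nu> = space (config_space q)"
    using config_probD[OF \<nu>(1)] by auto
  have "impose \<Lambda> s -` B \<inter> space (config_space q) \<in> sets \<nu>"
    using measurable_sets[OF measurable_impose[OF s] B] sets by simp
  moreover have "cyl q \<Lambda> {s'} \<inter> impose \<Lambda> s -` B = cyl q \<Lambda> {s'} \<inter> (impose \<Lambda> s -` B \<inter> space (config_space q))"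
    using cyl_subset_space by auto
  ultimately have m: "cyl q \<Lambda> {s} \<inter> B \<in> sets \<nu>" "cyl q \<Lambda> {s'} \<inter> impose \<Lambda> s -` B \<in> sets \<nu>"
    using sets_cyl[OF fin] B sets by auto
  have "(\<integral>\<^sup>+\<omega>. indicator B \<omega> * indicator (cyl q \<Lambda> {s}) \<omega> \<partial>\<nu>) = emeasure \<nu> (cyl q \<Lambda> {s} \<inter> B)"
    unfolding nn_integral_indicator[OF m(1), symmetric]
    by (intro nn_integral_cong) (auto simp: indicator_def)
  moreover have "(\<integral>\<^sup>+\<omega>. indicator B (impose \<Lambda> s \<omega>) * indicator (cyl q \<Lambda> {s'}) \<omega> \<partial>\<nu>)
      = emeasure \<nu> (cyl q \<Lambda> {s'} \<inter> impose \<Lambda> s -` B)"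
    unfolding nn_integral_indicator[OF m(2), symmetric]
    by (intro nn_integral_cong) (auto simp: indicator_def)
  ultimately show ?thesis
    using balanced_nn_integral[OF E \<nu> ex borel_measurable_indicator[OF B]] by simp
qed

section \<open>Comparison of probability measures and splitting of windows\<close>

text \<open>Total mass 1 on both sides turns the inequality for the complement into the reverse
  inequality. Hence an almost sure order between two probability densities already makes them
  densities of the same measure.\<close>

lemma prob_measure_eqI_le:
  assumes "prob_space M" "prob_space N" "sets M = sets N"
    and le: "\<And>A. A \<in> sets M \<Longrightarrow> emeasure M A \<le> emeasure N A"
  shows "M = N"
proof (rule measure_eqI)
  interpret M: prob_space M by fact
  interpret N: prob_space N by fact
  fix A assume A: "A \<in> sets M"
  have sp: "space M = space N" using assms(3) by (rule sets_eq_imp_space_eq)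
  have "M.prob A \<le> N.prob A" using le[OF A] by (simp add: M.emeasure_eq_measure N.emeasure_eq_measure)
  moreover have "M.prob (space M - A) \<le> N.prob (space N - A)"
    using le[OF sets.compl_sets[OF A]]
    unfolding M.emeasure_eq_measure N.emeasure_eq_measure sp by (simp add: measure_nonneg)
  then have "1 - M.prob A \<le> 1 - N.prob A"
    using A assms(3) by (simp add: M.prob_compl N.prob_compl)
  ultimately show "emeasure M A = emeasure N A"
    by (simp add: M.emeasure_eq_measure N.emeasure_eq_measure)
qed (rule assms)

lemma density_eqI_le:
  assumes f: "f \<in> borel_measurable M" "g \<in> borel_measurable M"
    and "prob_space (density M f)" "prob_space (density M g)" and le: "AE x in M. f x \<le> g x"
  shows "density M f = density M g"
proof (rule prob_measure_eqI_le)
  fix A assume "A \<in> sets (density M f)"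
  then show "emeasure (density M f) A \<le> emeasure (density M g) A"
    using f le by (auto simp: emeasure_density intro!: nn_integral_mono_AE mult_right_mono)
qed (use assms in auto)

lemma merge_in_configs: "s \<in> configs q A \<Longrightarrow> t \<in> configs q B \<Longrightarrow> merge A B (s, t) \<in> configs q (A \<union> B)"
  by (auto simp: merge_def PiE_iff extensional_def)

lemma emeasure_cyl_merge:
  assumes sets: "sets M = sets (config_space q)" and fin: "finite A" "finite B" and disj: "A \<inter> B = {}"
  shows "s \<in> configs q A \<Longrightarrow> emeasure M (cyl q A {s}) = (\<Sum>t\<in>configs q B. emeasure M (cyl q (A \<union> B) {merge A B (s, t)}))"
    and "t \<in> configs q B \<Longrightarrow> emeasure M (cyl q B {t}) = (\<Sum>s\<in>configs q A. emeasure M (cyl q (A \<union> B) {merge A B (s, t)}))"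
proof -
  have rA: "restrict (merge A B (s, t)) A = s" if "s \<in> configs q A" for s t
    using that by (auto simp: merge_def fun_eq_iff PiE_iff extensional_def)
  have rB: "restrict (merge A B (s, t)) B = t" if "t \<in> configs q B" for s t
    using that disj by (auto simp: merge_def fun_eq_iff PiE_iff extensional_def)
  have mm: "merge A B (restrict x A, restrict x B) = x" if "x \<in> configs q (A \<union> B)" for x
    using that by (auto simp: merge_def fun_eq_iff PiE_iff extensional_def)
  have res: "restrict x A \<in> configs q A" "restrict x B \<in> configs q B" if "x \<in> configs q (A \<union> B)" for x
    using that by (auto simp: PiE_iff)
  show "emeasure M (cyl q A {s}) = (\<Sum>t\<in>configs q B. emeasure M (cyl q (A \<union> B) {merge A B (s, t)}))"
    if s: "s \<in> configs q A"
  proof -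
    have "{x \<in> configs q (A \<union> B). restrict x A \<in> {s}} = (\<lambda>t. merge A B (s, t)) ` configs q B"
    proof (intro equalityI subsetI)
      fix x assume "x \<in> {x \<in> configs q (A \<union> B). restrict x A \<in> {s}}"
      then show "x \<in> (\<lambda>t. merge A B (s, t)) ` configs q B"
        using mm[of x] res(2)[of x] by (intro image_eqI[of _ _ "restrict x B"]) simp_all
    next
      fix x assume "x \<in> (\<lambda>t. merge A B (s, t)) ` configs q B"
      then show "x \<in> {x \<in> configs q (A \<union> B). restrict x A \<in> {s}}"
        using merge_in_configs[OF s] rA[OF s] by blast
    qed
    moreover have "inj_on (\<lambda>t. merge A B (s, t)) (configs q B)"
      using rB by (intro inj_onI) metis
    ultimately show ?thesis
      using merge_in_configs[OF s] unfolding cyl_widen[OF Un_upper1, of q A "{s}" B]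
      by (subst emeasure_cyl_sum[OF sets]) (auto simp: fin sum.reindex)
  qed
  show "emeasure M (cyl q B {t}) = (\<Sum>s\<in>configs q A. emeasure M (cyl q (A \<union> B) {merge A B (s, t)}))"
    if t: "t \<in> configs q B"
  proof -
    have "{x \<in> configs q (A \<union> B). restrict x B \<in> {t}} = (\<lambda>s. merge A B (s, t)) ` configs q A"
    proof (intro equalityI subsetI)
      fix x assume "x \<in> {x \<in> configs q (A \<union> B). restrict x B \<in> {t}}"
      then show "x \<in> (\<lambda>s. merge A B (s, t)) ` configs q A"
        using mm[of x] res(1)[of x] by (intro image_eqI[of _ _ "restrict x A"]) simp_all
    next
      fix x assume "x \<in> (\<lambda>s. merge A B (s, t)) ` configs q A"
      then show "x \<in> {x \<in> configs q (A \<union> B). restrict x B \<in> {t}}"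
        using merge_in_configs[OF _ t] rB[OF t] by blast
    qed
    moreover have "inj_on (\<lambda>s. merge A B (s, t)) (configs q A)"
      using rA by (intro inj_onI) metis
    ultimately show ?thesis
      using merge_in_configs[OF _ t] unfolding cyl_widen[OF Un_upper2, of q B "{t}" A]
      by (subst emeasure_cyl_sum[OF sets]) (auto simp: fin sum.reindex)
  qed
qed

lemma impose_in_space:
  "s \<in> configs q \<Lambda> \<Longrightarrow> \<omega> \<in> space (config_space q) \<Longrightarrow> impose \<Lambda> s \<omega> \<in> space (config_space q)"
  using impose_in_cyl cyl_subset_space by blast

section \<open>From detailed balance back to the Gibbs property\<close>

context regular_tree
begin

definition outer :: "'v set \<Rightarrow> 'v set" where
  "outer \<Lambda> = {v. v \<notin> \<Lambda> \<and> (\<exists>u\<in>\<Lambda>. adj u v)}"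

lemma finite_outer: "finite \<Lambda> \<Longrightarrow> finite (outer \<Lambda>)"
proof (rule finite_subset)
  show "outer \<Lambda> \<subseteq> (\<Union>u\<in>\<Lambda>. {v. adj v u})" by (auto simp: outer_def insert_commute)
qed (intro finite_UN_I finite_nbrs)

lemma outer_disjoint: "\<Lambda> \<inter> outer \<Lambda> = {}"
  by (auto simp: outer_def)

text \<open>The edges split into those inside \<open>\<Lambda>\<close>, those crossing to
  \<open>outer \<Lambda>\<close>, and those inside \<open>outer \<Lambda>\<close>. A crossing edge
  has exactly one orientation starting in \<open>\<Lambda>\<close>, which matches it with a pair
  counted by \<open>boundary_energy\<close>. The last summand depends on \<open>t\<close> alone and
  cancels in balance relations.\<close>

lemma inner_energy_merge:
  assumes fin: "finite \<Lambda>"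
  shows "inner_energy E (\<Lambda> \<union> outer \<Lambda>) (merge \<Lambda> (outer \<Lambda>) (s, t)) =
    inner_energy E \<Lambda> s + boundary_energy E \<Lambda> t s + inner_energy E (outer \<Lambda>) t"
proof -
  let ?D = "outer \<Lambda>" and ?\<sigma> = "merge \<Lambda> (outer \<Lambda>) (s, t)"
  let ?f = "\<lambda>e. of_bool (\<forall>u\<in>e. \<forall>v\<in>e. ?\<sigma> u = ?\<sigma> v) :: real"
  let ?P = "{(u, v). u \<in> \<Lambda> \<and> v \<notin> \<Lambda> \<and> adj u v}"
  let ?C = "{e \<in> E. e \<subseteq> \<Lambda> \<union> ?D \<and> \<not> e \<subseteq> \<Lambda> \<and> \<not> e \<subseteq> ?D}"
  have fin': "finite (\<Lambda> \<union> ?D)" using fin finite_outer by simp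
  have \<sigma>\<Lambda>: "?\<sigma> v = s v" if "v \<in> \<Lambda>" for v using that by (simp add: merge_def)
  have \<sigma>D: "?\<sigma> v = t v" if "v \<in> ?D" for v using that by (auto simp: merge_def outer_def)
  have PD: "v \<in> ?D" if "u \<in> \<Lambda>" "v \<notin> \<Lambda>" "adj u v" for u v using that by (auto simp: outer_def)
  have bij: "bij_betw (\<lambda>(u, v). {u, v}) ?P ?C"
  proof (rule bij_betw_imageI)
    show "inj_on (\<lambda>(u, v). {u, v}) ?P" by (auto simp: inj_on_def doubleton_eq_iff)
    show "(\<lambda>(u, v). {u, v}) ` ?P = ?C"
    proof (intro equalityI subsetI)
      fix e assume "e \<in> ?C"
      then have e: "e \<in> E" "e \<subseteq> \<Lambda> \<union> ?D" "\<not> e \<subseteq> \<Lambda>" "\<not> e \<subseteq> ?D" by auto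
      obtain u v where uv: "e = {u, v}" using e(1) by (rule edge_cases)
      from e uv consider "u \<in> \<Lambda>" "v \<notin> \<Lambda>" | "v \<in> \<Lambda>" "u \<notin> \<Lambda>"
        using outer_disjoint[of \<Lambda>] by auto
      then show "e \<in> (\<lambda>(u, v). {u, v}) ` ?P"
      proof cases
        case 1
        then show ?thesis using uv e(1) by (intro image_eqI[of _ _ "(u, v)"]) auto
      next
        case 2
        then show ?thesis using uv e(1) by (intro image_eqI[of _ _ "(v, u)"]) (auto simp: insert_commute)
      qed
    next
      fix e assume "e \<in> (\<lambda>(u, v). {u, v}) ` ?P"
      then show "e \<in> ?C" using PD outer_disjoint[of \<Lambda>] by fastforce
    qed
  qed
  have split: "{e \<in> E. e \<subseteq> \<Lambda> \<union> ?D} = ({e \<in> E. e \<subseteq> \<Lambda>} \<union> ?C) \<union> {e \<in> E. e \<subseteq> ?D}"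
    by auto
  have disj: "{e \<in> E. e \<subseteq> \<Lambda>} \<inter> ?C = {}" "({e \<in> E. e \<subseteq> \<Lambda>} \<union> ?C) \<inter> {e \<in> E. e \<subseteq> ?D} = {}"
    using outer_disjoint[of \<Lambda>] by (auto elim!: edge_cases)
  have finE: "finite {e \<in> E. e \<subseteq> \<Lambda>}" "finite ?C" "finite {e \<in> E. e \<subseteq> ?D}"
    using finite_edges_in[OF fin, of E] finite_edges_in[OF finite_outer[OF fin], of E]
    by (auto intro: finite_subset[OF _ finite_edges_in[OF fin', of E]])
  have "inner_energy E (\<Lambda> \<union> ?D) ?\<sigma> = sum ?f {e \<in> E. e \<subseteq> \<Lambda>} + sum ?f ?C + sum ?f {e \<in> E. e \<subseteq> ?D}"
    unfolding inner_energy_def split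
    by (subst sum.union_disjoint[OF _ _ disj(2)], simp add: finE, rule finE,
        subst sum.union_disjoint[OF _ _ disj(1)], rule finE, rule finE, rule refl)
  moreover have "sum ?f {e \<in> E. e \<subseteq> \<Lambda>} = inner_energy E \<Lambda> s"
    using inner_energy_cong[of \<Lambda> ?\<sigma> s E] \<sigma>\<Lambda> by (simp add: inner_energy_def)
  moreover have "sum ?f {e \<in> E. e \<subseteq> ?D} = inner_energy E ?D t"
    using inner_energy_cong[of ?D ?\<sigma> t E] \<sigma>D by (simp add: inner_energy_def)
  moreover have "sum ?f ?C = (\<Sum>p\<in>?P. ?f (case p of (u, v) \<Rightarrow> {u, v}))"
    by (rule sum.reindex_bij_betw[OF bij, symmetric])
  moreover have "\<dots> = boundary_energy E \<Lambda> t s"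
    unfolding boundary_energy_def
  proof (rule sum.cong[OF refl])
    fix p assume "p \<in> ?P"
    then obtain u v where p: "p = (u, v)" "u \<in> \<Lambda>" "v \<notin> \<Lambda>" "adj u v" by blast
    have "?\<sigma> u = s u" "?\<sigma> v = t v" using \<sigma>\<Lambda>[OF p(2)] \<sigma>D[OF PD[OF p(2-4)]] .
    then show "?f (case p of (u, v) \<Rightarrow> {u, v}) = (case p of (u, v) \<Rightarrow> of_bool (s u = t v))"
      using p(1) by auto
  qed
  ultimately show ?thesis by simp
qed

lemma emeasure_potts_restrict:
  assumes "finite \<Lambda>" "S \<subseteq> configs q \<Lambda>"
  shows "emeasure (potts E q \<beta> \<Lambda> (restrict \<eta> (outer \<Lambda>))) S = emeasure (potts E q \<beta> \<Lambda> \<eta>) S"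
proof -
  have "boundary_energy E \<Lambda> (restrict \<eta> (outer \<Lambda>)) \<sigma> = boundary_energy E \<Lambda> \<eta> \<sigma>" for \<sigma>
  proof -
    have "v \<in> outer \<Lambda>" if "u \<in> \<Lambda>" "v \<notin> \<Lambda>" "adj u v" for u v using that by (auto simp: outer_def)
    then show ?thesis unfolding boundary_energy_def by (intro sum.cong) auto
  qed
  then show ?thesis by (simp add: emeasure_potts assms)
qed

text \<open>In the window enlarged by its outer boundary, any two configurations of
  \<open>\<Lambda>\<close> with the same boundary spins \<open>t\<close> form an exchangeable pair.
  Summing the balance relation over one of them produces the normalizing constant, so the joint mass
  \<open>m s t\<close> is the Potts probability of \<open>s\<close> given \<open>t\<close> times the
  mass of \<open>t\<close>.\<close>

lemma balanced_gibbs: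
  assumes prob: "config_prob q \<nu>" and bal: "balanced E q \<beta> \<nu>"
  shows "\<nu> \<in> gibbs E q \<beta>"
  unfolding gibbs_def
proof (intro CollectI conjI prob allI impI)
  fix \<Lambda> :: "'v set" and S assume fin: "finite \<Lambda>" and S: "S \<subseteq> configs q \<Lambda>"
  let ?D = "outer \<Lambda>"
  define m where "m s t = emeasure \<nu> (cyl q (\<Lambda> \<union> ?D) {merge \<Lambda> ?D (s, t)})" for s t
  define w where "w t s = exp (\<beta> * inner_energy E \<Lambda> s + \<beta> * boundary_energy E \<Lambda> t s)" for t s
  define Z where "Z t = (\<Sum>s\<in>configs q \<Lambda>. w t s)" for t
  have sets: "sets \<nu> = sets (config_space q)" and space: "space \<nu> = space (config_space q)"
    using config_probD[OF prob] by auto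
  have finD: "finite ?D" using finite_outer[OF fin] .
  note marg = emeasure_cyl_merge[OF sets fin finD outer_disjoint, folded m_def]
  have ratio: "ennreal (w t s') * m s t = ennreal (w t s) * m s' t"
    if s: "s \<in> configs q \<Lambda>" "s' \<in> configs q \<Lambda>" and t: "t \<in> configs q ?D" for s s' t
  proof -
    let ?x = "merge \<Lambda> ?D (s, t)" and ?y = "merge \<Lambda> ?D (s', t)"
    have "exchangeable E q (\<Lambda> \<union> ?D) ?x ?y"
      unfolding exchangeable_def using fin finD merge_in_configs[OF s(1) t] merge_in_configs[OF s(2) t]
      by (auto simp: merge_def outer_def)
    from balancedD[OF bal this] show ?thesis
      unfolding w_def m_def
      by (rule exp_scale_eq[rotated]) (simp add: inner_energy_merge[OF fin] algebra_simps)
  qed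
  have m_eq: "m s t = ennreal (w t s / Z t) * emeasure \<nu> (cyl q ?D {t})"
    if s: "s \<in> configs q \<Lambda>" and t: "t \<in> configs q ?D" for s t
  proof -
    have Z: "Z t > 0" unfolding Z_def
      using s finite_configs[OF fin, of q] by (intro sum_pos) (auto simp: w_def)
    have "ennreal (Z t) * m s t = (\<Sum>s'\<in>configs q \<Lambda>. ennreal (w t s') * m s t)"
    proof -
      have "ennreal (Z t) = (\<Sum>s'\<in>configs q \<Lambda>. ennreal (w t s'))"
        unfolding Z_def by (rule sum_ennreal[symmetric]) (simp add: w_def)
      then show ?thesis by (simp add: sum_distrib_right)
    qed
    also have "\<dots> = (\<Sum>s'\<in>configs q \<Lambda>. ennreal (w t s) * m s' t)"
      using ratio[OF s _ t] by (intro sum.cong) auto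
    also have "\<dots> = ennreal (w t s) * emeasure \<nu> (cyl q ?D {t})"
      by (simp add: marg(2)[OF t] sum_distrib_left)
    finally have "ennreal (1 / Z t) * (ennreal (Z t) * m s t) = ennreal (1 / Z t) * (ennreal (w t s) * emeasure \<nu> (cyl q ?D {t}))"
      by simp
    moreover have "ennreal (1 / Z t) * ennreal (Z t) = 1"
      using Z by (simp flip: ennreal_mult)
    moreover have "ennreal (1 / Z t) * ennreal (w t s) = ennreal (w t s / Z t)"
      using Z by (simp add: w_def flip: ennreal_mult)
    ultimately show ?thesis by (simp flip: mult.assoc)
  qed
  \<comment> \<open>The kernel sees \<open>\<eta>\<close> only on the finite outer boundary, so the
    integral becomes a finite sum; exactly one \<open>t\<close> contributes for each
    \<open>\<eta>\<close>.\<close>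
  have potts: "emeasure (potts E q \<beta> \<Lambda> \<eta>) S = (\<Sum>t\<in>configs q ?D. emeasure (potts E q \<beta> \<Lambda> t) S * indicator (cyl q ?D {t}) \<eta>)"
    if \<eta>: "\<eta> \<in> space \<nu>" for \<eta>
  proof -
    have r: "restrict \<eta> ?D \<in> configs q ?D" using \<eta> restrict_in_configs[of \<eta> q ?D] unfolding space by blast
    have "(\<Sum>t\<in>configs q ?D. emeasure (potts E q \<beta> \<Lambda> t) S * indicator (cyl q ?D {t}) \<eta>)
       = (\<Sum>t\<in>{restrict \<eta> ?D}. emeasure (potts E q \<beta> \<Lambda> t) S * indicator (cyl q ?D {t}) \<eta>)"
      using r finite_configs[OF finD]
      by (intro sum.mono_neutral_right) (auto simp: cyl_def indicator_def)
    also have "\<dots> = emeasure (potts E q \<beta> \<Lambda> \<eta>) S"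
      using \<eta> space emeasure_potts_restrict[OF fin S] by (simp add: cyl_def)
    finally show ?thesis ..
  qed
  have "(\<integral>\<^sup>+\<eta>. emeasure (potts E q \<beta> \<Lambda> \<eta>) S \<partial>\<nu>)
     = (\<integral>\<^sup>+\<eta>. (\<Sum>t\<in>configs q ?D. emeasure (potts E q \<beta> \<Lambda> t) S * indicator (cyl q ?D {t}) \<eta>) \<partial>\<nu>)"
    using potts by (intro nn_integral_cong) auto
  also have "\<dots> = (\<Sum>t\<in>configs q ?D. emeasure (potts E q \<beta> \<Lambda> t) S * emeasure \<nu> (cyl q ?D {t}))"
    using sets_cyl[OF finD, of q] sets by (simp add: nn_integral_sum nn_integral_cmult_indicator)
  also have "\<dots> = (\<Sum>t\<in>configs q ?D. \<Sum>s\<in>S. m s t)"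
    using S by (intro sum.cong) (auto simp: emeasure_potts[OF fin S] sum_distrib_right m_eq w_def Z_def subset_iff)
  also have "\<dots> = (\<Sum>s\<in>S. \<Sum>t\<in>configs q ?D. m s t)" by (rule sum.swap)
  also have "\<dots> = emeasure \<nu> (cyl q \<Lambda> S)"
    using S by (subst emeasure_cyl_sum[OF sets fin S], intro sum.cong) (auto simp: marg(1))
  finally show "emeasure \<nu> (cyl q \<Lambda> S) = (\<integral>\<^sup>+\<eta>. emeasure (potts E q \<beta> \<Lambda> \<eta>) S \<partial>\<nu>)" ..
qed

lemma countable_local_events: "countable (local_events q :: ('v \<Rightarrow> nat) set set)"
proof -
  have fin: "countable {\<Lambda> :: 'v set. finite \<Lambda>}"
    using countable_Collect_finite_subset[OF countable_vertices] by simp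
  have "local_events q = (\<Union>\<Lambda>\<in>{\<Lambda> :: 'v set. finite \<Lambda>}. cyl q \<Lambda> ` Pow (configs q \<Lambda>))"
    unfolding local_events_def by blast
  then show ?thesis
    by (simp only:) (intro countable_UN fin countable_image countable_finite, simp add: finite_configs)
qed

subsection \<open>Events and densities invariant under local modifications\<close>

text \<open>Invariance under finite modifications replaces membership in a tail sigma-algebra. It is
  required almost everywhere, with an exceptional set depending on the modification, because
  densities are determined only up to null sets. The value type is free so that densities and
  membership predicates are covered alike.\<close>

definition tail_invariant :: "nat \<Rightarrow> ('v \<Rightarrow> nat) measure \<Rightarrow> (('v \<Rightarrow> nat) \<Rightarrow> 'b) \<Rightarrow> bool" where
  "tail_invariant q \<nu> f \<longleftrightarrow> (\<forall>\<Lambda> s s'. exchangeable E q \<Lambda> s s' \<longrightarrow>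
     (AE \<omega> in \<nu>. \<omega> \<in> cyl q \<Lambda> {s'} \<longrightarrow> f (impose \<Lambda> s \<omega>) = f \<omega>))"

text \<open>Overwriting moves the part of one cylinder inside \<open>D\<close> to the part of the
  other inside \<open>D\<close>, up to null sets. Conditioning on \<open>D\<close> therefore divides
  both sides of each balance relation by the same constant.\<close>

lemma gibbs_uniform_measure:
  assumes \<nu>: "\<nu> \<in> gibbs E q \<beta>" and D: "D \<in> sets (config_space q)" "emeasure \<nu> D \<noteq> 0"
    and inv: "tail_invariant q \<nu> (\<lambda>\<omega>. \<omega> \<in> D)"
  shows "uniform_measure \<nu> D \<in> gibbs E q \<beta>"
proof (rule balanced_gibbs)
  have prob: "config_prob q \<nu>" and bal: "balanced E q \<beta> \<nu>"
    using \<nu> gibbs_config_prob gibbs_balanced by blast+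
  interpret \<nu>: prob_space \<nu> using config_probD[OF prob] by simp
  have sets: "sets \<nu> = sets (config_space q)" using config_probD[OF prob] by simp
  have space: "space \<nu> = space (config_space q)" using config_probD[OF prob] by simp
  show "config_prob q (uniform_measure \<nu> D)"
    using D sets unfolding config_prob_def by (auto intro!: prob_space_uniform_measure)
  show "balanced E q \<beta> (uniform_measure \<nu> D)"
    unfolding balanced_def
  proof (intro allI impI)
    fix \<Lambda> s s' assume ex: "exchangeable E q \<Lambda> s s'"
    then have fin: "finite \<Lambda>" and s: "s \<in> configs q \<Lambda>" unfolding exchangeable_def by auto
    have cyl: "cyl q \<Lambda> S \<in> sets \<nu>" for S using sets_cyl[OF fin] sets by simp
    have imp: "cyl q \<Lambda> {s'} \<inter> impose \<Lambda> s -` D \<in> sets \<nu>"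
    proof -
      have "cyl q \<Lambda> {s'} \<inter> impose \<Lambda> s -` D = cyl q \<Lambda> {s'} \<inter> (impose \<Lambda> s -` D \<inter> space (config_space q))"
        using cyl_subset_space by auto
      also have "\<dots> \<in> sets \<nu>"
        using measurable_sets[OF measurable_impose[OF s] D(1)] cyl sets by auto
      finally show ?thesis .
    qed
    have "emeasure \<nu> (cyl q \<Lambda> {s'} \<inter> impose \<Lambda> s -` D) = emeasure \<nu> (cyl q \<Lambda> {s'} \<inter> D)"
    proof (rule emeasure_eq_AE)
      from inv ex have "AE \<omega> in \<nu>. \<omega> \<in> cyl q \<Lambda> {s'} \<longrightarrow> (impose \<Lambda> s \<omega> \<in> D) = (\<omega> \<in> D)"
        unfolding tail_invariant_def by blast
      then show "AE \<omega> in \<nu>. (\<omega> \<in> cyl q \<Lambda> {s'} \<inter> impose \<Lambda> s -` D) = (\<omega> \<in> cyl q \<Lambda> {s'} \<inter> D)"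
        by eventually_elim auto
    qed (use imp cyl D sets in auto)
    then have "ennreal (exp (\<beta> * inner_energy E \<Lambda> s')) * emeasure \<nu> (cyl q \<Lambda> {s} \<inter> D)
        = ennreal (exp (\<beta> * inner_energy E \<Lambda> s)) * emeasure \<nu> (cyl q \<Lambda> {s'} \<inter> D)"
      using balanced_emeasure[OF simple prob bal ex D(1)] by simp
    then show "ennreal (exp (\<beta> * inner_energy E \<Lambda> s')) * emeasure (uniform_measure \<nu> D) (cyl q \<Lambda> {s})
        = ennreal (exp (\<beta> * inner_energy E \<Lambda> s)) * emeasure (uniform_measure \<nu> D) (cyl q \<Lambda> {s'})"
      using D cyl sets by (simp add: ennreal_times_divide Int_commute)
  qed
qed

text \<open>Otherwise conditioning on \<open>D\<close> and on its complement would write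
  \<open>\<nu>\<close> as a proper convex combination of two distinct Gibbs measures, with weight
  \<open>\<nu>(D)\<close> on the first.\<close>

lemma ex_gibbs_zero_one:
  assumes \<nu>: "\<nu> \<in> ex_gibbs E q \<beta>" and D: "D \<in> sets (config_space q)"
    and inv: "tail_invariant q \<nu> (\<lambda>\<omega>. \<omega> \<in> D)"
  shows "(AE \<omega> in \<nu>. \<omega> \<in> D) \<or> (AE \<omega> in \<nu>. \<omega> \<notin> D)"
proof (rule ccontr)
  assume not01: "\<not> ((AE \<omega> in \<nu>. \<omega> \<in> D) \<or> (AE \<omega> in \<nu>. \<omega> \<notin> D))"
  have g: "\<nu> \<in> gibbs E q \<beta>" using \<nu> by (simp add: ex_gibbs_def)
  note prob = gibbs_config_prob[OF g]
  interpret \<nu>: prob_space \<nu> using config_probD[OF prob] by simp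
  have sets: "sets \<nu> = sets (config_space q)" and space: "space \<nu> = space (config_space q)"
    using config_probD[OF prob] by auto
  have D': "D \<in> \<nu>.events" using D sets by simp
  let ?C = "space \<nu> - D" and ?t = "\<nu>.prob D"
  have t1: "?t \<noteq> 1" using not01 D' by (simp add: \<nu>.prob_eq_1)
  have t0: "?t \<noteq> 0" using not01 D' by (simp add: \<nu>.prob_eq_0)
  have t: "0 < ?t" "?t < 1" using t0 t1 \<nu>.prob_le_1[of D] by (auto simp: zero_less_measure_iff less_le)
  have C: "?C \<in> sets (config_space q)" "emeasure \<nu> ?C \<noteq> 0"
    using D' sets t \<nu>.prob_compl[OF D'] by (auto simp: \<nu>.emeasure_eq_measure)
  have invC: "tail_invariant q \<nu> (\<lambda>\<omega>. \<omega> \<in> ?C)"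
    unfolding tail_invariant_def
  proof (intro allI impI)
    fix \<Lambda> s s' assume ex: "exchangeable E q \<Lambda> s s'"
    then have s: "s \<in> configs q \<Lambda>" unfolding exchangeable_def by auto
    from inv ex have "AE \<omega> in \<nu>. \<omega> \<in> cyl q \<Lambda> {s'} \<longrightarrow> (impose \<Lambda> s \<omega> \<in> D) = (\<omega> \<in> D)"
      unfolding tail_invariant_def by blast
    moreover have "AE \<omega> in \<nu>. \<omega> \<in> space \<nu> \<and> impose \<Lambda> s \<omega> \<in> space \<nu>"
      using impose_in_space[OF s] space by (intro AE_I2) auto
    ultimately show "AE \<omega> in \<nu>. \<omega> \<in> cyl q \<Lambda> {s'} \<longrightarrow> (impose \<Lambda> s \<omega> \<in> ?C) = (\<omega> \<in> ?C)"
      by eventually_elim auto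
  qed
  let ?\<mu>1 = "uniform_measure \<nu> D" and ?\<mu>2 = "uniform_measure \<nu> ?C"
  have "?\<mu>1 \<in> gibbs E q \<beta>" "?\<mu>2 \<in> gibbs E q \<beta>"
    using gibbs_uniform_measure[OF g D _ inv] gibbs_uniform_measure[OF g C invC] t0
    by (auto simp: \<nu>.emeasure_eq_measure)
  moreover have m: "measure (uniform_measure \<nu> X) B = \<nu>.prob (X \<inter> B) / \<nu>.prob X"
    if "X \<in> sets \<nu>" "B \<in> sets \<nu>" "\<nu>.prob X \<noteq> 0" for X B
    using that by (simp add: measure_uniform_measure \<nu>.emeasure_eq_measure)
  have "?\<mu>1 \<noteq> ?\<mu>2"
  proof
    assume "?\<mu>1 = ?\<mu>2"
    moreover have "measure ?\<mu>1 D = 1" using m[of D D] D' t by simp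
    moreover have "measure ?\<mu>2 D = 0"
      using m[of ?C D] D' C sets t \<nu>.prob_compl[OF D'] by (simp add: Int_commute)
    ultimately show False by simp
  qed
  moreover have "measure \<nu> B = ?t * measure ?\<mu>1 B + (1 - ?t) * measure ?\<mu>2 B"
    if B: "B \<in> sets (config_space q)" for B
  proof -
    have B': "B \<in> sets \<nu>" using B sets by simp
    have "B = (D \<inter> B) \<union> (?C \<inter> B)" using sets.sets_into_space[OF B'] by auto
    then have "\<nu>.prob B = \<nu>.prob (D \<inter> B) + \<nu>.prob (?C \<inter> B)"
      using D' B' by (subst \<nu>.finite_measure_Union[symmetric]) auto
    then show ?thesis
      using m[of D B] m[of ?C B] D' B' t \<nu>.prob_compl[OF D'] by simp
  qed
  ultimately have "\<exists>t::real. \<exists>\<mu>1 \<in> gibbs E q \<beta>. \<exists>\<mu>2 \<in> gibbs E q \<beta>. 0 < t \<and> t < 1 \<and> \<mu>1 \<noteq> \<mu>2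
          \<and> (\<forall>B \<in> sets (config_space q). measure \<nu> B = t * measure \<mu>1 B + (1 - t) * measure \<mu>2 B)"
    using t by (intro exI[of _ ?t] bexI[of _ ?\<mu>1] bexI[of _ ?\<mu>2]) auto
  then show False using \<nu> unfolding ex_gibbs_def by blast
qed

text \<open>Both \<open>\<mu>\<close> and the measure with density \<open>f\<close> transform under
  overwriting by the same Boltzmann factors. Comparing them, \<open>f\<close> and its overwritten
  version define the same measure on the cylinder of \<open>s'\<close>, and densities are unique
  almost everywhere.\<close>

lemma density_tail_invariant:
  assumes \<mu>: "config_prob q \<mu>" "balanced E q \<beta> \<mu>" and f: "f \<in> borel_measurable (config_space q)"
    and \<nu>: "density \<mu> f \<in> gibbs E q \<beta>"
  shows "tail_invariant q \<mu> f"
  unfolding tail_invariant_def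
proof (intro allI impI)
  fix \<Lambda> s s' assume ex: "exchangeable E q \<Lambda> s s'"
  then have fin: "finite \<Lambda>" and s: "s \<in> configs q \<Lambda>" "s' \<in> configs q \<Lambda>" unfolding exchangeable_def by auto
  interpret \<mu>: prob_space \<mu> using config_probD[OF \<mu>(1)] by simp
  have sets: "sets \<mu> = sets (config_space q)" and space: "space \<mu> = space (config_space q)"
    using config_probD[OF \<mu>(1)] by auto
  have cyl: "cyl q \<Lambda> S \<in> sets \<mu>" for S using sets_cyl[OF fin] sets by simp
  have f': "f \<in> borel_measurable \<mu>" using f measurable_cong_sets[OF sets refl] by blast
  let ?a = "ennreal (exp (\<beta> * inner_energy E \<Lambda> s'))" and ?b = "ennreal (exp (\<beta> * inner_energy E \<Lambda> s))"
  let ?\<tau> = "impose \<Lambda> s" and ?\<tau>' = "impose \<Lambda> s'"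
  have imp: "?\<tau> \<in> measurable \<mu> (config_space q)" "?\<tau>' \<in> measurable \<mu> (config_space q)"
    using measurable_impose s measurable_cong_sets[OF sets refl] by blast+
  have f\<tau>: "(\<lambda>\<omega>. f (?\<tau> \<omega>)) \<in> borel_measurable \<mu>" using measurable_compose[OF imp(1) f] .
  have "density \<mu> (\<lambda>\<omega>. f \<omega> * indicator (cyl q \<Lambda> {s'}) \<omega>) = density \<mu> (\<lambda>\<omega>. f (?\<tau> \<omega>) * indicator (cyl q \<Lambda> {s'}) \<omega>)"
    (is "?L = ?R")
  proof (rule measure_eqI)
    fix X assume "X \<in> Sigma_Algebra.sets ?L"
    then have X: "X \<in> sets \<mu>" "X \<in> sets (config_space q)" using sets by auto
    \<comment> \<open>A test function for the cylinder of \<open>s\<close>, chosen so that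
      overwriting by \<open>s\<close> turns it into the indicator of \<open>X\<close> on the
      cylinder of \<open>s'\<close>.\<close>
    define F :: "_ \<Rightarrow> ennreal" where "F \<omega> = indicator X (?\<tau>' \<omega>)" for \<omega>
    have F: "F \<in> borel_measurable (config_space q)"
      unfolding F_def using measurable_compose[OF measurable_impose[OF s(2)] borel_measurable_indicator[OF X(2)]] .
    then have F': "F \<in> borel_measurable \<mu>" using measurable_cong_sets[OF sets refl] by blast
    have F\<tau>: "(\<lambda>\<omega>. F (?\<tau> \<omega>)) \<in> borel_measurable \<mu>" using measurable_compose[OF imp(1) F] .
    have F_back: "F (?\<tau> \<omega>) = indicator X \<omega>" if "\<omega> \<in> cyl q \<Lambda> {s'}" for \<omega>
      using impose_impose[OF s(2) that] by (simp add: F_def)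
    have "?b * (\<integral>\<^sup>+\<omega>. F (?\<tau> \<omega>) * indicator (cyl q \<Lambda> {s'}) \<omega> \<partial>density \<mu> f)
        = ?a * (\<integral>\<^sup>+\<omega>. F \<omega> * indicator (cyl q \<Lambda> {s}) \<omega> \<partial>density \<mu> f)"
      using balanced_nn_integral[OF simple gibbs_config_prob[OF \<nu>] gibbs_balanced[OF \<nu>] ex F] ..
    also have "\<dots> = ?a * (\<integral>\<^sup>+\<omega>. f \<omega> * (F \<omega> * indicator (cyl q \<Lambda> {s}) \<omega>) \<partial>\<mu>)"
      using f' F' cyl by (subst nn_integral_density) auto
    also have "\<dots> = ?a * (\<integral>\<^sup>+\<omega>. (f \<omega> * F \<omega>) * indicator (cyl q \<Lambda> {s}) \<omega> \<partial>\<mu>)"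
      by (simp add: mult.assoc)
    also have "\<dots> = ?b * (\<integral>\<^sup>+\<omega>. f (?\<tau> \<omega>) * F (?\<tau> \<omega>) * indicator (cyl q \<Lambda> {s'}) \<omega> \<partial>\<mu>)"
      using balanced_nn_integral[OF simple \<mu> ex, of "\<lambda>\<omega>. f \<omega> * F \<omega>"] f F by simp
    also have "(\<integral>\<^sup>+\<omega>. F (?\<tau> \<omega>) * indicator (cyl q \<Lambda> {s'}) \<omega> \<partial>density \<mu> f)
        = (\<integral>\<^sup>+\<omega>. f \<omega> * (F (?\<tau> \<omega>) * indicator (cyl q \<Lambda> {s'}) \<omega>) \<partial>\<mu>)"
      using f' F\<tau> cyl by (subst nn_integral_density) auto
    finally have "(\<integral>\<^sup>+\<omega>. f \<omega> * (F (?\<tau> \<omega>) * indicator (cyl q \<Lambda> {s'}) \<omega>) \<partial>\<mu>)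
       = (\<integral>\<^sup>+\<omega>. f (?\<tau> \<omega>) * F (?\<tau> \<omega>) * indicator (cyl q \<Lambda> {s'}) \<omega> \<partial>\<mu>)"
      by (simp add: ennreal_mult_cancel_left ennreal_eq_0_iff)
    moreover have "(\<integral>\<^sup>+\<omega>. f \<omega> * (F (?\<tau> \<omega>) * indicator (cyl q \<Lambda> {s'}) \<omega>) \<partial>\<mu>) = emeasure ?L X"
      using X(1) f' cyl by (subst emeasure_density) (auto intro!: nn_integral_cong simp: F_back indicator_def)
    moreover have "(\<integral>\<^sup>+\<omega>. f (?\<tau> \<omega>) * F (?\<tau> \<omega>) * indicator (cyl q \<Lambda> {s'}) \<omega> \<partial>\<mu>) = emeasure ?R X"
      using X(1) f\<tau> cyl by (subst emeasure_density) (auto intro!: nn_integral_cong simp: F_back indicator_def)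
    ultimately show "emeasure ?L X = emeasure ?R X" by simp
  qed simp
  then have "AE \<omega> in \<mu>. f \<omega> * indicator (cyl q \<Lambda> {s'}) \<omega> = f (?\<tau> \<omega>) * indicator (cyl q \<Lambda> {s'}) \<omega>"
    using f' f\<tau> cyl by (intro \<mu>.density_unique) auto
  then show "AE \<omega> in \<mu>. \<omega> \<in> cyl q \<Lambda> {s'} \<longrightarrow> f (?\<tau> \<omega>) = f \<omega>"
    by eventually_elim (auto simp: indicator_def)
qed

text \<open>By tail triviality each of the two measures is carried by \<open>{f < f'}\<close> or by its complement;
  if the first is carried by \<open>{f < f'}\<close>, or the second by the complement, then the densities are
  ordered almost everywhere and hence equal.\<close>

lemma ex_gibbs_dichotomy:
  assumes \<mu>: "config_prob q \<mu>" "balanced E q \<beta> \<mu>"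
    and f: "f \<in> borel_measurable (config_space q)" "f' \<in> borel_measurable (config_space q)"
    and \<nu>: "density \<mu> f \<in> ex_gibbs E q \<beta>" "density \<mu> f' \<in> ex_gibbs E q \<beta>"
  shows "density \<mu> f = density \<mu> f' \<or> (AE \<omega> in \<mu>. f \<omega> = 0 \<or> f' \<omega> = 0)"
proof -
  have sets: "sets \<mu> = sets (config_space q)" and space: "space \<mu> = space (config_space q)"
    using config_probD[OF \<mu>(1)] by auto
  have fm: "f \<in> borel_measurable \<mu>" "f' \<in> borel_measurable \<mu>" using f measurable_cong_sets[OF sets refl] by blast+
  have g: "density \<mu> f \<in> gibbs E q \<beta>" "density \<mu> f' \<in> gibbs E q \<beta>" using \<nu> by (auto simp: ex_gibbs_def)
  have p: "prob_space (density \<mu> f)" "prob_space (density \<mu> f')"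
    using g gibbs_config_prob config_probD by blast+
  let ?D = "{\<omega> \<in> space (config_space q). f \<omega> < f' \<omega>}"
  have D: "?D \<in> Sigma_Algebra.sets (config_space q)" using f by measurable
  have AE_in: "AE \<omega> in \<mu>. \<omega> \<in> space (config_space q)" using space by (auto intro: AE_I2)
  have inv: "tail_invariant q \<mu> (\<lambda>\<omega>. \<omega> \<in> ?D)"
    unfolding tail_invariant_def
  proof (intro allI impI)
    fix \<Lambda> s s' assume ex: "exchangeable E q \<Lambda> s s'"
    then have s: "s \<in> configs q \<Lambda>" unfolding exchangeable_def by auto
    have "AE \<omega> in \<mu>. \<omega> \<in> cyl q \<Lambda> {s'} \<longrightarrow> f (impose \<Lambda> s \<omega>) = f \<omega>"
      using density_tail_invariant[OF \<mu> f(1) g(1)] ex unfolding tail_invariant_def by blast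
    moreover have "AE \<omega> in \<mu>. \<omega> \<in> cyl q \<Lambda> {s'} \<longrightarrow> f' (impose \<Lambda> s \<omega>) = f' \<omega>"
      using density_tail_invariant[OF \<mu> f(2) g(2)] ex unfolding tail_invariant_def by blast
    moreover have "AE \<omega> in \<mu>. \<omega> \<in> space \<mu> \<and> impose \<Lambda> s \<omega> \<in> space \<mu>"
      using impose_in_space[OF s] space by (intro AE_I2) auto
    ultimately show "AE \<omega> in \<mu>. \<omega> \<in> cyl q \<Lambda> {s'} \<longrightarrow> (impose \<Lambda> s \<omega> \<in> ?D) = (\<omega> \<in> ?D)"
      by eventually_elim (auto simp: space)
  qed
  \<comment> \<open>Sets that are null for \<open>\<mu>\<close> stay null for any measure with a
    density, so the exceptional sets do no harm and the zero-one law applies to both extremal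
    measures.\<close>
  have inv': "tail_invariant q (density \<mu> g) (\<lambda>\<omega>. \<omega> \<in> ?D)" if "g \<in> borel_measurable \<mu>" for g :: "_ \<Rightarrow> ennreal"
    unfolding tail_invariant_def AE_density[OF that]
  proof (intro allI impI)
    fix \<Lambda> s s' assume "exchangeable E q \<Lambda> s s'"
    then have "AE \<omega> in \<mu>. \<omega> \<in> cyl q \<Lambda> {s'} \<longrightarrow> (impose \<Lambda> s \<omega> \<in> ?D) = (\<omega> \<in> ?D)"
      using inv unfolding tail_invariant_def by blast
    then show "AE \<omega> in \<mu>. 0 < g \<omega> \<longrightarrow> \<omega> \<in> cyl q \<Lambda> {s'} \<longrightarrow> (impose \<Lambda> s \<omega> \<in> ?D) = (\<omega> \<in> ?D)"
      by (rule AE_mp) (intro AE_I2 impI, blast)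
  qed
  have "(AE \<omega> in \<mu>. 0 < f \<omega> \<longrightarrow> \<omega> \<in> ?D) \<or> (AE \<omega> in \<mu>. 0 < f \<omega> \<longrightarrow> \<omega> \<notin> ?D)"
    using ex_gibbs_zero_one[OF \<nu>(1) D inv'[OF fm(1)]] unfolding AE_density[OF fm(1)] .
  moreover have "(AE \<omega> in \<mu>. 0 < f' \<omega> \<longrightarrow> \<omega> \<in> ?D) \<or> (AE \<omega> in \<mu>. 0 < f' \<omega> \<longrightarrow> \<omega> \<notin> ?D)"
    using ex_gibbs_zero_one[OF \<nu>(2) D inv'[OF fm(2)]] unfolding AE_density[OF fm(2)] .
  ultimately consider "AE \<omega> in \<mu>. 0 < f \<omega> \<longrightarrow> \<omega> \<in> ?D" | "AE \<omega> in \<mu>. 0 < f' \<omega> \<longrightarrow> \<omega> \<notin> ?D"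
    | "AE \<omega> in \<mu>. 0 < f \<omega> \<longrightarrow> \<omega> \<notin> ?D" "AE \<omega> in \<mu>. 0 < f' \<omega> \<longrightarrow> \<omega> \<in> ?D"
    by blast
  then show ?thesis
  proof cases
    case 1
    then have "AE \<omega> in \<mu>. f \<omega> \<le> f' \<omega>"
      by eventually_elim (auto simp: less_imp_le zero_less_iff_neq_zero)
    then show ?thesis using density_eqI_le[OF fm p] by blast
  next
    case 2
    then have "AE \<omega> in \<mu>. f' \<omega> \<le> f \<omega>"
      using AE_in by eventually_elim (auto simp: not_less zero_less_iff_neq_zero)
    then show ?thesis using density_eqI_le[OF fm(2,1) p(2,1)] by simp
  next
    case 3
    then have "AE \<omega> in \<mu>. f \<omega> = 0 \<or> f' \<omega> = 0"
      by eventually_elim (auto simp: zero_less_iff_neq_zero)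
    then show ?thesis ..
  qed
qed

end

subsection \<open>Automorphisms acting on configurations\<close>

definition shift :: "('v \<Rightarrow> 'v) \<Rightarrow> ('v \<Rightarrow> nat) \<Rightarrow> ('v \<Rightarrow> nat)" where
  "shift g \<omega> = \<omega> \<circ> g"

lemma measurable_shift [measurable]: "shift g \<in> measurable (config_space q) (config_space q)"
  by (rule measurable_to_config_space) (simp add: shift_def measurable_spin)

lemma shift_inv: "bij g \<Longrightarrow> shift (inv g) (shift g \<omega>) = \<omega>" "bij g \<Longrightarrow> shift g (shift (inv g) \<omega>) = \<omega>"
  by (auto simp: shift_def fun_eq_iff bij_is_surj bij_is_inj surj_f_inv_f)

lemma shift_in_space: "\<omega> \<in> space (config_space q) \<Longrightarrow> shift g \<omega> \<in> space (config_space q)"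
  using measurable_space[OF measurable_shift] .

text \<open>\<open>shift g\<close> reads at \<open>v\<close> the spin at \<open>g v\<close>, so
  pulling an event on \<open>\<Lambda>\<close> back along it gives an event on the image of
  \<open>\<Lambda>\<close> under \<open>g\<close>. This definition moves a pattern to that
  image.\<close>

definition push :: "('v \<Rightarrow> 'v) \<Rightarrow> 'v set \<Rightarrow> ('v \<Rightarrow> nat) \<Rightarrow> ('v \<Rightarrow> nat)" where
  "push g \<Lambda> s = (\<lambda>v\<in>g ` \<Lambda>. s (inv g v))"

lemma push_apply: "inj g \<Longrightarrow> v \<in> \<Lambda> \<Longrightarrow> push g \<Lambda> s (g v) = s v"
  by (simp add: push_def)

lemma push_in_configs: "inj g \<Longrightarrow> s \<in> configs q \<Lambda> \<Longrightarrow> push g \<Lambda> s \<in> configs q (g ` \<Lambda>)"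
  by (auto simp: push_def)

lemma shift_vimage_cyl:
  assumes "inj g" "s \<in> configs q \<Lambda>"
  shows "shift g -` cyl q \<Lambda> {s} \<inter> space (config_space q) = cyl q (g ` \<Lambda>) {push g \<Lambda> s}"
  unfolding cyl_singleton[OF push_in_configs[OF assms]] cyl_singleton[OF assms(2)]
  using shift_in_space by (auto simp: push_apply assms) (auto simp: shift_def)

lemma shift_vimage_cyl_set:
  "shift g -` cyl q \<Lambda> S \<inter> space (config_space q)
    = cyl q (g ` \<Lambda>) {t \<in> configs q (g ` \<Lambda>). restrict (t \<circ> g) \<Lambda> \<in> S}"
proof -
  have "restrict (restrict \<omega> (g ` \<Lambda>) \<circ> g) \<Lambda> = restrict (shift g \<omega>) \<Lambda>" for \<omega>
    by (auto simp: shift_def restrict_def)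
  then show ?thesis
    using shift_in_space[of _ q g] restrict_in_configs[of _ q "g ` \<Lambda>"] unfolding cyl_def
    by (intro set_eqI) (simp, blast)
qed

lemma config_prob_distr_shift:
  assumes "config_prob q \<nu>"
  shows "config_prob q (distr \<nu> (config_space q) (shift g))"
proof -
  interpret prob_space \<nu> using config_probD[OF assms] by simp
  have "shift g \<in> measurable \<nu> (config_space q)"
    using measurable_shift measurable_cong_sets[OF config_probD(2)[OF assms] refl] by blast
  then show ?thesis unfolding config_prob_def by (simp add: prob_space_distr)
qed

lemma emeasure_distr_shift:
  assumes "config_prob q \<nu>" "B \<in> sets (config_space q)"
  shows "emeasure (distr \<nu> (config_space q) (shift g)) B = emeasure \<nu> (shift g -` B \<inter> space (config_space q))"
proof -
  have "shift g \<in> measurable \<nu> (config_space q)"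
    using measurable_shift measurable_cong_sets[OF config_probD(2)[OF assms(1)] refl] by blast
  from emeasure_distr[OF this assms(2)] show ?thesis by (simp add: config_probD(3)[OF assms(1)])
qed

lemma distr_shift_inv:
  assumes "config_prob q \<nu>" "bij g"
  shows "distr (distr \<nu> (config_space q) (shift g)) (config_space q) (shift (inv g)) = \<nu>"
proof -
  have m: "shift g \<in> measurable \<nu> (config_space q)"
    using measurable_shift measurable_cong_sets[OF config_probD(2)[OF assms(1)] refl] by blast
  have "distr (distr \<nu> (config_space q) (shift g)) (config_space q) (shift (inv g))
    = distr \<nu> (config_space q) (shift (inv g) \<circ> shift g)"
    by (rule distr_distr[OF measurable_shift m])
  also have "shift (inv g) \<circ> shift g = (\<lambda>\<omega>. \<omega>)"
    using shift_inv[OF assms(2)] by auto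
  also have "distr \<nu> (config_space q) (\<lambda>\<omega>. \<omega>) = \<nu>"
    using config_probD(2)[OF assms(1)] by (intro distr_id2) simp
  finally show ?thesis .
qed

context regular_tree
begin

definition automorphism :: "('v \<Rightarrow> 'v) \<Rightarrow> bool" where
  "automorphism g \<longleftrightarrow> bij g \<and> (\<forall>u v. adj (g u) (g v) \<longleftrightarrow> adj u v)"

lemma automorphism_aut: "automorphism (aut r x)"
  by (simp add: automorphism_def bij_aut adj_aut)

lemma automorphism_inv:
  assumes "automorphism g" shows "automorphism (inv g)"
proof -
  have "bij g" using assms by (simp add: automorphism_def)
  moreover have "adj (inv g u) (inv g v) \<longleftrightarrow> adj u v" for u v
  proof -
    have "adj (g (inv g u)) (g (inv g v)) \<longleftrightarrow> adj (inv g u) (inv g v)"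
      using assms by (simp add: automorphism_def)
    then show ?thesis using \<open>bij g\<close> by (simp add: bij_is_surj surj_f_inv_f)
  qed
  ultimately show ?thesis by (simp add: automorphism_def bij_imp_bij_inv)
qed

lemma inner_energy_push:
  assumes g: "automorphism g"
  shows "inner_energy E (g ` \<Lambda>) (push g \<Lambda> s) = inner_energy E \<Lambda> s"
proof -
  have bij: "bij g" and adj: "\<And>u v. adj (g u) (g v) \<longleftrightarrow> adj u v"
    using g by (auto simp: automorphism_def)
  then have inj: "inj g" by (simp add: bij_is_inj)
  have img: "g ` e \<in> E \<longleftrightarrow> e \<in> E" for e
  proof
    show "g ` e \<in> E" if "e \<in> E"
      using that by (rule edge_cases) (use that adj in auto)
    assume "g ` e \<in> E"
    then obtain x y where xy: "g ` e = {x, y}" by (rule edge_cases)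
    then have "e = {inv g x, inv g y}"
      using inj by (metis image_insert image_empty image_inv_f_f)
    moreover have "g (inv g x) = x" "g (inv g y) = y" using bij by (auto simp: bij_is_surj surj_f_inv_f)
    ultimately show "e \<in> E" using adj[of "inv g x" "inv g y"] xy \<open>g ` e \<in> E\<close> by simp
  qed
  have "bij_betw ((`) g) {e \<in> E. e \<subseteq> \<Lambda>} {e \<in> E. e \<subseteq> g ` \<Lambda>}"
  proof (rule bij_betw_imageI)
    show "inj_on ((`) g) {e \<in> E. e \<subseteq> \<Lambda>}" using inj by (simp add: inj_on_def inj_image_eq_iff)
    show "(`) g ` {e \<in> E. e \<subseteq> \<Lambda>} = {e \<in> E. e \<subseteq> g ` \<Lambda>}"
    proof (intro equalityI subsetI)
      fix e assume e: "e \<in> {e \<in> E. e \<subseteq> g ` \<Lambda>}"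
      then obtain e' where "e' \<subseteq> \<Lambda>" "e = g ` e'" by (auto simp: subset_image_iff)
      then show "e \<in> (`) g ` {e \<in> E. e \<subseteq> \<Lambda>}" using e img by auto
    qed (use img in auto)
  qed
  from sum.reindex_bij_betw[OF this, of "\<lambda>e. of_bool (\<forall>u\<in>e. \<forall>v\<in>e. push g \<Lambda> s u = push g \<Lambda> s v)", symmetric]
  show ?thesis unfolding inner_energy_def
  proof (rule trans)
    show "(\<Sum>e\<in>{e \<in> E. e \<subseteq> \<Lambda>}. of_bool (\<forall>u\<in>g ` e. \<forall>v\<in>g ` e. push g \<Lambda> s u = push g \<Lambda> s v))
      = (\<Sum>e\<in>{e \<in> E. e \<subseteq> \<Lambda>}. of_bool (\<forall>u\<in>e. \<forall>v\<in>e. s u = s v) :: real)"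
      using push_apply[OF inj] by (intro sum.cong refl arg_cong[of _ _ of_bool]) (auto simp: subset_iff)
  qed
qed

lemma exchangeable_push:
  assumes g: "automorphism g" and ex: "exchangeable E q \<Lambda> s s'"
  shows "exchangeable E q (g ` \<Lambda>) (push g \<Lambda> s) (push g \<Lambda> s')"
proof -
  have bij: "bij g" and adj: "\<And>u v. adj (g u) (g v) \<longleftrightarrow> adj u v"
    using g by (auto simp: automorphism_def)
  then have inj: "inj g" by (simp add: bij_is_inj)
  have "w \<in> g ` \<Lambda>" if "v \<in> \<Lambda>" "s v \<noteq> s' v" "adj (g v) w" for v w
  proof -
    obtain x where x: "w = g x" using bij by (metis bij_pointE)
    then have "x \<in> \<Lambda>" using that ex adj unfolding exchangeable_def by blast
    then show ?thesis using x by simp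
  qed
  then show ?thesis
    using ex push_in_configs[OF inj] push_apply[OF inj] unfolding exchangeable_def by auto
qed

text \<open>A balance relation of the image measure over \<open>\<Lambda>\<close> is one of
  \<open>\<nu>\<close> over the moved window: automorphisms preserve edges, hence both
  exchangeability and inner energy.\<close>

lemma gibbs_shift:
  assumes g: "automorphism g" and \<nu>: "\<nu> \<in> gibbs E q \<beta>"
  shows "distr \<nu> (config_space q) (shift g) \<in> gibbs E q \<beta>"
proof (rule balanced_gibbs)
  have inj: "inj g" using g by (auto simp: automorphism_def bij_is_inj)
  note prob = gibbs_config_prob[OF \<nu>]
  show "config_prob q (distr \<nu> (config_space q) (shift g))"
    by (rule config_prob_distr_shift[OF prob])
  have *: "emeasure (distr \<nu> (config_space q) (shift g)) (cyl q \<Lambda> {s}) = emeasure \<nu> (cyl q (g ` \<Lambda>) {push g \<Lambda> s})"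
    if "finite \<Lambda>" "s \<in> configs q \<Lambda>" for \<Lambda> s
    by (simp only: emeasure_distr_shift[OF prob sets_cyl[OF that(1)]] shift_vimage_cyl[OF inj that(2)])
  show "balanced E q \<beta> (distr \<nu> (config_space q) (shift g))"
    unfolding balanced_def
  proof (intro allI impI)
    fix \<Lambda> s s' assume ex: "exchangeable E q \<Lambda> s s'"
    then have "finite \<Lambda>" "s \<in> configs q \<Lambda>" "s' \<in> configs q \<Lambda>" unfolding exchangeable_def by auto
    then show "ennreal (exp (\<beta> * inner_energy E \<Lambda> s')) * emeasure (distr \<nu> (config_space q) (shift g)) (cyl q \<Lambda> {s}) =
        ennreal (exp (\<beta> * inner_energy E \<Lambda> s)) * emeasure (distr \<nu> (config_space q) (shift g)) (cyl q \<Lambda> {s'})"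
      using balancedD[OF gibbs_balanced[OF \<nu>] exchangeable_push[OF g ex]]
      by (simp add: * inner_energy_push[OF g])
  qed
qed

text \<open>A proper splitting of the image measure, carried back by the inverse automorphism, would
  be a proper splitting of \<open>\<nu>\<close>.\<close>

lemma ex_gibbs_shift:
  assumes g: "automorphism g" and \<nu>: "\<nu> \<in> ex_gibbs E q \<beta>"
  shows "distr \<nu> (config_space q) (shift g) \<in> ex_gibbs E q \<beta>"
proof -
  let ?S = "\<lambda>g \<nu>. distr \<nu> (config_space q) (shift g)"
  have bij: "bij g" using g by (auto simp: automorphism_def)
  have \<nu>g: "\<nu> \<in> gibbs E q \<beta>" using \<nu> by (simp add: ex_gibbs_def)
  note inv = automorphism_inv[OF g]
  have False
    if t: "0 < t" "t < 1" and \<mu>: "\<mu>1 \<in> gibbs E q \<beta>" "\<mu>2 \<in> gibbs E q \<beta>" "\<mu>1 \<noteq> \<mu>2"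
      and eq: "\<And>B. B \<in> sets (config_space q) \<Longrightarrow> measure (?S g \<nu>) B = t * measure \<mu>1 B + (1 - t) * measure \<mu>2 B"
    for t :: real and \<mu>1 \<mu>2
  proof -
    have "?S (inv g) \<mu>1 \<noteq> ?S (inv g) \<mu>2"
      using distr_shift_inv[OF gibbs_config_prob[OF \<mu>(1)] bij_imp_bij_inv[OF bij]]
        distr_shift_inv[OF gibbs_config_prob[OF \<mu>(2)] bij_imp_bij_inv[OF bij]] \<mu>(3) by metis
    moreover have "measure \<nu> B = t * measure (?S (inv g) \<mu>1) B + (1 - t) * measure (?S (inv g) \<mu>2) B"
      if B: "B \<in> sets (config_space q)" for B
    proof -
      have m: "shift (inv g) -` B \<inter> space (config_space q) \<in> sets (config_space q)"
        using measurable_sets[OF measurable_shift B] .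
      have S: "measure (?S (inv g) \<rho>) B = measure \<rho> (shift (inv g) -` B \<inter> space (config_space q))"
        if "config_prob q \<rho>" for \<rho>
        by (simp add: measure_def emeasure_distr_shift[OF that B])
      have "measure \<nu> B = measure (?S (inv g) (?S g \<nu>)) B"
        by (simp only: distr_shift_inv[OF gibbs_config_prob[OF \<nu>g] bij])
      also have "\<dots> = measure (?S g \<nu>) (shift (inv g) -` B \<inter> space (config_space q))"
        by (rule S[OF config_prob_distr_shift[OF gibbs_config_prob[OF \<nu>g]]])
      also have "\<dots> = t * measure (?S (inv g) \<mu>1) B + (1 - t) * measure (?S (inv g) \<mu>2) B"
        using eq[OF m] S[OF gibbs_config_prob[OF \<mu>(1)]] S[OF gibbs_config_prob[OF \<mu>(2)]] by simp
      finally show ?thesis .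
    qed
    ultimately show False
      using \<nu> t gibbs_shift[OF inv \<mu>(1)] gibbs_shift[OF inv \<mu>(2)] unfolding ex_gibbs_def by blast
  qed
  then show ?thesis using gibbs_shift[OF g \<nu>g] unfolding ex_gibbs_def by blast
qed

end

subsection \<open>The free state as a Markov chain on the tree\<close>

definition spin_is :: "nat \<Rightarrow> 'v \<Rightarrow> nat \<Rightarrow> ('v \<Rightarrow> nat) set" where
  "spin_is q v a = {\<omega> \<in> space (config_space q). \<omega> v = a}"

definition local_in :: "nat \<Rightarrow> 'v set \<Rightarrow> ('v \<Rightarrow> nat) set set" where
  "local_in q \<Lambda> = {cyl q \<Lambda> S | S. S \<subseteq> configs q \<Lambda>}"

lemma local_in_Int: "A \<in> local_in q \<Lambda> \<Longrightarrow> B \<in> local_in q \<Lambda> \<Longrightarrow> A \<inter> B \<in> local_in q \<Lambda>"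
proof -
  assume "A \<in> local_in q \<Lambda>" "B \<in> local_in q \<Lambda>"
  then obtain S S' where "A = cyl q \<Lambda> S" "S \<subseteq> configs q \<Lambda>" "B = cyl q \<Lambda> S'"
    unfolding local_in_def by blast
  then have "A \<inter> B = cyl q \<Lambda> (S \<inter> S')" "S \<inter> S' \<subseteq> configs q \<Lambda>" by (auto simp: cyl_Int)
  then show ?thesis unfolding local_in_def by blast
qed

lemma local_in_mono: "A \<in> local_in q \<Lambda> \<Longrightarrow> \<Lambda> \<subseteq> \<Lambda>' \<Longrightarrow> A \<in> local_in q \<Lambda>'"
proof -
  assume "A \<in> local_in q \<Lambda>" "\<Lambda> \<subseteq> \<Lambda>'"
  then obtain S where "A = cyl q \<Lambda>' {s \<in> configs q \<Lambda>'. restrict s \<Lambda> \<in> S}"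
    unfolding local_in_def using cyl_widen[OF \<open>\<Lambda> \<subseteq> \<Lambda>'\<close>, of q] by auto
  then show ?thesis unfolding local_in_def by blast
qed

lemma cyl_in_local_in: "S \<subseteq> configs q \<Lambda> \<Longrightarrow> cyl q \<Lambda> S \<in> local_in q \<Lambda>"
  unfolding local_in_def by blast

lemma spin_is_eq_cyl: "v \<in> \<Lambda> \<Longrightarrow> spin_is q v a = cyl q \<Lambda> {s \<in> configs q \<Lambda>. s v = a}"
  using restrict_in_configs[of _ q \<Lambda>] by (auto simp: spin_is_def cyl_def)

lemma spin_is_local_in: "v \<in> \<Lambda> \<Longrightarrow> spin_is q v a \<in> local_in q \<Lambda>"
  unfolding spin_is_eq_cyl by (rule cyl_in_local_in) auto

lemma spin_is_sets: "spin_is q v a \<in> sets (config_space q)"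
  unfolding spin_is_def by (rule spin_event)

lemma local_in_sets: "finite \<Lambda> \<Longrightarrow> A \<in> local_in q \<Lambda> \<Longrightarrow> A \<in> sets (config_space q)"
  using sets_cyl[of \<Lambda> q] unfolding local_in_def by auto

lemma cyl_insert:
  assumes "s \<in> configs q (insert v \<Lambda>)"
  shows "cyl q (insert v \<Lambda>) {s} = cyl q \<Lambda> {restrict s \<Lambda>} \<inter> spin_is q v (s v)"
proof -
  have "restrict s \<Lambda> \<in> configs q \<Lambda>" using assms by auto
  then show ?thesis unfolding cyl_singleton[OF assms] cyl_singleton[OF \<open>restrict s \<Lambda> \<in> configs q \<Lambda>\<close>]
    by (auto simp: spin_is_def)
qed

locale free_potts = regular_tree E d for E :: "'v set set" and d +
  fixes q :: nat and \<beta> :: real and \<mu> :: "('v \<Rightarrow> nat) measure"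
  assumes q_pos: "q \<ge> 2" and \<beta>_nonneg: "\<beta> \<ge> 0" and free: "free_state E q \<beta> \<mu>"
begin

lemma config_prob_\<mu>: "config_prob q \<mu>"
  using free by (simp add: free_state_def)

lemma sets_\<mu> [measurable_cong]: "sets \<mu> = sets (config_space q)" and space_\<mu>: "space \<mu> = space (config_space q)"
  using config_probD[OF config_prob_\<mu>] by auto

sublocale prob_space \<mu>
  using config_probD[OF config_prob_\<mu>] by simp

definition Z_free :: "'v set \<Rightarrow> real" where
  "Z_free \<Lambda> = (\<Sum>s\<in>configs q \<Lambda>. exp (\<beta> * inner_energy E \<Lambda> s))"

lemma Z_free_pos: assumes "finite \<Lambda>" shows "Z_free \<Lambda> > 0"
proof -
  have "(\<lambda>v\<in>\<Lambda>. 1) \<in> configs q \<Lambda>" using q_pos by auto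
  then have "configs q \<Lambda> \<noteq> {}" by blast
  then show ?thesis unfolding Z_free_def using finite_configs[OF assms] by (intro sum_pos) auto
qed

lemma prob_cyl_free:
  assumes "finite \<Lambda>" "connected_in E \<Lambda>" "s \<in> configs q \<Lambda>"
  shows "prob (cyl q \<Lambda> {s}) = exp (\<beta> * inner_energy E \<Lambda> s) / Z_free \<Lambda>"
proof -
  have "{\<sigma> \<in> configs q \<Lambda>. \<forall>u\<in>\<Lambda>. \<sigma> u = s u} = {s}"
    using assms(3) by (auto simp: PiE_iff extensional_def fun_eq_iff) metis
  then have "emeasure \<mu> (cyl q \<Lambda> {s}) = emeasure (potts_free E q \<beta> \<Lambda>) {s}"
    using free assms unfolding free_state_def cyl_singleton[OF assms(3)] by simp
  also have "\<dots> = ennreal (exp (\<beta> * inner_energy E \<Lambda> s) / Z_free \<Lambda>)"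
    unfolding potts_free_def normalized_def Z_free_def
    using assms finite_configs by (subst emeasure_point_measure_finite) auto
  finally show ?thesis using Z_free_pos[OF assms(1)] by (simp add: measure_def)
qed

lemma edges_insert:
  assumes "connected_in E \<Lambda>" "v \<notin> \<Lambda>" "u \<in> \<Lambda>" "adj u v"
  shows "{e \<in> E. e \<subseteq> insert v \<Lambda>} = insert {u, v} {e \<in> E. e \<subseteq> \<Lambda>}"
proof (intro equalityI subsetI)
  fix e assume "e \<in> {e \<in> E. e \<subseteq> insert v \<Lambda>}"
  then have e: "e \<in> E" "e \<subseteq> insert v \<Lambda>" by auto
  show "e \<in> insert {u, v} {e \<in> E. e \<subseteq> \<Lambda>}"
  proof (cases "v \<in> e")
    case True
    obtain x y where xy: "e = {x, y}" "x \<noteq> y" using e(1) by (rule edge_cases)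
    then obtain w where w: "e = {w, v}" "w \<noteq> v" using True by auto
    then have "w \<in> \<Lambda>" "adj w v" using e by auto
    then show ?thesis using unique_attachment[OF assms(1,2)] assms(3,4) w by blast
  qed (use e in auto)
qed (use assms in auto)

lemma inner_energy_insert:
  assumes "finite \<Lambda>" "connected_in E \<Lambda>" "v \<notin> \<Lambda>" "u \<in> \<Lambda>" "adj u v"
  shows "inner_energy E (insert v \<Lambda>) (s(v := b)) = inner_energy E \<Lambda> s + of_bool (s u = b)"
proof -
  have uv: "u \<noteq> v" using assms by auto
  have 1: "inner_energy E (insert v \<Lambda>) (s(v := b)) = of_bool (s u = b) + inner_energy E \<Lambda> (s(v := b))"
    unfolding inner_energy_def edges_insert[OF assms(2-5)]
    using assms uv finite_edges_in[OF assms(1), of E] by (subst sum.insert) auto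
  have 2: "inner_energy E \<Lambda> (s(v := b)) = inner_energy E \<Lambda> s"
    using assms by (intro inner_energy_cong) auto
  show ?thesis unfolding 1 2 by (rule add.commute)
qed

text \<open>The row sum of the weights \<open>exp (\<beta> * of_bool (a = b))\<close>: one equal
  spin contributes \<open>exp \<beta>\<close>, the other \<open>q - 1\<close> contribute 1
  each.\<close>

definition total :: real where "total = exp \<beta> - 1 + real q"

definition trans_prob :: "nat \<Rightarrow> nat \<Rightarrow> real" where
  "trans_prob a b = exp (\<beta> * of_bool (a = b)) / total"

lemma total_pos: "total > 0"
  using q_pos \<beta>_nonneg by (simp add: total_def add_nonneg_pos)

lemma trans_prob_eq: "trans_prob a b = (1 + (exp \<beta> - 1) * of_bool (a = b)) / total"
  by (auto simp: trans_prob_def)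

lemma sum_spins: "b \<in> {1..q} \<Longrightarrow> (\<Sum>a\<in>{1..q}. f a * of_bool (a = b)) = (f b :: real)"
proof -
  assume "b \<in> {1..q}"
  have "(\<Sum>a\<in>{1..q}. f a * of_bool (a = b)) = (\<Sum>a\<in>{1..q}. if a = b then f a else 0)"
    by (intro sum.cong) auto
  also have "\<dots> = f b" using \<open>b \<in> {1..q}\<close> by (subst sum.delta) auto
  finally show ?thesis .
qed

lemma sum_exp_spins: "b \<in> {1..q} \<Longrightarrow> (\<Sum>a\<in>{1..q}. exp (\<beta> * of_bool (b = a))) = total"
proof -
  assume b: "b \<in> {1..q}"
  have "exp (\<beta> * of_bool (b = a)) = 1 + (exp \<beta> - 1) * of_bool (a = b)" for a by auto
  then show ?thesis using sum_spins[OF b, of "\<lambda>_. exp \<beta> - 1"] by (simp add: sum.distrib total_def)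
qed

text \<open>The new vertex interacts with \<open>u\<close> alone, and the sum over its spins is
  \<open>total\<close> whatever the spin of \<open>u\<close>; this symmetry lets the factor come out
  of the sum.\<close>

lemma Z_free_insert:
  assumes "finite \<Lambda>" "connected_in E \<Lambda>" "v \<notin> \<Lambda>" "u \<in> \<Lambda>" "adj u v"
  shows "Z_free (insert v \<Lambda>) = Z_free \<Lambda> * total"
proof -
  have "Z_free (insert v \<Lambda>) = (\<Sum>(b, s)\<in>{1..q} \<times> configs q \<Lambda>. exp (\<beta> * inner_energy E (insert v \<Lambda>) (s(v := b))))"
    unfolding Z_free_def PiE_insert_eq
    using inj_combinator[OF assms(3), of "\<lambda>_. {1..q}"]
    by (subst sum.reindex) (auto intro!: sum.cong)
  also have "\<dots> = (\<Sum>(b, s)\<in>{1..q} \<times> configs q \<Lambda>. exp (\<beta> * inner_energy E \<Lambda> s) * exp (\<beta> * of_bool (s u = b)))"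
    by (intro sum.cong) (auto simp: inner_energy_insert[OF assms] distrib_left simp flip: exp_add)
  also have "\<dots> = (\<Sum>s\<in>configs q \<Lambda>. \<Sum>b\<in>{1..q}. exp (\<beta> * inner_energy E \<Lambda> s) * exp (\<beta> * of_bool (s u = b)))"
    by (subst sum.cartesian_product[symmetric], rule sum.swap)
  also have "\<dots> = (\<Sum>s\<in>configs q \<Lambda>. exp (\<beta> * inner_energy E \<Lambda> s) * total)"
  proof (intro sum.cong refl)
    fix s assume "s \<in> configs q \<Lambda>"
    then have "s u \<in> {1..q}" using assms by auto
    then show "(\<Sum>b\<in>{1..q}. exp (\<beta> * inner_energy E \<Lambda> s) * exp (\<beta> * of_bool (s u = b))) = exp (\<beta> * inner_energy E \<Lambda> s) * total"
      by (simp add: sum_exp_spins flip: sum_distrib_left)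
  qed
  finally show ?thesis by (simp add: Z_free_def sum_distrib_right)
qed

lemma prob_cyl_Int_sum:
  assumes "finite \<Lambda>" "S \<subseteq> configs q \<Lambda>" "B \<in> events"
  shows "prob (cyl q \<Lambda> S \<inter> B) = (\<Sum>s\<in>S. prob (cyl q \<Lambda> {s} \<inter> B))"
proof -
  have eq: "cyl q \<Lambda> S \<inter> B = (\<Union>s\<in>S. cyl q \<Lambda> {s} \<inter> B)" using assms cyl_eq_UN[of q \<Lambda> S] by auto
  have disj: "disjoint_family_on (\<lambda>s. cyl q \<Lambda> {s} \<inter> B) S" by (auto simp: disjoint_family_on_def cyl_def)
  have fin: "finite S" using finite_subset[OF assms(2) finite_configs[OF assms(1)]] .
  have "(\<lambda>s. cyl q \<Lambda> {s} \<inter> B) ` S \<subseteq> events" using assms(3) sets_cyl[OF assms(1)] sets_\<mu> by auto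
  from finite_measure_finite_Union[OF fin this disj] show ?thesis unfolding eq .
qed

text \<open>One step of the Markov chain. For a single configuration the numerator gains one edge
  factor and the partition function gains \<open>total\<close>, which is a transition probability;
  summing over the configurations that make up \<open>A\<close> with spin \<open>a\<close> at
  \<open>u\<close> gives the claim.\<close>

lemma leaf_extension:
  assumes fin: "finite \<Lambda>" and conn: "connected_in E \<Lambda>" and v: "v \<notin> \<Lambda>" and u: "u \<in> \<Lambda>" "adj u v"
    and A: "A \<in> local_in q \<Lambda>" and b: "b \<in> {1..q}"
  shows "prob (A \<inter> spin_is q u a \<inter> spin_is q v b) = prob (A \<inter> spin_is q u a) * trans_prob a b"
proof -
  have single: "prob (cyl q \<Lambda> {s} \<inter> spin_is q v b) = prob (cyl q \<Lambda> {s}) * trans_prob (s u) b"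
    if s: "s \<in> configs q \<Lambda>" for s
  proof -
    have t: "s(v := b) \<in> configs q (insert v \<Lambda>)" using s b by (auto simp: PiE_iff extensional_def)
    have "restrict (s(v := b)) \<Lambda> = s" using s v by (auto simp: PiE_iff extensional_def fun_eq_iff)
    then have "cyl q \<Lambda> {s} \<inter> spin_is q v b = cyl q (insert v \<Lambda>) {s(v := b)}"
      using cyl_insert[OF t] by simp
    then show ?thesis
      using fin u Z_free_insert[OF fin conn v u]
      by (simp add: prob_cyl_free[OF _ connected_in_insert[OF conn u] t] prob_cyl_free[OF fin conn s]
          inner_energy_insert[OF fin conn v u] trans_prob_def distrib_left exp_add)
  qed
  have "A \<inter> spin_is q u a \<in> local_in q \<Lambda>" using local_in_Int[OF A spin_is_local_in[OF u(1)]] .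
  then obtain S where S: "A \<inter> spin_is q u a = cyl q \<Lambda> S" "S \<subseteq> configs q \<Lambda>" unfolding local_in_def by blast
  have eq: "cyl q \<Lambda> {s} = {}" if "s \<in> S" "s u \<noteq> a" for s
  proof -
    have "cyl q \<Lambda> {s} \<subseteq> cyl q \<Lambda> S" using that(1) by (auto simp: cyl_def)
    then have "cyl q \<Lambda> {s} \<subseteq> spin_is q u a" unfolding S(1)[symmetric] by blast
    moreover have "\<omega> u = s u" if "\<omega> \<in> cyl q \<Lambda> {s}" for \<omega>
      using that u(1) by (auto simp: cyl_def)
    ultimately show ?thesis using that(2) unfolding spin_is_def by fastforce
  qed
  have spin_ev: "spin_is q v b \<in> events" using spin_is_sets sets_\<mu> by simp
  have "prob (A \<inter> spin_is q u a \<inter> spin_is q v b) = (\<Sum>s\<in>S. prob (cyl q \<Lambda> {s} \<inter> spin_is q v b))"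
    unfolding S(1) by (rule prob_cyl_Int_sum[OF fin S(2) spin_ev])
  also have "\<dots> = (\<Sum>s\<in>S. prob (cyl q \<Lambda> {s} \<inter> space \<mu>) * trans_prob a b)"
  proof (intro sum.cong refl)
    fix s assume s: "s \<in> S"
    have "cyl q \<Lambda> {s} \<inter> space \<mu> = cyl q \<Lambda> {s}" using cyl_subset_space space_\<mu> by blast
    then show "prob (cyl q \<Lambda> {s} \<inter> spin_is q v b) = prob (cyl q \<Lambda> {s} \<inter> space \<mu>) * trans_prob a b"
      using single[of s] eq[of s] s S(2) by (cases "s u = a") auto
  qed
  also have "\<dots> = prob (cyl q \<Lambda> S \<inter> space \<mu>) * trans_prob a b"
    using prob_cyl_Int_sum[OF fin S(2), of "space \<mu>"] by (simp add: sum_distrib_right)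
  also have "cyl q \<Lambda> S \<inter> space \<mu> = cyl q \<Lambda> S" using cyl_subset_space space_\<mu> by blast
  finally show ?thesis by (simp add: S(1))
qed

lemma prob_spin: assumes "a \<in> {1..q}" shows "prob (spin_is q y a) = 1 / q"
proof -
  define s where "s = (\<lambda>v\<in>{y}. a)"
  have s: "s \<in> configs q {y}" using assms by (auto simp: s_def)
  have "spin_is q y a = cyl q {y} {s}" unfolding cyl_singleton[OF s] by (auto simp: spin_is_def s_def)
  moreover have "inner_energy E {y} t = 0" for t
  proof -
    have "\<not> e \<subseteq> {y}" if "e \<in> E" for e using that by (rule edge_cases) auto
    then have "{e \<in> E. e \<subseteq> {y}} = {}" by blast
    then show ?thesis by (simp only: inner_energy_def sum.empty)
  qed
  moreover have "card (configs q {y}) = q" by (simp add: card_PiE)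
  ultimately show ?thesis
    using prob_cyl_free[OF _ connected_in_singleton s] by (simp add: Z_free_def)
qed

text \<open>Independence of two branches given the spin at their common vertex; the factor
  \<open>q\<close> is the reciprocal of the uniform probability of that spin. Growing the window
  from \<open>y\<close>, each new leaf multiplies both sides by the same transition
  probability.\<close>

lemma markov_property:
  assumes \<Lambda>: "finite \<Lambda>" "connected_in E \<Lambda>" and \<Delta>: "finite \<Delta>" "connected_in E \<Delta>"
    and y: "\<Lambda> \<inter> \<Delta> = {y}" and A: "A \<in> local_in q \<Lambda>" and s: "s \<in> configs q \<Delta>"
  shows "prob (A \<inter> cyl q \<Delta> {s}) = q * prob (A \<inter> spin_is q y (s y)) * prob (cyl q \<Delta> {s})"
proof -
  have y': "y \<in> \<Lambda>" "y \<in> \<Delta>" using y by auto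
  have "prob (A \<inter> cyl q \<Delta> {restrict s \<Delta>}) = q * prob (A \<inter> spin_is q y (s y)) * prob (cyl q \<Delta> {restrict s \<Delta>})"
    using \<Delta> y'(2)
  proof (induction rule: connected_induct)
    case single
    have r: "restrict s {y} \<in> configs q {y}" using s y' by auto
    have "cyl q {y} {restrict s {y}} = spin_is q y (s y)"
      unfolding cyl_singleton[OF r] by (auto simp: spin_is_def)
    moreover have "s y \<in> {1..q}" using s y' by auto
    ultimately show ?case using prob_spin[of "s y" y] q_pos by (simp only:) simp
  next
    case (insert K u v)
    let ?C = "cyl q K {restrict s K}"
    have finK: "finite K" using insert \<Delta> finite_subset by blast
    have res: "restrict s X \<in> configs q X" if "X \<subseteq> \<Delta>" for X using s that by (auto simp: PiE_iff)
    have sK: "restrict s K \<in> configs q K" "restrict s (Set.insert v K) \<in> configs q (Set.insert v K)"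
      by (rule res; use insert(1,5) in blast)+
    have C': "cyl q (Set.insert v K) {restrict s (Set.insert v K)} = ?C \<inter> spin_is q v (s v)"
    proof -
      have "restrict (restrict s (Set.insert v K)) K = restrict s K" by (auto simp: fun_eq_iff)
      then show ?thesis using cyl_insert[OF sK(2)] by (simp only:) simp
    qed
    have Cu: "?C \<inter> spin_is q u (s u) = ?C" "A \<inter> ?C \<inter> spin_is q u (s u) = A \<inter> ?C"
      unfolding cyl_singleton[OF sK(1)] using insert by (auto simp: spin_is_def)
    have b: "s v \<in> {1..q}" using s insert(5) by auto
    \<comment> \<open>The windows meet only in \<open>y\<close>, which already lies in
      \<open>K\<close>; hence \<open>v\<close> is a new leaf for \<open>\<Lambda> \<union> K\<close>
      as well as for \<open>K\<close>.\<close>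
    have "v \<notin> \<Lambda>" using insert(2,5,6) y by auto
    have 1: "prob (?C \<inter> spin_is q v (s v)) = prob ?C * trans_prob (s u) (s v)"
      using leaf_extension[OF finK insert(3) insert(6) insert(4) insert(7) cyl_in_local_in b, of "{restrict s K}" "s u"] sK Cu
      by simp
    have "?C \<in> local_in q K" by (rule cyl_in_local_in) (use sK in simp)
    then have "A \<inter> ?C \<in> local_in q (\<Lambda> \<union> K)"
      by (rule local_in_Int[OF local_in_mono[OF A Un_upper1] local_in_mono[OF _ Un_upper2]])
    then have 2: "prob (A \<inter> ?C \<inter> spin_is q v (s v)) = prob (A \<inter> ?C) * trans_prob (s u) (s v)"
      using leaf_extension[of "\<Lambda> \<union> K" v u "A \<inter> ?C" "s v" "s u"] Cu finK \<Lambda> b insert(4,6,7) \<open>v \<notin> \<Lambda>\<close>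
        connected_in_Un[OF \<Lambda>(2) insert(3) y'(1) insert(2)]
      by simp
    show ?case
      unfolding C' 1 unfolding Int_assoc[symmetric] 2 insert.IH by (simp only: mult.assoc)
  qed
  moreover have "restrict s \<Delta> = s" using s by (auto simp: PiE_iff extensional_def fun_eq_iff)
  ultimately show ?thesis by simp
qed

section \<open>Contraction along paths and decorrelation of distant balls\<close>

text \<open>The second eigenvalue of the transition matrix, which is \<open>contraction\<close>
  times the identity plus \<open>1 - contraction\<close> times the matrix with all entries
  \<open>1 / q\<close>. For \<open>\<beta> \<ge> 0\<close> it lies in \<open>[0, 1)\<close>.\<close>

definition contraction :: real where "contraction = (exp \<beta> - 1) / total"

lemma contraction_bounds: "0 \<le> contraction" "contraction < 1"
  using q_pos \<beta>_nonneg total_pos by (auto simp: contraction_def total_def)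

lemma one_minus_contraction: "1 / total = (1 - contraction) / q"
  using q_pos total_pos by (simp add: contraction_def field_simps) (simp add: total_def)

lemma sum_prob_spin:
  assumes "A \<in> events"
  shows "(\<Sum>a\<in>{1..q}. prob (A \<inter> spin_is q u a)) = prob A"
proof -
  have "A = (\<Union>a\<in>{1..q}. A \<inter> spin_is q u a)"
    using sets.sets_into_space[OF assms] unfolding space_\<mu> by (auto simp: spin_is_def in_space_config_iff subset_iff)
  moreover have "prob (\<Union>a\<in>{1..q}. A \<inter> spin_is q u a) = (\<Sum>a\<in>{1..q}. prob (A \<inter> spin_is q u a))"
  proof (rule finite_measure_finite_Union)
    show "(\<lambda>a. A \<inter> spin_is q u a) ` {1..q} \<subseteq> events"
      using assms spin_is_sets[of q u] sets_\<mu> by blast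
    show "disjoint_family_on (\<lambda>a. A \<inter> spin_is q u a) {1..q}"
      by (auto simp: disjoint_family_on_def spin_is_def)
  qed simp
  ultimately show ?thesis by metis
qed

text \<open>Each step of the path multiplies the deviation from the uniform value exactly by
  \<open>contraction\<close>, and the initial deviation is at most 1. Connectedness of the window
  swallowed so far belongs to the induction because \<open>leaf_extension\<close> needs it at the
  next step.\<close>

lemma path_decay:
  assumes fin: "finite \<Lambda>" and conn: "connected_in E \<Lambda>" and z0: "z 0 \<in> \<Lambda>"
    and adj: "\<And>k. k < n \<Longrightarrow> adj (z k) (z (Suc k))"
    and new: "\<And>k. k < n \<Longrightarrow> z (Suc k) \<notin> \<Lambda> \<union> z ` {..k}"
    and A: "A \<in> local_in q \<Lambda>" and b: "b \<in> {1..q}"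
  shows "connected_in E (\<Lambda> \<union> z ` {..n}) \<and> \<bar>prob (A \<inter> spin_is q (z n) b) - prob A / q\<bar> \<le> contraction ^ n"
  using adj new b
proof (induction n arbitrary: b)
  case 0
  have "prob A / q \<le> 1" using q_pos prob_le_1[of A] by (simp add: divide_le_eq del: prob_le_1)
  moreover have "0 \<le> prob A / q" by simp
  ultimately have "\<bar>prob (A \<inter> spin_is q (z 0) b) - prob A / q\<bar> \<le> 1"
    using prob_le_1[of "A \<inter> spin_is q (z 0) b"] measure_nonneg[of \<mu> "A \<inter> spin_is q (z 0) b"] by linarith
  then show ?case using conn z0 by (simp add: insert_absorb)
next
  case (Suc n)
  let ?L = "\<Lambda> \<union> z ` {..n}"
  have IH: "connected_in E ?L" "\<bar>prob (A \<inter> spin_is q (z n) b) - prob A / q\<bar> \<le> contraction ^ n"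
    using Suc by auto
  have adj: "adj (z n) (z (Suc n))" and new: "z (Suc n) \<notin> ?L" using Suc by auto
  have Aev: "A \<in> events" using local_in_sets[OF fin A] sets_\<mu> by simp
  have ev: "A \<inter> spin_is q (z (Suc n)) b \<in> events"
    using Aev spin_is_sets[of q "z (Suc n)" b] unfolding sets_\<mu> by (rule sets.Int)
  have AL: "A \<in> local_in q ?L" using local_in_mono[OF A] by auto
  have "prob (A \<inter> spin_is q (z (Suc n)) b)
      = (\<Sum>a\<in>{1..q}. prob (A \<inter> spin_is q (z (Suc n)) b \<inter> spin_is q (z n) a))"
    using sum_prob_spin[OF ev] by simp
  also have "\<dots> = (\<Sum>a\<in>{1..q}. prob (A \<inter> spin_is q (z n) a) * trans_prob a b)"
  proof (intro sum.cong refl)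
    fix a
    have "A \<inter> spin_is q (z (Suc n)) b \<inter> spin_is q (z n) a = A \<inter> spin_is q (z n) a \<inter> spin_is q (z (Suc n)) b"
      by blast
    then show "prob (A \<inter> spin_is q (z (Suc n)) b \<inter> spin_is q (z n) a) = prob (A \<inter> spin_is q (z n) a) * trans_prob a b"
      using leaf_extension[OF _ IH(1) new _ adj AL Suc(4), of a] fin by simp
  qed
  \<comment> \<open>The transition matrix is split into its uniform part and a multiple of the
    identity.\<close>
  also have "\<dots> = (\<Sum>a\<in>{1..q}. prob (A \<inter> spin_is q (z n) a) / total
      + contraction * (prob (A \<inter> spin_is q (z n) a) * of_bool (a = b)))"
    by (intro sum.cong refl) (simp add: trans_prob_eq contraction_def add_divide_distrib distrib_left mult_ac)
  also have "\<dots> = prob A * (1 / total) + contraction * prob (A \<inter> spin_is q (z n) b)"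
    using sum_prob_spin[OF Aev] sum_spins[OF Suc(4), of "\<lambda>a. prob (A \<inter> spin_is q (z n) a)"]
    by (simp add: sum.distrib sum_distrib_left[symmetric] sum_divide_distrib[symmetric])
  finally have "prob (A \<inter> spin_is q (z (Suc n)) b) - prob A / q
      = contraction * (prob (A \<inter> spin_is q (z n) b) - prob A / q)"
    unfolding one_minus_contraction using q_pos by (simp add: field_simps)
  then have "\<bar>prob (A \<inter> spin_is q (z (Suc n)) b) - prob A / q\<bar>
      = contraction * \<bar>prob (A \<inter> spin_is q (z n) b) - prob A / q\<bar>"
    using contraction_bounds by (simp add: abs_mult)
  also have "\<dots> \<le> contraction ^ Suc n"
    using mult_left_mono[OF IH(2) contraction_bounds(1)] by simp
  finally have "\<bar>prob (A \<inter> spin_is q (z (Suc n)) b) - prob A / q\<bar> \<le> contraction ^ Suc n" .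
  moreover have "connected_in E (\<Lambda> \<union> z ` {..Suc n})"
    using connected_in_insert[OF IH(1) _ adj] by (simp add: atMost_Suc)
  ultimately show ?case by simp
qed

text \<open>The first ball together with the ray segment leading to the second ball is a connected
  window meeting the second ball in one vertex. By the Markov property \<open>A\<close> and a
  pattern in that ball communicate only through the spin there, and \<open>path_decay\<close> bounds
  its dependence on \<open>A\<close>.\<close>

lemma decorrelation:
  assumes n: "2 * R < n" and A: "A \<in> local_in q (gball r R)" and B: "B \<in> local_in q (gball (ray r n) R)"
  shows "\<bar>prob (A \<inter> B) - prob A * prob B\<bar> \<le> q * contraction ^ (n - 2 * R)"
proof -
  \<comment> \<open>The segment runs from level \<open>R\<close>, on the rim of the first ball, to
    level \<open>R + m = n - R\<close>, at distance \<open>R\<close> from the second centre.\<close>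
  define z where "z k = ray r (R + k)" for k
  define m where "m = n - 2 * R"
  let ?\<Delta> = "gball (ray r n) R"
  let ?\<Lambda> = "gball r R \<union> z ` {..m}"
  have lev: "gdist r (z k) = R + k" for k by (simp add: z_def gdist_ray_root)
  have z0: "z 0 \<in> gball r R" using lev[of 0] by (simp add: gball_def)
  have adj: "adj (z k) (z (Suc k))" for k using adj_ray[of r "R + k"] by (simp add: z_def del: ray.simps)
  have new: "z (Suc k) \<notin> gball r R \<union> z ` {..k}" for k
  proof
    assume "z (Suc k) \<in> gball r R \<union> z ` {..k}"
    then consider "z (Suc k) \<in> gball r R" | i where "i \<le> k" "z (Suc k) = z i" by auto
    then have "gdist r (z (Suc k)) \<le> R + k"
    proof cases
      case 1
      then show ?thesis by (simp add: gball_def)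
    next
      case 2
      then show ?thesis using lev[of i] by simp
    qed
    then show False using lev[of "Suc k"] by simp
  qed
  have y: "?\<Lambda> \<inter> ?\<Delta> = {z m}"
  proof (intro equalityI subsetI)
    fix w assume w: "w \<in> ?\<Lambda> \<inter> ?\<Delta>"
    then have wD: "gdist (ray r n) w \<le> R" by (simp add: gball_def)
    have "w \<notin> gball r R"
    proof
      assume "w \<in> gball r R"
      then have "gdist r (ray r n) \<le> R + R"
        using gdist_triangle[of r "ray r n" w] wD by (simp add: gball_def gdist_sym)
      then show False using n by (simp add: gdist_ray_root)
    qed
    then obtain k where k: "k \<le> m" "w = ray r (R + k)" using w by (auto simp: z_def)
    then have "gdist (ray r n) w = n - (R + k)" using n by (simp add: gdist_ray m_def)
    then have "k = m" using wD k n by (simp add: m_def)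
    then show "w \<in> {z m}" using k by (simp add: z_def)
  next
    fix w assume "w \<in> {z m}"
    moreover have "gdist (ray r n) (z m) = R" using n by (simp add: z_def gdist_ray m_def)
    ultimately show "w \<in> ?\<Lambda> \<inter> ?\<Delta>" by (auto simp: gball_def)
  qed
  have decay: "connected_in E ?\<Lambda> \<and> \<bar>prob (A \<inter> spin_is q (z m) b) - prob A / q\<bar> \<le> contraction ^ m"
    if "b \<in> {1..q}" for b
    using path_decay[OF finite_gball connected_gball z0 adj new A that] .
  have conn: "connected_in E ?\<Lambda>" using decay[of 1] q_pos by simp
  have AL: "A \<in> local_in q ?\<Lambda>" using local_in_mono[OF A] by auto
  obtain S where S: "B = cyl q ?\<Delta> S" "S \<subseteq> configs q ?\<Delta>" using B unfolding local_in_def by blast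
  have cs: "cyl q ?\<Delta> X \<inter> space \<mu> = cyl q ?\<Delta> X" for X
    using cyl_subset_space[of q ?\<Delta> X] unfolding space_\<mu> by blast
  have Aev: "A \<in> events" using local_in_sets[OF finite_gball A] sets_\<mu> by simp
  have sum: "(\<Sum>s\<in>S. prob (cyl q ?\<Delta> {s})) = prob B"
    using prob_cyl_Int_sum[OF finite_gball S(2) sets.top] unfolding cs S(1) ..
  have AB: "prob (A \<inter> B) = (\<Sum>s\<in>S. prob (A \<inter> cyl q ?\<Delta> {s}))"
    using prob_cyl_Int_sum[OF finite_gball S(2) Aev] unfolding S(1) by (simp only: Int_commute)
  have "\<bar>prob (A \<inter> B) - prob A * prob B\<bar> = \<bar>\<Sum>s\<in>S. prob (A \<inter> cyl q ?\<Delta> {s}) - prob A * prob (cyl q ?\<Delta> {s})\<bar>"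
    by (simp add: AB sum_subtractf sum_distrib_left flip: sum)
  also have "\<dots> \<le> (\<Sum>s\<in>S. q * contraction ^ m * prob (cyl q ?\<Delta> {s}))"
  proof (rule order_trans[OF sum_abs sum_mono])
    fix s assume "s \<in> S"
    then have s: "s \<in> configs q ?\<Delta>" using S by auto
    have "z m \<in> ?\<Delta>" using y by blast
    then have b: "s (z m) \<in> {1..q}" using s by auto
    have "prob (A \<inter> cyl q ?\<Delta> {s}) - prob A * prob (cyl q ?\<Delta> {s})
        = q * (prob (A \<inter> spin_is q (z m) (s (z m))) - prob A / q) * prob (cyl q ?\<Delta> {s})"
      using markov_property[OF _ conn finite_gball connected_gball y AL s] finite_gball q_pos
      by (simp add: algebra_simps)
    then have "\<bar>prob (A \<inter> cyl q ?\<Delta> {s}) - prob A * prob (cyl q ?\<Delta> {s})\<bar>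
        = q * \<bar>prob (A \<inter> spin_is q (z m) (s (z m))) - prob A / q\<bar> * prob (cyl q ?\<Delta> {s})"
      by (simp add: abs_mult)
    also have "\<dots> \<le> q * contraction ^ m * prob (cyl q ?\<Delta> {s})"
      using decay[OF b] by (intro mult_right_mono mult_left_mono) auto
    finally show "\<bar>prob (A \<inter> cyl q ?\<Delta> {s}) - prob A * prob (cyl q ?\<Delta> {s})\<bar> \<le> q * contraction ^ m * prob (cyl q ?\<Delta> {s})" .
  qed
  also have "\<dots> = q * contraction ^ m * prob B"
    by (simp add: sum_distrib_left flip: sum)
  also have "\<dots> \<le> q * contraction ^ m"
    using contraction_bounds by (intro mult_left_le) auto
  finally show ?thesis by (simp add: m_def)
qed

end

subsection \<open>Mixing along translations\<close>

text \<open>The events \<open>A\<close> with this limit form a Dynkin class. Complements use the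
  convergence of \<open>prob (B n)\<close>; for disjoint unions, limit and series are exchanged by
  domination, the bound \<open>prob (A i)\<close> being summable.\<close>

lemma (in prob_space) mixing_extend:
  assumes G: "Int_stable G" "G \<subseteq> Pow (space M)" "events = sigma_sets (space M) G"
    and B: "\<And>n. B n \<in> events" and c: "(\<lambda>n. prob (B n)) \<longlonglongrightarrow> c"
    and base: "\<And>A. A \<in> G \<Longrightarrow> (\<lambda>n. prob (A \<inter> B n)) \<longlonglongrightarrow> prob A * c"
    and A: "A \<in> events"
  shows "(\<lambda>n. prob (A \<inter> B n)) \<longlonglongrightarrow> prob A * c"
proof -
  have "A \<in> sigma_sets (space M) G" using A G(3) by simp
  from G(1,2) this show ?thesis
  proof (induction rule: sigma_sets_induct_disjoint)
    case (basic A)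
    then show ?case by (rule base)
  next
    case empty
    show ?case by simp
  next
    case (compl A)
    then have A: "A \<in> events" using G(3) by simp
    have "prob ((space M - A) \<inter> B n) = prob (B n) - prob (A \<inter> B n)" for n
    proof -
      have "(space M - A) \<inter> B n = B n - A \<inter> B n"
        using sets.sets_into_space[OF B[of n]] by auto
      then show ?thesis using finite_measure_Diff[of "B n" "A \<inter> B n"] A B[of n] by simp
    qed
    then have "(\<lambda>n. prob ((space M - A) \<inter> B n)) \<longlonglongrightarrow> c - prob A * c"
      using tendsto_diff[OF c compl(2)] by simp
    then show ?case by (simp add: prob_compl[OF A] left_diff_distrib)
  next
    case (union A)
    then have A: "range A \<subseteq> events" using G(3) by simp
    have sums: "(\<lambda>i. prob (A i)) sums prob (\<Union>i. A i)"
      by (rule finite_measure_UNION[OF A union(1)])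
    have sumsB: "(\<lambda>i. prob (A i \<inter> B n)) sums prob ((\<Union>i. A i) \<inter> B n)" for n
    proof -
      have "range (\<lambda>i. A i \<inter> B n) \<subseteq> events" using A B[of n] by auto
      moreover have "disjoint_family (\<lambda>i. A i \<inter> B n)"
        using union(1) unfolding disjoint_family_on_def by blast
      ultimately show ?thesis using finite_measure_UNION[of "\<lambda>i. A i \<inter> B n"] by simp
    qed
    have "prob (A i \<inter> B n) \<le> prob (A i)" for i n
      using A by (intro finite_measure_mono) auto
    then have "(\<lambda>n. \<Sum>i. prob (A i \<inter> B n)) \<longlonglongrightarrow> (\<Sum>i. prob (A i) * c)"
      using union(3) sums
      by (intro tannerys_theorem[where M = "\<lambda>i. prob (A i)", THEN conjunct2, THEN conjunct2])
        (auto simp: sums_iff intro!: always_eventually)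
    moreover have "(\<Sum>i. prob (A i \<inter> B n)) = prob ((\<Union>i. A i) \<inter> B n)" for n
      using sumsB[of n] by (simp add: sums_iff)
    moreover have "(\<Sum>i. prob (A i) * c) = prob (\<Union>i. A i) * c"
      using sums_mult2[OF sums, of c] by (simp add: sums_iff)
    ultimately show ?case by simp
  qed
qed

context free_potts
begin

lemma Z_free_image:
  assumes g: "automorphism g"
  shows "Z_free (g ` \<Lambda>) = Z_free \<Lambda>"
proof -
  have inj: "inj g" using g by (auto simp: automorphism_def bij_is_inj)
  have inv_l: "restrict (push g \<Lambda> s \<circ> g) \<Lambda> = s" if "s \<in> configs q \<Lambda>" for s
    using that push_apply[OF inj, of _ \<Lambda> s] by (auto simp: fun_eq_iff PiE_iff extensional_def)
  have inv_r: "push g \<Lambda> (restrict (t \<circ> g) \<Lambda>) = t" if "t \<in> configs q (g ` \<Lambda>)" for t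
    using that inj by (auto simp: fun_eq_iff PiE_iff extensional_def push_def)
  have "restrict (t \<circ> g) \<Lambda> \<in> configs q \<Lambda>" if "t \<in> configs q (g ` \<Lambda>)" for t
    using that by auto
  then have "(\<Sum>s\<in>configs q \<Lambda>. exp (\<beta> * inner_energy E \<Lambda> s)) = Z_free (g ` \<Lambda>)"
    unfolding Z_free_def using inv_l inv_r push_in_configs[OF inj] inner_energy_push[OF g]
    by (intro sum.reindex_bij_witness[where j = "push g \<Lambda>" and i = "\<lambda>t. restrict (t \<circ> g) \<Lambda>"]) auto
  then show ?thesis by (simp add: Z_free_def)
qed

text \<open>\<open>aut r x\<close> takes balls around \<open>r\<close> to balls around
  \<open>x\<close>. Both are connected, so the finite-volume formula applies on either side with
  equal energy and partition function, and balls are cofinal among finite windows.\<close>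

lemma free_state_shift: "distr \<mu> (config_space q) (shift (aut r x)) = \<mu>"
proof (rule config_measure_eqI[where \<F> = "range (gball r)" and q = q])
  let ?g = "aut r x"
  have inj: "inj ?g" by (rule inj_aut)
  show "finite_measure (distr \<mu> (config_space q) (shift ?g))"
    using config_probD(1)[OF config_prob_distr_shift[OF config_prob_\<mu>]] by (simp add: prob_space_def)
  show "\<exists>\<Lambda>'\<in>range (gball r). finite \<Lambda>' \<and> \<Lambda> \<subseteq> \<Lambda>'" if fin: "finite \<Lambda>" for \<Lambda>
  proof -
    obtain n where "\<Lambda> \<subseteq> gball r n" using finite_subset_gball[OF fin] .
    then show ?thesis using finite_gball by blast
  qed
  fix \<Lambda> s assume "\<Lambda> \<in> range (gball r)" and s: "s \<in> configs q \<Lambda>"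
  then obtain n where L: "\<Lambda> = gball r n" by auto
  have gL: "?g ` \<Lambda> = gball x n" unfolding L by (rule aut_gball)
  have "prob (cyl q (?g ` \<Lambda>) {push ?g \<Lambda> s}) = prob (cyl q \<Lambda> {s})"
    using prob_cyl_free[of "?g ` \<Lambda>" "push ?g \<Lambda> s"] push_in_configs[OF inj s] prob_cyl_free[of \<Lambda> s] s
    by (simp add: inner_energy_push Z_free_image automorphism_aut)
      (simp add: L aut_gball finite_gball connected_gball)
  moreover have "finite \<Lambda>" unfolding L by (rule finite_gball)
  ultimately show "emeasure (distr \<mu> (config_space q) (shift ?g)) (cyl q \<Lambda> {s}) = emeasure \<mu> (cyl q \<Lambda> {s})"
    by (simp only: emeasure_distr_shift[OF config_prob_\<mu> sets_cyl] shift_vimage_cyl[OF inj s] emeasure_eq_measure)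
qed (use sets_\<mu> in simp_all)

text \<open>\<open>undefined\<close> serves as an arbitrary fixed root. The automorphisms for
  different \<open>n\<close> are chosen separately and are not powers of one map; all that matters
  is that the root is moved to distance \<open>n\<close>.\<close>

definition transl :: "nat \<Rightarrow> ('v \<Rightarrow> nat) \<Rightarrow> ('v \<Rightarrow> nat)" where
  "transl n = shift (aut undefined (ray undefined n))"

definition untransl :: "nat \<Rightarrow> ('v \<Rightarrow> nat) \<Rightarrow> ('v \<Rightarrow> nat)" where
  "untransl n = shift (inv (aut undefined (ray undefined n)))"

lemma untransl_transl [simp]: "untransl n (transl n \<omega>) = \<omega>"
  by (simp add: transl_def untransl_def shift_inv bij_aut)

lemma measurable_transl [measurable]:
  "transl n \<in> measurable \<mu> (config_space q)" "untransl n \<in> measurable \<mu> (config_space q)"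
  using measurable_shift measurable_cong_sets[OF sets_\<mu> refl] unfolding transl_def untransl_def by blast+

lemma transl_in_space: "\<omega> \<in> space \<mu> \<Longrightarrow> transl n \<omega> \<in> space \<mu>" "\<omega> \<in> space \<mu> \<Longrightarrow> untransl n \<omega> \<in> space \<mu>"
  using shift_in_space space_\<mu> by (auto simp: transl_def untransl_def)

lemma distr_transl: "distr \<mu> (config_space q) (transl n) = \<mu>"
  unfolding transl_def by (rule free_state_shift)

lemma distr_untransl: "distr \<mu> (config_space q) (untransl n) = \<mu>"
  using distr_shift_inv[OF config_prob_\<mu> bij_aut, of undefined "ray undefined n"]
  by (simp only: free_state_shift untransl_def)

lemma transl_events: "A \<in> events \<Longrightarrow> transl n -` A \<inter> space \<mu> \<in> events"
  "A \<in> events \<Longrightarrow> untransl n -` A \<inter> space \<mu> \<in> events"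
  using measurable_sets[OF measurable_transl(1), of A n] measurable_sets[OF measurable_transl(2), of A n]
  unfolding sets_\<mu> by auto

lemma prob_transl: "A \<in> events \<Longrightarrow> prob (transl n -` A \<inter> space \<mu>) = prob A"
  using measure_distr[OF measurable_transl(1), of A n] unfolding distr_transl sets_\<mu> by simp

lemma prob_untransl: "A \<in> events \<Longrightarrow> prob (untransl n -` A \<inter> space \<mu>) = prob A"
  using measure_distr[OF measurable_transl(2), of A n] unfolding distr_untransl sets_\<mu> by simp

text \<open>Invariance of \<open>\<mu>\<close> moves the translation from one event to the other,
  which gives access to the translated argument when mixing is extended.\<close>

lemma prob_transl_swap:
  assumes "A \<in> events" "B \<in> events"
  shows "prob (A \<inter> (transl n -` B \<inter> space \<mu>)) = prob (B \<inter> (untransl n -` A \<inter> space \<mu>))"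
proof -
  have "transl n -` (B \<inter> (untransl n -` A \<inter> space \<mu>)) \<inter> space \<mu> = A \<inter> (transl n -` B \<inter> space \<mu>)"
    using transl_in_space sets.sets_into_space[OF assms(1)] by auto
  then show ?thesis
    using prob_transl[of "B \<inter> (untransl n -` A \<inter> space \<mu>)" n] assms transl_events(2)[OF assms(1), of n]
    by (metis sets.Int)
qed

lemma local_event_in_gball:
  assumes "A \<in> local_events q" obtains R where "A \<in> local_in q (gball r R)"
proof -
  obtain \<Lambda> S where "A = cyl q \<Lambda> S" "finite \<Lambda>" "S \<subseteq> configs q \<Lambda>"
    using assms unfolding local_events_def by blast
  moreover obtain R where "\<Lambda> \<subseteq> gball r R" using finite_subset_gball[OF \<open>finite \<Lambda>\<close>] .
  ultimately show ?thesis using that local_in_mono[OF cyl_in_local_in] by blast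
qed

lemma mixing_local:
  assumes "A \<in> local_events q" "B \<in> local_events q"
  shows "(\<lambda>n. prob (A \<inter> (transl n -` B \<inter> space \<mu>))) \<longlonglongrightarrow> prob A * prob B"
proof -
  let ?r = "undefined :: 'v"
  obtain R1 where R1: "A \<in> local_in q (gball ?r R1)" using local_event_in_gball[OF assms(1)] .
  obtain R2 where R2: "B \<in> local_in q (gball ?r R2)" using local_event_in_gball[OF assms(2)] .
  define R where "R = max R1 R2"
  have A: "A \<in> local_in q (gball ?r R)" by (rule local_in_mono[OF R1 gball_mono]) (simp add: R_def)
  have B: "B \<in> local_in q (gball ?r R)" by (rule local_in_mono[OF R2 gball_mono]) (simp add: R_def)
  have Bev: "B \<in> events" using local_event_in_sets[OF assms(2)] sets_\<mu> by simp
  obtain S where S: "B = cyl q (gball ?r R) S" using B unfolding local_in_def by blast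
  have "transl n -` B \<inter> space \<mu> \<in> local_in q (gball (ray ?r n) R)" for n
    unfolding transl_def S space_\<mu> shift_vimage_cyl_set unfolding aut_gball
    by (rule cyl_in_local_in) auto
  from decorrelation[OF _ A this]
  have bound: "\<bar>prob (A \<inter> (transl n -` B \<inter> space \<mu>)) - prob A * prob B\<bar> \<le> q * contraction ^ (n - 2 * R)"
    if "2 * R < n" for n
    using that by (simp add: prob_transl[OF Bev])
  have "(\<lambda>n. real q * contraction ^ n) \<longlonglongrightarrow> real q * 0"
    using contraction_bounds by (intro tendsto_mult_left LIMSEQ_power_zero) simp
  then have "(\<lambda>n. real q * contraction ^ (n - 2 * R)) \<longlonglongrightarrow> 0"
    using LIMSEQ_offset[of "\<lambda>n. real q * contraction ^ (n - 2 * R)" "2 * R" 0] by simp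
  then have "(\<lambda>n. prob (A \<inter> (transl n -` B \<inter> space \<mu>)) - prob A * prob B) \<longlonglongrightarrow> 0"
    by (rule Lim_null_comparison[rotated])
      (use bound in \<open>auto intro!: eventually_sequentiallyI[of "Suc (2 * R)"]\<close>)
  then show ?thesis by (rule LIM_zero_cancel)
qed

lemma sigma_events: "events = sigma_sets (space \<mu>) (local_events q)"
  "local_events q \<subseteq> Pow (space \<mu>)"
  unfolding sets_\<mu> space_\<mu> by (rule sigma_local_events local_events_subset)+

text \<open>\<open>mixing_extend\<close> enlarges only the class of the untranslated event. It is
  therefore applied twice, with the roles exchanged by \<open>prob_transl_swap\<close> in between:
  first for local \<open>B\<close> and general \<open>A\<close>, then for general
  \<open>B\<close>.\<close>

lemma mixing:
  assumes A: "A \<in> events" and B: "B \<in> events"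
  shows "(\<lambda>n. prob (A \<inter> (transl n -` B \<inter> space \<mu>))) \<longlonglongrightarrow> prob A * prob B"
proof -
  have 1: "(\<lambda>n. prob (A \<inter> (transl n -` B \<inter> space \<mu>))) \<longlonglongrightarrow> prob A * prob B"
    if B: "B \<in> local_events q" for B :: "('v \<Rightarrow> nat) set"
  proof (rule mixing_extend[OF Int_stable_local_events sigma_events(2,1) _ _ _ A])
    have Bev: "B \<in> events" using local_event_in_sets[OF B] sets_\<mu> by simp
    then show "transl n -` B \<inter> space \<mu> \<in> events" for n by (rule transl_events)
    show "(\<lambda>n. prob (transl n -` B \<inter> space \<mu>)) \<longlonglongrightarrow> prob B" by (simp add: prob_transl[OF Bev])
  qed (rule mixing_local[OF _ B])
  have "(\<lambda>n. prob (B \<inter> (untransl n -` A \<inter> space \<mu>))) \<longlonglongrightarrow> prob B * prob A"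
  proof (rule mixing_extend[OF Int_stable_local_events sigma_events(2,1) _ _ _ B])
    show "untransl n -` A \<inter> space \<mu> \<in> events" for n using A by (rule transl_events)
    show "(\<lambda>n. prob (untransl n -` A \<inter> space \<mu>)) \<longlonglongrightarrow> prob A" by (simp add: prob_untransl[OF A])
    fix B :: "('v \<Rightarrow> nat) set" assume B: "B \<in> local_events q"
    then have "B \<in> events" using local_event_in_sets[OF B] sets_\<mu> by simp
    then show "(\<lambda>n. prob (B \<inter> (untransl n -` A \<inter> space \<mu>))) \<longlonglongrightarrow> prob B * prob A"
      using 1[OF B] by (simp add: prob_transl_swap[OF A] mult.commute)
  qed
  then show ?thesis by (simp add: prob_transl_swap[OF A B] mult.commute)
qed

section \<open>Translated densities and absolutely continuous extremal measures\<close>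

lemma distr_density_transl:
  assumes f: "f \<in> borel_measurable \<mu>"
  shows "distr (density \<mu> f) (config_space q) (transl n) = density \<mu> (\<lambda>\<omega>. f (untransl n \<omega>))"
proof (rule measure_eqI)
  fix B assume "B \<in> Sigma_Algebra.sets (distr (density \<mu> f) (config_space q) (transl n))"
  then have B: "B \<in> Sigma_Algebra.sets (config_space q)" "B \<in> events" using sets_\<mu> by auto
  have "f \<in> borel_measurable (config_space q)" using f measurable_cong_sets[OF sets_\<mu> refl] by blast
  then have fu: "(\<lambda>\<omega>. f (untransl n \<omega>)) \<in> borel_measurable \<mu>"
    using measurable_compose[OF measurable_transl(2)] by blast
  then have "(\<lambda>\<omega>. f (untransl n \<omega>) * indicator B \<omega>) \<in> borel_measurable \<mu>"
    using B(2) by measurable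
  then have fuc: "(\<lambda>\<omega>. f (untransl n \<omega>) * indicator B \<omega>) \<in> borel_measurable (distr \<mu> (config_space q) (transl n))"
    by (simp only: distr_transl)
  have "emeasure (distr (density \<mu> f) (config_space q) (transl n)) B
      = emeasure (density \<mu> f) (transl n -` B \<inter> space \<mu>)"
    using B by (subst emeasure_distr) auto
  also have "\<dots> = (\<integral>\<^sup>+\<omega>. f \<omega> * indicator (transl n -` B \<inter> space \<mu>) \<omega> \<partial>\<mu>)"
    by (rule emeasure_density[OF f transl_events(1)[OF B(2)]])
  also have "\<dots> = (\<integral>\<^sup>+\<omega>. f (untransl n (transl n \<omega>)) * indicator B (transl n \<omega>) \<partial>\<mu>)"
    by (intro nn_integral_cong) (simp add: indicator_def)
  also have "\<dots> = (\<integral>\<^sup>+\<omega>. f (untransl n \<omega>) * indicator B \<omega> \<partial>distr \<mu> (config_space q) (transl n))"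
    by (rule nn_integral_distr[OF measurable_transl(1) fuc, symmetric])
  also have "\<dots> = emeasure (density \<mu> (\<lambda>\<omega>. f (untransl n \<omega>))) B"
    unfolding distr_transl by (rule emeasure_density[OF fu B(2), symmetric])
  finally show "emeasure (distr (density \<mu> f) (config_space q) (transl n)) B
      = emeasure (density \<mu> (\<lambda>\<omega>. f (untransl n \<omega>))) B" .
qed (simp add: sets_\<mu>)

text \<open>Let \<open>f\<close> be the density of \<open>\<nu>\<close>. By mixing, \<open>{f > 0}\<close> meets its own far translates, so the
  dichotomy makes \<open>\<nu>\<close> invariant under all far translations; applying mixing to the then invariant
  event \<open>{f > 1}\<close> shows that its probability is 0 or 1, and both cases force \<open>f = 1\<close>.\<close>

lemma ex_gibbs_absolutely_continuous:
  assumes bal: "balanced E q \<beta> \<mu>" and \<nu>: "\<nu> \<in> ex_gibbs E q \<beta>" and ac: "absolutely_continuous \<mu> \<nu>"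
  shows "\<nu> = \<mu>"
proof -
  have g: "\<nu> \<in> gibbs E q \<beta>" using \<nu> by (simp add: ex_gibbs_def)
  have sets_\<nu>: "Sigma_Algebra.sets \<nu> = Sigma_Algebra.sets (config_space q)" and prob_\<nu>: "prob_space \<nu>"
    using config_probD[OF gibbs_config_prob[OF g]] by auto
  define f where "f = RN_deriv \<mu> \<nu>"
  have f: "f \<in> borel_measurable \<mu>" unfolding f_def by simp
  then have fc: "f \<in> borel_measurable (config_space q)" using measurable_cong_sets[OF sets_\<mu> refl] by blast
  have \<nu>_eq: "density \<mu> f = \<nu>"
    unfolding f_def using density_RN_deriv[OF ac] sets_\<nu> sets_\<mu> by simp
  have fu: "(\<lambda>\<omega>. f (untransl n \<omega>)) \<in> borel_measurable \<mu>" for n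
    using measurable_compose[OF measurable_transl(2) fc] .
  have fuc: "(\<lambda>\<omega>. f (untransl n \<omega>)) \<in> borel_measurable (config_space q)" for n
    using fu measurable_cong_sets[OF sets_\<mu> refl] by blast
  have shifted: "density \<mu> (\<lambda>\<omega>. f (untransl n \<omega>)) \<in> ex_gibbs E q \<beta>" for n
    using ex_gibbs_shift[OF automorphism_aut[of undefined "ray undefined n"] \<nu>] distr_density_transl[OF f, of n]
    unfolding \<nu>_eq transl_def by simp
  have dich: "\<nu> = density \<mu> (\<lambda>\<omega>. f (untransl n \<omega>)) \<or> (AE \<omega> in \<mu>. f \<omega> = 0 \<or> f (untransl n \<omega>) = 0)" for n
    using ex_gibbs_dichotomy[OF config_prob_\<mu> bal fc fuc _ shifted] \<nu> unfolding \<nu>_eq by blast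
  let ?A = "{\<omega> \<in> space \<mu>. f \<omega> > 0}" and ?D = "{\<omega> \<in> space \<mu>. f \<omega> > 1}"
  have A: "?A \<in> events" and D: "?D \<in> events" using f by measurable
  have "prob ?A \<noteq> 0"
  proof
    assume "prob ?A = 0"
    then have "AE \<omega> in \<mu>. \<omega> \<notin> ?A" using A by (simp add: prob_eq_0)
    then have "AE \<omega> in \<mu>. f \<omega> = 0" using AE_space by eventually_elim (auto simp: zero_less_iff_neq_zero)
    then have "emeasure \<nu> (space \<mu>) = 0"
      unfolding \<nu>_eq[symmetric] using f by (subst emeasure_density) (auto simp: nn_integral_0_iff_AE elim: eventually_mono)
    moreover have "space \<mu> = space \<nu>" using sets_\<nu> sets_\<mu> by (intro sets_eq_imp_space_eq) simp
    ultimately show False using prob_space.emeasure_space_1[OF prob_\<nu>] by simp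
  qed
  then have "0 < prob ?A * prob ?A" by (simp add: zero_less_measure_iff)
  from order_tendstoD(1)[OF mixing[OF A A] this]
  have inv: "eventually (\<lambda>n. AE \<omega> in \<mu>. f \<omega> = f (untransl n \<omega>)) sequentially"
  proof eventually_elim
    case (elim n)
    have "\<not> (AE \<omega> in \<mu>. f \<omega> = 0 \<or> f (untransl n \<omega>) = 0)"
    proof
      assume "AE \<omega> in \<mu>. f \<omega> = 0 \<or> f (untransl n \<omega>) = 0"
      then have "AE \<omega> in \<mu>. \<omega> \<notin> ?A \<inter> (untransl n -` ?A \<inter> space \<mu>)"
        by eventually_elim auto
      then have null: "prob (?A \<inter> (untransl n -` ?A \<inter> space \<mu>)) = 0"
        using transl_events(2)[OF A, of n] A by (subst prob_eq_0) auto
      show False using elim unfolding prob_transl_swap[OF A A] null by simp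
    qed
    then have "density \<mu> f = density \<mu> (\<lambda>\<omega>. f (untransl n \<omega>))" using dich[of n] \<nu>_eq by simp
    then show ?case by (rule density_unique[OF f fu])
  qed
  then have "eventually (\<lambda>n. prob (?D \<inter> (transl n -` ?D \<inter> space \<mu>)) = prob ?D) sequentially"
  proof eventually_elim
    case (elim n)
    have "prob (?D \<inter> (untransl n -` ?D \<inter> space \<mu>)) = prob ?D"
    proof (rule finite_measure_eq_AE)
      show "AE \<omega> in \<mu>. (\<omega> \<in> ?D \<inter> (untransl n -` ?D \<inter> space \<mu>)) = (\<omega> \<in> ?D)"
        using elim AE_space by eventually_elim (auto simp: transl_in_space)
    qed (use D transl_events(2)[OF D, of n] in auto)
    then show ?case unfolding prob_transl_swap[OF D D] .
  qed
  \<comment> \<open>The intersections eventually have constant probability \<open>prob ?D\<close>,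
    while mixing makes them converge to its square.\<close>
  then have "prob ?D = prob ?D * prob ?D"
    using LIMSEQ_unique[OF tendsto_eventually mixing[OF D D]] by blast
  then consider "prob ?D = 0" | "prob ?D = 1" by auto
  then show ?thesis
  proof cases
    case 1
    then have "AE \<omega> in \<mu>. \<omega> \<notin> ?D" using D by (simp add: prob_eq_0)
    then have "AE \<omega> in \<mu>. f \<omega> \<le> 1" using AE_space by eventually_elim auto
    from density_eqI_le[OF f _ _ _ this] show ?thesis
      using prob_\<nu> prob_space_axioms by (simp add: \<nu>_eq density_1)
  next
    case 2
    then have "AE \<omega> in \<mu>. \<omega> \<in> ?D" using D by (simp add: prob_eq_1)
    then have "AE \<omega> in \<mu>. 1 \<le> f \<omega>" by eventually_elim auto
    from density_eqI_le[OF _ f _ _ this] show ?thesis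
      using prob_\<nu> prob_space_axioms by (simp add: \<nu>_eq density_1)
  qed
qed

subsection \<open>The decomposition measure and its support\<close>

context
  fixes L :: "('v \<Rightarrow> nat) measure measure"
  assumes L: "extremal_decomposition E q \<beta> \<mu> L"
begin

lemma prob_space_L: "prob_space L"
  and sets_L: "Sigma_Algebra.sets L = Sigma_Algebra.sets (restrict_space (prob_algebra (config_space q)) (ex_gibbs E q \<beta>))"
  and emeasure_mixture: "B \<in> Sigma_Algebra.sets (config_space q) \<Longrightarrow> emeasure \<mu> B = (\<integral>\<^sup>+\<nu>. emeasure \<nu> B \<partial>L)"
  using L by (auto simp: extremal_decomposition_def)

lemma space_L: "space L = ex_gibbs E q \<beta>"
proof -
  have "\<nu> \<in> space (prob_algebra (config_space q))" if "\<nu> \<in> ex_gibbs E q \<beta>" for \<nu>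
    using config_probD[OF ex_gibbs_config_prob[OF that]] by (simp add: space_prob_algebra)
  then show ?thesis
    using sets_eq_imp_space_eq[OF sets_L] by (auto simp: space_restrict_space)
qed

lemma measurable_emeasure_L:
  assumes "B \<in> Sigma_Algebra.sets (config_space q)"
  shows "(\<lambda>\<nu>. emeasure \<nu> B) \<in> borel_measurable L"
proof -
  have "(\<lambda>\<nu>. emeasure \<nu> B) \<in> borel_measurable (prob_algebra (config_space q))"
    unfolding prob_algebra_def by (intro measurable_restrict_space1 measurable_emeasure_subprob_algebra assms)
  then have "(\<lambda>\<nu>. emeasure \<nu> B) \<in> borel_measurable (restrict_space (prob_algebra (config_space q)) (ex_gibbs E q \<beta>))"
    by (rule measurable_restrict_space1)
  then show ?thesis using measurable_cong_sets[OF sets_L refl] by blast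
qed

lemma measurable_measure_L:
  assumes "B \<in> Sigma_Algebra.sets (config_space q)"
  shows "(\<lambda>\<nu>. Sigma_Algebra.measure \<nu> B) \<in> borel_measurable L"
  unfolding Sigma_Algebra.measure_def using measurable_emeasure_L[OF assms] by measurable

text \<open>Balance relations are linear in the measure, so they pass from the extremal components
  to their mixture.\<close>

lemma balanced_\<mu>: "balanced E q \<beta> \<mu>"
  unfolding balanced_def
proof (intro allI impI)
  fix \<Lambda> s s' assume ex: "exchangeable E q \<Lambda> s s'"
  then have cyl: "cyl q \<Lambda> S \<in> Sigma_Algebra.sets (config_space q)" for S
    by (intro sets_cyl) (simp add: exchangeable_def)
  let ?a = "ennreal (exp (\<beta> * inner_energy E \<Lambda> s'))" and ?b = "ennreal (exp (\<beta> * inner_energy E \<Lambda> s))"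
  have "?a * emeasure \<mu> (cyl q \<Lambda> {s}) = (\<integral>\<^sup>+\<nu>. ?a * emeasure \<nu> (cyl q \<Lambda> {s}) \<partial>L)"
    unfolding emeasure_mixture[OF cyl] by (rule nn_integral_cmult[symmetric, OF measurable_emeasure_L[OF cyl]])
  also have "\<dots> = (\<integral>\<^sup>+\<nu>. ?b * emeasure \<nu> (cyl q \<Lambda> {s'}) \<partial>L)"
    using ex by (intro nn_integral_cong balancedD gibbs_balanced) (auto simp: space_L ex_gibbs_def)
  also have "\<dots> = ?b * emeasure \<mu> (cyl q \<Lambda> {s'})"
    unfolding emeasure_mixture[OF cyl] by (rule nn_integral_cmult[OF measurable_emeasure_L[OF cyl]])
  finally show "?a * emeasure \<mu> (cyl q \<Lambda> {s}) = ?b * emeasure \<mu> (cyl q \<Lambda> {s'})" .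
qed

text \<open>A measure is determined by its values on the countably many local events, so the
  singleton is a countable intersection of level sets of evaluation maps.\<close>

lemma singleton_sets_L:
  assumes \<nu>: "\<nu> \<in> ex_gibbs E q \<beta>"
  shows "{\<nu>} \<in> Sigma_Algebra.sets L"
proof -
  define Q where "Q A = (\<lambda>\<rho>. emeasure \<rho> A) -` {emeasure \<nu> A} \<inter> space L" for A
  have "{\<nu>} = (\<Inter>A\<in>local_events q. Q A)"
  proof (intro equalityI subsetI)
    fix \<rho> assume "\<rho> \<in> (\<Inter>A\<in>local_events q. Q A)"
    then have "\<rho> \<in> Q A" if "A \<in> local_events q" for A using that by blast
    then have \<rho>: "\<And>A. A \<in> local_events q \<Longrightarrow> emeasure \<rho> A = emeasure \<nu> A" and "\<rho> \<in> space L"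
      using space_in_local_events[of q] by (auto simp: Q_def)
    then have \<rho>e: "\<rho> \<in> ex_gibbs E q \<beta>" by (simp add: space_L)
    note pr = config_probD[OF ex_gibbs_config_prob[OF \<rho>e]] and pn = config_probD[OF ex_gibbs_config_prob[OF \<nu>]]
    have "\<rho> = \<nu>"
    proof (rule config_measure_eqI[OF pr(2) pn(2), of UNIV])
      show "finite_measure \<rho>" using pr(1) by (simp add: prob_space_def)
      show "emeasure \<rho> (cyl q \<Lambda> {s}) = emeasure \<nu> (cyl q \<Lambda> {s})" if "finite \<Lambda>" "s \<in> configs q \<Lambda>" for \<Lambda> s
        using that by (intro \<rho>) (auto simp: local_events_def)
    qed auto
    then show "\<rho> \<in> {\<nu>}" by simp
  qed (use \<nu> in \<open>simp add: space_L Q_def\<close>)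
  moreover have "Q A \<in> Sigma_Algebra.sets L" if "A \<in> local_events q" for A
    unfolding Q_def by (rule measurable_sets[OF measurable_emeasure_L[OF local_event_in_sets[OF that]]]) simp
  ultimately show ?thesis
    using sets.countable_INT'[OF countable_local_events[of q] _ image_subsetI, of Q L] space_in_local_events[of q]
    by (simp only:) blast
qed

text \<open>Keeping only the atom in the mixture shows that its weight times \<open>\<nu>\<close> is
  dominated by \<open>\<mu>\<close>.\<close>

lemma atom_absolutely_continuous:
  assumes \<nu>: "\<nu> \<in> ex_gibbs E q \<beta>" and atom: "emeasure L {\<nu>} \<noteq> 0"
  shows "absolutely_continuous \<mu> \<nu>"
  unfolding absolutely_continuous_def
proof
  fix N assume N: "N \<in> null_sets \<mu>"
  then have Ns: "N \<in> Sigma_Algebra.sets (config_space q)" using sets_\<mu> by auto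
  have "emeasure \<nu> N * emeasure L {\<nu>} = (\<integral>\<^sup>+\<rho>. emeasure \<nu> N * indicator {\<nu>} \<rho> \<partial>L)"
    using singleton_sets_L[OF \<nu>] by (rule nn_integral_cmult_indicator[symmetric])
  also have "\<dots> \<le> (\<integral>\<^sup>+\<rho>. emeasure \<rho> N \<partial>L)"
    by (intro nn_integral_mono) (auto simp: indicator_def)
  also have "\<dots> = 0" using N emeasure_mixture[OF Ns] by auto
  finally have "emeasure \<nu> N = 0" using atom by simp
  then show "N \<in> null_sets \<nu>"
    using Ns config_probD(2)[OF ex_gibbs_config_prob[OF \<nu>]] by (auto intro: null_setsI)
qed

section \<open>A countable base of the local topology\<close>

definition box :: "(('v \<Rightarrow> nat) set \<times> real \<times> real) list \<Rightarrow> ('v \<Rightarrow> nat) measure set" where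
  "box l = {\<nu> \<in> ex_gibbs E q \<beta>. \<forall>(A, a, b)\<in>set l. a < Sigma_Algebra.measure \<nu> A \<and> Sigma_Algebra.measure \<nu> A < b}"

text \<open>Finitely many strict rational bounds on local events: countably many sets, each
  measurable for \<open>L\<close>, although a general open set is not known to be.\<close>

definition rational_boxes :: "('v \<Rightarrow> nat) measure set set" where
  "rational_boxes = box ` lists (local_events q \<times> \<rat> \<times> \<rat>)"

lemma countable_rational_boxes: "countable rational_boxes"
  unfolding rational_boxes_def
  by (intro countable_image countable_lists countable_SIGMA countable_local_events countable_rat)

lemma sets_rational_box: "U \<in> rational_boxes \<Longrightarrow> U \<in> Sigma_Algebra.sets L"
proof -
  assume "U \<in> rational_boxes"
  then obtain l where l: "U = box l" "set l \<subseteq> local_events q \<times> \<rat> \<times> \<rat>" unfolding rational_boxes_def by auto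
  have "box l = {\<nu> \<in> space L. \<forall>x\<in>set l. fst (snd x) < Sigma_Algebra.measure \<nu> (fst x) \<and> Sigma_Algebra.measure \<nu> (fst x) < snd (snd x)}"
    by (auto simp: box_def space_L)
  also have "\<dots> \<in> Sigma_Algebra.sets L"
  proof (rule sets.sets_Collect_finite_All)
    fix x assume "x \<in> set l"
    then have "fst x \<in> local_events q" using l(2) by auto
    then have "fst x \<in> Sigma_Algebra.sets (config_space q)" by (rule local_event_in_sets)
    from measurable_measure_L[OF this]
    show "{\<nu> \<in> space L. fst (snd x) < Sigma_Algebra.measure \<nu> (fst x) \<and> Sigma_Algebra.measure \<nu> (fst x) < snd (snd x)} \<in> Sigma_Algebra.sets L"
      by measurable
  qed simp
  finally show ?thesis using l by simp
qed

text \<open>A basic open set of the product topology constrains finitely many coordinates; around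
  the value at \<open>\<nu>\<close>, each constraint is shrunk to an interval with rational
  ends.\<close>

lemma rational_box_between:
  assumes U: "openin (local_topology q (ex_gibbs E q \<beta>)) U" and \<nu>: "\<nu> \<in> U"
  obtains W where "W \<in> rational_boxes" "\<nu> \<in> W" "W \<subseteq> U"
proof -
  let ?m = "\<lambda>\<nu>. \<lambda>A\<in>local_events q. Sigma_Algebra.measure \<nu> A"
  obtain V where V: "openin (product_topology (\<lambda>_. euclideanreal) (local_events q)) V" "U = ?m -` V \<inter> ex_gibbs E q \<beta>"
    using U unfolding local_topology_def openin_pullback_topology by blast
  then have "?m \<nu> \<in> V" using \<nu> by auto
  from product_topology_open_contains_basis[OF V(1) this]
  obtain X where X: "?m \<nu> \<in> (\<Pi>\<^sub>E A\<in>local_events q. X A)" "\<And>A. open (X A)" "finite {A. X A \<noteq> UNIV}"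
    "(\<Pi>\<^sub>E A\<in>local_events q. X A) \<subseteq> V" by auto
  have "\<exists>a b. a \<in> \<rat> \<and> b \<in> \<rat> \<and> a < Sigma_Algebra.measure \<nu> A \<and> Sigma_Algebra.measure \<nu> A < b \<and> {a<..<b} \<subseteq> X A"
    if "A \<in> local_events q" for A
  proof -
    let ?x = "Sigma_Algebra.measure \<nu> A"
    have "?x \<in> X A" using X(1) that by auto
    then obtain e where e: "e > 0" "ball ?x e \<subseteq> X A" using X(2) by (meson openE)
    obtain a where a: "a \<in> \<rat>" "?x - e < a" "a < ?x" using Rats_dense_in_real[of "?x - e" ?x] e(1) by auto
    obtain b where b: "b \<in> \<rat>" "?x < b" "b < ?x + e" using Rats_dense_in_real[of ?x "?x + e"] e(1) by auto
    have "{a<..<b} \<subseteq> ball ?x e" using a b by (auto simp: dist_real_def)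
    then show ?thesis using a b e(2) by blast
  qed
  then obtain a b where ab: "\<And>A. A \<in> local_events q \<Longrightarrow> a A \<in> \<rat> \<and> b A \<in> \<rat> \<and>
      a A < Sigma_Algebra.measure \<nu> A \<and> Sigma_Algebra.measure \<nu> A < b A \<and> {a A<..<b A} \<subseteq> X A"
    by metis
  have "finite ({A. X A \<noteq> UNIV} \<inter> local_events q)" using X(3) by simp
  then obtain As where As: "set As = {A. X A \<noteq> UNIV} \<inter> local_events q" using finite_list by blast
  define l where "l = map (\<lambda>A. (A, a A, b A)) As"
  show thesis
  proof
    show "box l \<in> rational_boxes"
      unfolding rational_boxes_def using As ab by (intro imageI) (auto simp: l_def)
    show "\<nu> \<in> box l" using As ab V(2) \<nu> by (auto simp: box_def l_def)
    show "box l \<subseteq> U"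
    proof
      fix \<rho> assume \<rho>: "\<rho> \<in> box l"
      have "Sigma_Algebra.measure \<rho> A \<in> X A" if "A \<in> local_events q" for A
      proof (cases "X A = UNIV")
        case False
        then have "A \<in> set As" using As that by auto
        then have "a A < Sigma_Algebra.measure \<rho> A \<and> Sigma_Algebra.measure \<rho> A < b A"
          using \<rho> by (auto simp: box_def l_def)
        then show ?thesis using ab[OF that] by auto
      qed simp
      then have "?m \<rho> \<in> V" using X(4) by (auto simp: PiE_iff extensional_def)
      then show "\<rho> \<in> U" using V(2) \<rho> by (auto simp: box_def)
    qed
  qed
qed

text \<open>A countable support would be null in the absence of atoms. Every measure outside it has
  a null open neighbourhood and hence lies in a null rational box; as there are only countably many
  boxes, the whole space would be null.\<close>

lemma uncountable_support:
  assumes no_atoms: "\<And>\<nu>. \<nu> \<in> ex_gibbs E q \<beta> \<Longrightarrow> {\<nu>} \<in> null_sets L"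
  shows "uncountable (support_in (local_topology q (ex_gibbs E q \<beta>)) L)"
proof
  let ?T = "local_topology q (ex_gibbs E q \<beta>)"
  let ?S = "support_in ?T L"
  assume count: "countable ?S"
  have top: "topspace ?T = ex_gibbs E q \<beta>"
    by (auto simp: local_topology_def topspace_pullback_topology)
  have sub: "?S \<subseteq> ex_gibbs E q \<beta>" using top by (auto simp: support_in_def)
  have "(\<Union>\<nu>\<in>?S. {\<nu>}) \<in> null_sets L"
    using sub no_atoms by (intro null_sets_UN' count) auto
  moreover have "(\<Union>W\<in>rational_boxes \<inter> null_sets L. W) \<in> null_sets L"
    by (rule null_sets_UN'[OF countable_subset[OF Int_lower1 countable_rational_boxes]]) auto
  ultimately have "(\<Union>\<nu>\<in>?S. {\<nu>}) \<union> (\<Union>W\<in>rational_boxes \<inter> null_sets L. W) \<in> null_sets L"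
    by (rule null_sets.Un)
  moreover have "space L \<subseteq> (\<Union>\<nu>\<in>?S. {\<nu>}) \<union> (\<Union>W\<in>rational_boxes \<inter> null_sets L. W)"
  proof
    fix \<nu> assume \<nu>: "\<nu> \<in> space L"
    show "\<nu> \<in> (\<Union>\<nu>\<in>?S. {\<nu>}) \<union> (\<Union>W\<in>rational_boxes \<inter> null_sets L. W)"
    proof (cases "\<nu> \<in> ?S")
      case False
      then obtain U where U: "openin ?T U" "\<nu> \<in> U" "U \<in> null_sets L"
        using \<nu> top unfolding support_in_def space_L by blast
      obtain W where W: "W \<in> rational_boxes" "\<nu> \<in> W" "W \<subseteq> U"
        using rational_box_between[OF U(1,2)] .
      then have "W \<in> null_sets L" using null_sets_subset[OF U(3) sets_rational_box] by blast
      then show ?thesis using W by blast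
    qed simp
  qed
  ultimately have "space L \<in> null_sets L" using null_sets_subset sets.top by blast
  then show False using prob_space.emeasure_space_1[OF prob_space_L] by auto
qed

end

end

theorem theorem1:
  fixes E :: "'v set set" and d q :: nat and \<beta> :: real
    and \<mu> :: "('v \<Rightarrow> nat) measure" and L :: "('v \<Rightarrow> nat) measure measure"
  assumes "d \<ge> 2" and "q \<ge> 2" and "\<beta> \<ge> 0"
    and "cayley_tree d E"
    and "free_state E q \<beta> \<mu>"
    and "extremal_decomposition E q \<beta> \<mu> L"
  shows "\<mu> \<in> ex_gibbs E q \<beta>
    \<or> ((\<forall>\<nu> \<in> ex_gibbs E q \<beta>. {\<nu>} \<in> null_sets L)
       \<and> uncountable (support_in (local_topology q (ex_gibbs E q \<beta>)) L))"
proof (cases "\<mu> \<in> ex_gibbs E q \<beta>")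
  case False
  interpret free_potts E d q \<beta> \<mu>
    using assms by unfold_locales auto
  \<comment> \<open>A null set is measurable by definition, so the value 0 cannot come from the
    convention for non-measurable sets.\<close>
  have "{\<nu>} \<in> null_sets L" if \<nu>: "\<nu> \<in> ex_gibbs E q \<beta>" for \<nu>
  proof (rule null_setsI)
    show "emeasure L {\<nu>} = 0"
    proof (rule ccontr)
      assume "emeasure L {\<nu>} \<noteq> 0"
      then have "\<nu> = \<mu>"
        using ex_gibbs_absolutely_continuous[OF balanced_\<mu>[OF assms(6)] \<nu>]
          atom_absolutely_continuous[OF assms(6) \<nu>] by blast
      then show False using \<nu> False by simp
    qed
    show "{\<nu>} \<in> Sigma_Algebra.sets L" by (rule singleton_sets_L[OF assms(6) \<nu>])
  qed
  then show ?thesis using uncountable_support[OF assms(6)] by blast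
qed simp

end
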